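(* Let $P$ be a well-founded poset and let $(C,d)$ be a $P$-graded chain complex of vector spaces over a field, with a homology decomposition $\zeta^p_n\colon C^p_n\xrightarrow{\cong}H^p_n\oplus B^p_n\oplus K^p_n$ of each relative chain complex $(C^p,t^p)$. Regard $C$ as a based complex via $C_n\cong\bigoplus_{p}(H^p_n\oplus B^p_n\oplus K^p_n)$, and let $\mathsf M$ be the Morse matching consisting of all edges $(p,K_n)\rightharpoonup(p,B_{n-1})$ (with $K^p_n=B^p_{n-1}\ne0$). Then the contraction $(\widetilde f,\widetilde g,\widetilde h)$ of $(C,d)$ to $(\widetilde C,\widetilde d)$ associated with $\mathsf M$ by Sköldberg's construction is identical to the $P$-filtered contraction $(\bar\alpha,\bar\beta,\bar\gamma)$ of $(C,d)$ to $(\bar C,\bar d)$ obtained from the homology decompositions by perturbation; that is, $\widetilde C=\bar C$, $\widetilde d=\bar d$, $\widetilde f=\bar\alpha$, $\widetilde g=\bar\beta$ and $\widetilde h=\bar\gamma$. (Both constructions are described in the context.)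
   Context: A poset $P$ is well-founded if it has no infinite strictly descending sequence. Chain complexes are $\mathbb Z$-indexed complexes of vector spaces over a fixed field, with $d_n\colon C_n\to C_{n-1}$. A linear map $f$ between $P$-graded spaces $V=\bigoplus_pV^p$, $W=\bigoplus_pW^p$ is $P$-filtered if $f^{pq}=\jmath^pf\imath^q\ne0$ implies $p\le q$ ($\imath^p,\jmath^p$ inclusion and projection of the $p$-summand). $(C,d)$ is $P$-graded if each $C_n=\bigoplus_pC^p_n$ and each $d_n$ is $P$-filtered. Put $t^{pq}=\jmath^pd\imath^q$, $t^p=t^{pp}$; $(C^p,t^p)$ is the relative chain complex at $p$. A contraction of $(C,d)$ to $(C',d')$ is a triple $(f,g,h)$ with chain maps $f\colon C\to C'$, $g\colon C'\to C$ and $h_n\colon C_n\to C_{n+1}$ with $fg=1$, $gf=1+dh+hd$, $fh=0$, $hg=0$, $h^2=0$; it is $P$-filtered if $f,g,h$ are. Homology decomposition of $(C^p,t^p)$: with $B^p_n=\operatorname{im}(t^p_{n+1})$, $K^p_n:=B^p_{n-1}$, $H^p_n=H_n(C^p)$, a family of isomorphisms $\zeta^p_n\colon C^p_n\to H^p_n\oplus B^p_n\oplus K^p_n$ with $\zeta^p_{n-1}t^p_n(\zeta^p_n)^{-1}(h,b,k)=(0,k,0)$. Contraction from perturbation: $\alpha^p_n\colon C^p_n\to H^p_n$ is $\zeta^p_n$ followed by projection; $\beta^p_n\colon H^p_n\to C^p_n$ is inclusion followed by $(\zeta^p_n)^{-1}$; $\gamma^p_n\colon C^p_n\to C^p_{n+1}$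 is $-1$ times the composite of $\zeta^p_n$, projection to $B^p_n=K^p_{n+1}$, inclusion into $H^p_{n+1}\oplus B^p_{n+1}\oplus K^p_{n+1}$, and $(\zeta^p_{n+1})^{-1}$. Let $\bar C_n=\bigoplus_pH^p_n$, let $\alpha,\beta,\gamma$ be the direct sums over $p$ of $\alpha^p,\beta^p,\gamma^p$, let $\widehat d=\sum_p\imath^pt^p\jmath^p$, $\delta=d-\widehat d$, $\mathcal S_\delta=\delta(1-\gamma\delta)^{-1}=\sum_{i\ge0}\delta(\gamma\delta)^i$, and $\bar d=\alpha\mathcal S_\delta\beta$, $\bar\alpha=\alpha+\alpha\mathcal S_\delta\gamma$, $\bar\beta=\beta+\gamma\mathcal S_\delta\beta$, $\bar\gamma=\gamma+\gamma\mathcal S_\delta\gamma$. Based complex: a complex with decompositions $C_n\cong\bigoplus_{a\in I_n}C_n^{(a)}$, the index sets $I_n$ being mutually disjoint; $\imath^{(a)},\jmath^{(a)}$ are the inclusions and projections and $d^{(ab)}=\jmath^{(a)}d\,\imath^{(b)}$ for $b\in I_n,a\in I_{n-1}$. The digraph $G(C)$ has vertex set $\bigsqcup_nI_n$ and an edge $b\rightharpoonup a$ whenever $d^{(ab)}\ne0$. A partial matching $\mathsf M$ is a set of edges no two of which share a vertex; its critical set $\mathsf M^0$ is the set of indices that are neither sources nor targets of edges in $\mathsf M$, and $\mathsf M^0_n=\mathsf M^0\cap I_n$. $G(C)^{\mathsf M}$ is obtained by reversing the edges in $\mathsf M$; a reversed edge is written $a\rightharpoondown b$. $\mathsf M$ is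 a Morse matching if $d^{(ab)}$ is an isomorphism for all $(b\rightharpoonup a)\in\mathsf M$ and each $I_n$ carries a well-founded partial order $\preceq_n$ such that, for $a\neq b$ in $I_n$, any directed path $a\rightharpoonup c\rightharpoondown b$ or $a\rightharpoondown c\rightharpoonup b$ in $G(C)^{\mathsf M}$ implies $a\succ_n b$. Here the index set is $I_n=\{(p,V_n):p\in P,\ V\in\{H,B,K\}\}$ (zero summands with $V\in\{B,K\}$ discarded), with $C_n^{(p,V)}=V^p_n$; $\imath^{(p,V)}$ is inclusion into $H^p_n\oplus B^p_n\oplus K^p_n$ followed by $(\zeta^p_n)^{-1}$ and $\imath^p$, and $\jmath^{(p,V)}$ is $\jmath^p$ followed by $\zeta^p_n$ and projection. Sköldberg's construction: for a based complex with Morse matching $\mathsf M$, let $\widetilde C_n=\bigoplus_{a\in\mathsf M^0_n}C^{(a)}_n$, $f\colon C\to\widetilde C$ and $g\colon\widetilde C\to C$ the natural projection and inclusion, $h_n=-\sum_{(b\rightharpoonup a)\in\mathsf M}\imath^{(b)}_{n+1}(d^{(ab)}_{n+1})^{-1}\jmath^{(a)}_n$ and $\tau_n=\sum_{(b\rightharpoonup a)\notin\mathsf M}\imath^{(a)}_{n-1}d^{(ab)}_n\jmath^{(b)}_n$. When $h\tau$ is locally nilpotent (each vector is killed by some power), set $\mathcal S_\tau=\tau(1-h\tau)^{-1}$; the associated contraction is $\widetilde d=f\mathcal S_\tau g$, $\widetilde f=f+f\mathcal S_\tau h$, $\widetilde g=g+h\mathcal S_\tau g$, $\widetilde h=h+h\mathcal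 S_\tau h$. *)

theory Defs
  imports "HOL-Algebra.AbelCoset" "Jordan_Normal_Form.Missing_VectorSpace"
begin

section \<open>Direct sums, quotients and isomorphisms of vector spaces\<close>

text \<open>
  Vector spaces over a field \<open>K\<close> are module records satisfying \<^locale>\<open>vectorspace\<close>.  The fields
  \<open>mult\<close> and \<open>one\<close>, inherited from rings, carry no meaning for a module.  Linear maps are functions
  of which only the values on the carrier matter.
\<close>

definition lin_iso ::
  "('k, 'e) ring_scheme \<Rightarrow> ('k, 'v) module \<Rightarrow> ('k, 'w) module \<Rightarrow> ('v \<Rightarrow> 'w) \<Rightarrow> bool" where
  "lin_iso K V W f \<longleftrightarrow> linear_map K V W f \<and> bij_betw f (carrier V) (carrier W)"

definition dsum :: "'i set \<Rightarrow> ('i \<Rightarrow> ('k, 'v) module) \<Rightarrow> ('k, 'i \<Rightarrow> 'v) module" where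
  "dsum I V = \<lparr>carrier = {x \<in> \<Pi>\<^sub>E i\<in>I. carrier (V i). finite {i \<in> I. x i \<noteq> \<zero>\<^bsub>V i\<^esub>}},
     mult = (\<lambda>x y. \<lambda>i\<in>I. \<zero>\<^bsub>V i\<^esub>),
     one = (\<lambda>i\<in>I. \<zero>\<^bsub>V i\<^esub>),
     zero = (\<lambda>i\<in>I. \<zero>\<^bsub>V i\<^esub>),
     add = (\<lambda>x y. \<lambda>i\<in>I. x i \<oplus>\<^bsub>V i\<^esub> y i),
     smult = (\<lambda>c x. \<lambda>i\<in>I. c \<odot>\<^bsub>V i\<^esub> x i)\<rparr>"

definition dincl :: "'i set \<Rightarrow> ('i \<Rightarrow> ('k, 'v) module) \<Rightarrow> 'i \<Rightarrow> 'v \<Rightarrow> 'i \<Rightarrow> 'v" where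
  "dincl I V i v = (\<lambda>j\<in>I. if j = i then v else \<zero>\<^bsub>V j\<^esub>)"

definition quotient_module :: "('k, 'v) module \<Rightarrow> 'v set \<Rightarrow> ('k, 'v set) module" where
  "quotient_module V U = \<lparr>carrier = a_rcosets\<^bsub>V\<^esub> U,
     mult = (\<lambda>X Y. U),
     one = U,
     zero = U,
     add = set_add V,
     smult = (\<lambda>c X. \<Union>x\<in>X. U +>\<^bsub>V\<^esub> (c \<odot>\<^bsub>V\<^esub> x))\<rparr>"

text \<open>The structure of \<open>V\<close> carried along an injection \<open>j\<close>.\<close>

definition relabel :: "('v \<Rightarrow> 'w) \<Rightarrow> ('k, 'v) module \<Rightarrow> ('k, 'w) module" where
  "relabel j V = \<lparr>carrier = j ` carrier V,
     mult = (\<lambda>x y. j \<zero>\<^bsub>V\<^esub>),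
     one = j \<zero>\<^bsub>V\<^esub>,
     zero = j \<zero>\<^bsub>V\<^esub>,
     add = (\<lambda>x y. j (inv_into UNIV j x \<oplus>\<^bsub>V\<^esub> inv_into UNIV j y)),
     smult = (\<lambda>c x. j (c \<odot>\<^bsub>V\<^esub> inv_into UNIV j x))\<rparr>"

text \<open>
  The sum of a possibly infinite family of which only finitely many members are nonzero.  The sum
  has to be restricted to the nonzero terms because \<^const>\<open>finsum\<close> returns zero on every infinite
  index set.
\<close>

definition lfsum :: "('k, 'v) module \<Rightarrow> ('i \<Rightarrow> 'v) \<Rightarrow> 'i set \<Rightarrow> 'v" where
  "lfsum V F A = finsum V F {i \<in> A. F i \<noteq> \<zero>\<^bsub>V\<^esub>}"


section \<open>Chain complexes and contractions\<close>

definition chain_complex ::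
  "('k, 'e) ring_scheme \<Rightarrow> (int \<Rightarrow> ('k, 'x) module) \<Rightarrow> (int \<Rightarrow> 'x \<Rightarrow> 'x) \<Rightarrow> bool" where
  "chain_complex K C d \<longleftrightarrow>
     (\<forall>n. linear_map K (C n) (C (n - 1)) (d n)) \<and>
     (\<forall>n. \<forall>x\<in>carrier (C n). d (n - 1) (d n x) = \<zero>\<^bsub>C (n - 2)\<^esub>)"

definition chain_map ::
  "('k, 'e) ring_scheme \<Rightarrow> (int \<Rightarrow> ('k, 'x) module) \<Rightarrow> (int \<Rightarrow> 'x \<Rightarrow> 'x) \<Rightarrow>
   (int \<Rightarrow> ('k, 'y) module) \<Rightarrow> (int \<Rightarrow> 'y \<Rightarrow> 'y) \<Rightarrow> (int \<Rightarrow> 'x \<Rightarrow> 'y) \<Rightarrow> bool" where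
  "chain_map K C d C' d' f \<longleftrightarrow>
     (\<forall>n. linear_map K (C n) (C' n) (f n)) \<and>
     (\<forall>n. \<forall>x\<in>carrier (C n). f (n - 1) (d n x) = d' n (f n x))"

definition contraction ::
  "('k, 'e) ring_scheme \<Rightarrow> (int \<Rightarrow> ('k, 'x) module) \<Rightarrow> (int \<Rightarrow> 'x \<Rightarrow> 'x) \<Rightarrow>
   (int \<Rightarrow> ('k, 'y) module) \<Rightarrow> (int \<Rightarrow> 'y \<Rightarrow> 'y) \<Rightarrow>
   (int \<Rightarrow> 'x \<Rightarrow> 'y) \<Rightarrow> (int \<Rightarrow> 'y \<Rightarrow> 'x) \<Rightarrow> (int \<Rightarrow> 'x \<Rightarrow> 'x) \<Rightarrow> bool" where
  "contraction K C d C' d' f g h \<longleftrightarrow>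
     chain_complex K C d \<and> chain_complex K C' d' \<and>
     chain_map K C d C' d' f \<and> chain_map K C' d' C d g \<and>
     (\<forall>n. linear_map K (C n) (C (n + 1)) (h n)) \<and>
     (\<forall>n. \<forall>y\<in>carrier (C' n). f n (g n y) = y) \<and>
     (\<forall>n. \<forall>x\<in>carrier (C n).
        g n (f n x) = x \<oplus>\<^bsub>C n\<^esub> d (n + 1) (h n x) \<oplus>\<^bsub>C n\<^esub> h (n - 1) (d n x)) \<and>
     (\<forall>n. \<forall>x\<in>carrier (C n). f (n + 1) (h n x) = \<zero>\<^bsub>C' (n + 1)\<^esub>) \<and>
     (\<forall>n. \<forall>y\<in>carrier (C' n). h n (g n y) = \<zero>\<^bsub>C (n + 1)\<^esub>) \<and>
     (\<forall>n. \<forall>x\<in>carrier (C n). h (n + 1) (h n x) = \<zero>\<^bsub>C (n + 2)\<^esub>)"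


section \<open>The perturbation formulas\<close>

definition locally_nilpotent :: "('k, 'x) module \<Rightarrow> ('x \<Rightarrow> 'x) \<Rightarrow> bool" where
  "locally_nilpotent V \<psi> \<longleftrightarrow> (\<forall>x\<in>carrier V. \<exists>k. (\<psi> ^^ k) x = \<zero>\<^bsub>V\<^esub>)"

text \<open>\<open>\<tau> (1 - h \<tau>)\<^sup>-\<^sup>1\<close> in degree \<open>n\<close>, where \<open>\<tau>\<close> has degree \<open>-1\<close> and \<open>h\<close> has degree \<open>1\<close>.\<close>

definition pert_S ::
  "(int \<Rightarrow> ('k, 'x) module) \<Rightarrow> (int \<Rightarrow> 'x \<Rightarrow> 'x) \<Rightarrow> (int \<Rightarrow> 'x \<Rightarrow> 'x) \<Rightarrow> int \<Rightarrow> 'x \<Rightarrow> 'x" where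
  "pert_S C h \<tau> n x =
     \<tau> n (inv_into (carrier (C n)) (\<lambda>z. z \<ominus>\<^bsub>C n\<^esub> h (n - 1) (\<tau> n z)) x)"

definition pert_d ::
  "(int \<Rightarrow> 'x \<Rightarrow> 'y) \<Rightarrow> (int \<Rightarrow> 'y \<Rightarrow> 'x) \<Rightarrow> (int \<Rightarrow> 'x \<Rightarrow> 'x) \<Rightarrow> int \<Rightarrow> 'y \<Rightarrow> 'y" where
  "pert_d f g S n y = f (n - 1) (S n (g n y))"

definition pert_f ::
  "(int \<Rightarrow> ('k, 'y) module) \<Rightarrow> (int \<Rightarrow> 'x \<Rightarrow> 'y) \<Rightarrow> (int \<Rightarrow> 'x \<Rightarrow> 'x) \<Rightarrow> (int \<Rightarrow> 'x \<Rightarrow> 'x) \<Rightarrow>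
   int \<Rightarrow> 'x \<Rightarrow> 'y" where
  "pert_f C' f h S n x = f n x \<oplus>\<^bsub>C' n\<^esub> f n (S (n + 1) (h n x))"

definition pert_g ::
  "(int \<Rightarrow> ('k, 'x) module) \<Rightarrow> (int \<Rightarrow> 'y \<Rightarrow> 'x) \<Rightarrow> (int \<Rightarrow> 'x \<Rightarrow> 'x) \<Rightarrow> (int \<Rightarrow> 'x \<Rightarrow> 'x) \<Rightarrow>
   int \<Rightarrow> 'y \<Rightarrow> 'x" where
  "pert_g C g h S n y = g n y \<oplus>\<^bsub>C n\<^esub> h (n - 1) (S n (g n y))"

definition pert_h ::
  "(int \<Rightarrow> ('k, 'x) module) \<Rightarrow> (int \<Rightarrow> 'x \<Rightarrow> 'x) \<Rightarrow> (int \<Rightarrow> 'x \<Rightarrow> 'x) \<Rightarrow> int \<Rightarrow> 'x \<Rightarrow> 'x" where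
  "pert_h C h S n x = h n x \<oplus>\<^bsub>C (n + 1)\<^esub> h n (S (n + 1) (h n x))"


section \<open>Complexes graded by a poset\<close>

text \<open>
  A graded family \<open>C p n\<close> stands for \<open>C\<^sup>p\<^sub>n\<close>.  The poset is the type \<^typ>\<open>'p::order\<close>, and the
  projection onto the summand at \<open>p\<close> is evaluation at \<open>p\<close>.
\<close>

definition total_space :: "('p \<Rightarrow> int \<Rightarrow> ('k, 'v) module) \<Rightarrow> int \<Rightarrow> ('k, 'p \<Rightarrow> 'v) module" where
  "total_space C n = dsum UNIV (\<lambda>p. C p n)"

definition gincl :: "('p \<Rightarrow> int \<Rightarrow> ('k, 'v) module) \<Rightarrow> int \<Rightarrow> 'p \<Rightarrow> 'v \<Rightarrow> 'p \<Rightarrow> 'v" where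
  "gincl C n = dincl UNIV (\<lambda>p. C p n)"

text \<open>\<open>filtered C m C' n f\<close> says that \<open>f\<close>, from \<open>total_space C m\<close> to \<open>total_space C' n\<close>, is filtered.\<close>

definition filtered ::
  "('p::order \<Rightarrow> int \<Rightarrow> ('k, 'v) module) \<Rightarrow> int \<Rightarrow> ('p \<Rightarrow> int \<Rightarrow> ('k, 'w) module) \<Rightarrow> int \<Rightarrow>
   (('p \<Rightarrow> 'v) \<Rightarrow> ('p \<Rightarrow> 'w)) \<Rightarrow> bool" where
  "filtered C m C' n f \<longleftrightarrow>
     (\<forall>p q. (\<exists>v\<in>carrier (C q m). f (gincl C m q v) p \<noteq> \<zero>\<^bsub>C' p n\<^esub>) \<longrightarrow> p \<le> q)"

definition graded_complex ::
  "('k, 'e) ring_scheme \<Rightarrow> ('p::order \<Rightarrow> int \<Rightarrow> ('k, 'v) module) \<Rightarrow>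
   (int \<Rightarrow> ('p \<Rightarrow> 'v) \<Rightarrow> ('p \<Rightarrow> 'v)) \<Rightarrow> bool" where
  "graded_complex K C d \<longleftrightarrow>
     (\<forall>p n. vectorspace K (C p n)) \<and> chain_complex K (total_space C) d \<and>
     (\<forall>n. filtered C n C (n - 1) (d n))"

definition filtered_contraction ::
  "('k, 'e) ring_scheme \<Rightarrow>
   ('p::order \<Rightarrow> int \<Rightarrow> ('k, 'v) module) \<Rightarrow> (int \<Rightarrow> ('p \<Rightarrow> 'v) \<Rightarrow> ('p \<Rightarrow> 'v)) \<Rightarrow>
   ('p \<Rightarrow> int \<Rightarrow> ('k, 'w) module) \<Rightarrow> (int \<Rightarrow> ('p \<Rightarrow> 'w) \<Rightarrow> ('p \<Rightarrow> 'w)) \<Rightarrow>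
   (int \<Rightarrow> ('p \<Rightarrow> 'v) \<Rightarrow> ('p \<Rightarrow> 'w)) \<Rightarrow> (int \<Rightarrow> ('p \<Rightarrow> 'w) \<Rightarrow> ('p \<Rightarrow> 'v)) \<Rightarrow>
   (int \<Rightarrow> ('p \<Rightarrow> 'v) \<Rightarrow> ('p \<Rightarrow> 'v)) \<Rightarrow> bool" where
  "filtered_contraction K C d C' d' f g h \<longleftrightarrow>
     graded_complex K C d \<and> graded_complex K C' d' \<and>
     contraction K (total_space C) d (total_space C') d' f g h \<and>
     (\<forall>n. filtered C n C' n (f n)) \<and> (\<forall>n. filtered C' n C n (g n)) \<and>
     (\<forall>n. filtered C n C (n + 1) (h n))"

text \<open>The relative differential \<open>t\<^sup>p\<^sub>n\<close>, its image \<open>B\<^sup>p\<^sub>n\<close> and its homology \<open>H\<^sup>p\<^sub>n\<close>.\<close>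

definition rel_diff ::
  "('p \<Rightarrow> int \<Rightarrow> ('k, 'v) module) \<Rightarrow> (int \<Rightarrow> ('p \<Rightarrow> 'v) \<Rightarrow> ('p \<Rightarrow> 'v)) \<Rightarrow>
   'p \<Rightarrow> int \<Rightarrow> 'v \<Rightarrow> 'v" where
  "rel_diff C d p n v = d n (gincl C n p v) p"

definition Bsp ::
  "('p \<Rightarrow> int \<Rightarrow> ('k, 'v) module) \<Rightarrow> (int \<Rightarrow> ('p \<Rightarrow> 'v) \<Rightarrow> ('p \<Rightarrow> 'v)) \<Rightarrow>
   'p \<Rightarrow> int \<Rightarrow> ('k, 'v) module" where
  "Bsp C d p n = (C p n)\<lparr>carrier := rel_diff C d p (n + 1) ` carrier (C p (n + 1))\<rparr>"

definition Ksp ::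
  "('p \<Rightarrow> int \<Rightarrow> ('k, 'v) module) \<Rightarrow> (int \<Rightarrow> ('p \<Rightarrow> 'v) \<Rightarrow> ('p \<Rightarrow> 'v)) \<Rightarrow>
   'p \<Rightarrow> int \<Rightarrow> ('k, 'v) module" where
  "Ksp C d p n = Bsp C d p (n - 1)"

definition Hsp ::
  "('p \<Rightarrow> int \<Rightarrow> ('k, 'v) module) \<Rightarrow> (int \<Rightarrow> ('p \<Rightarrow> 'v) \<Rightarrow> ('p \<Rightarrow> 'v)) \<Rightarrow>
   'p \<Rightarrow> int \<Rightarrow> ('k, 'v set) module" where
  "Hsp C d p n =
     quotient_module
       ((C p n)\<lparr>carrier := a_kernel (C p n) (C p (n - 1)) (rel_diff C d p n)\<rparr>)
       (carrier (Bsp C d p n))"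

definition HBK ::
  "('p \<Rightarrow> int \<Rightarrow> ('k, 'v) module) \<Rightarrow> (int \<Rightarrow> ('p \<Rightarrow> 'v) \<Rightarrow> ('p \<Rightarrow> 'v)) \<Rightarrow>
   'p \<Rightarrow> int \<Rightarrow> ('k, 'v set \<times> 'v \<times> 'v) module" where
  "HBK C d p n = direct_sum (Hsp C d p n) (direct_sum (Bsp C d p n) (Ksp C d p n))"

definition zeta_inv ::
  "('p \<Rightarrow> int \<Rightarrow> ('k, 'v) module) \<Rightarrow> ('p \<Rightarrow> int \<Rightarrow> 'v \<Rightarrow> 'v set \<times> 'v \<times> 'v) \<Rightarrow>
   'p \<Rightarrow> int \<Rightarrow> 'v set \<times> 'v \<times> 'v \<Rightarrow> 'v" where
  "zeta_inv C \<zeta> p n = inv_into (carrier (C p n)) (\<zeta> p n)"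

definition homology_decomposition ::
  "('k, 'e) ring_scheme \<Rightarrow> ('p \<Rightarrow> int \<Rightarrow> ('k, 'v) module) \<Rightarrow>
   (int \<Rightarrow> ('p \<Rightarrow> 'v) \<Rightarrow> ('p \<Rightarrow> 'v)) \<Rightarrow>
   ('p \<Rightarrow> int \<Rightarrow> 'v \<Rightarrow> 'v set \<times> 'v \<times> 'v) \<Rightarrow> bool" where
  "homology_decomposition K C d \<zeta> \<longleftrightarrow>
     (\<forall>p n. lin_iso K (C p n) (HBK C d p n) (\<zeta> p n)) \<and>
     (\<forall>p n. \<forall>h\<in>carrier (Hsp C d p n). \<forall>b\<in>carrier (Bsp C d p n). \<forall>k\<in>carrier (Ksp C d p n).
        \<zeta> p (n - 1) (rel_diff C d p n (zeta_inv C \<zeta> p n (h, b, k))) =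
          (\<zero>\<^bsub>Hsp C d p (n - 1)\<^esub>, k, \<zero>\<^bsub>Ksp C d p (n - 1)\<^esub>))"


section \<open>The contraction obtained by perturbation\<close>

definition hd_alpha ::
  "('p \<Rightarrow> int \<Rightarrow> 'v \<Rightarrow> 'v set \<times> 'v \<times> 'v) \<Rightarrow> int \<Rightarrow> ('p \<Rightarrow> 'v) \<Rightarrow> 'p \<Rightarrow> 'v set" where
  "hd_alpha \<zeta> n x = (\<lambda>p. fst (\<zeta> p n (x p)))"

definition hd_beta ::
  "('p \<Rightarrow> int \<Rightarrow> ('k, 'v) module) \<Rightarrow> (int \<Rightarrow> ('p \<Rightarrow> 'v) \<Rightarrow> ('p \<Rightarrow> 'v)) \<Rightarrow>
   ('p \<Rightarrow> int \<Rightarrow> 'v \<Rightarrow> 'v set \<times> 'v \<times> 'v) \<Rightarrow> int \<Rightarrow> ('p \<Rightarrow> 'v set) \<Rightarrow> 'p \<Rightarrow> 'v" where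
  "hd_beta C d \<zeta> n y =
     (\<lambda>p. zeta_inv C \<zeta> p n (y p, \<zero>\<^bsub>Bsp C d p n\<^esub>, \<zero>\<^bsub>Ksp C d p n\<^esub>))"

text \<open>The \<open>B\<close>-component in degree \<open>n\<close> becomes the \<open>K\<close>-component in degree \<open>n + 1\<close>.\<close>

definition hd_gamma ::
  "('p \<Rightarrow> int \<Rightarrow> ('k, 'v) module) \<Rightarrow> (int \<Rightarrow> ('p \<Rightarrow> 'v) \<Rightarrow> ('p \<Rightarrow> 'v)) \<Rightarrow>
   ('p \<Rightarrow> int \<Rightarrow> 'v \<Rightarrow> 'v set \<times> 'v \<times> 'v) \<Rightarrow> int \<Rightarrow> ('p \<Rightarrow> 'v) \<Rightarrow> 'p \<Rightarrow> 'v" where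
  "hd_gamma C d \<zeta> n x =
     (\<lambda>p. \<ominus>\<^bsub>C p (n + 1)\<^esub> zeta_inv C \<zeta> p (n + 1)
        (\<zero>\<^bsub>Hsp C d p (n + 1)\<^esub>, \<zero>\<^bsub>Bsp C d p (n + 1)\<^esub>, fst (snd (\<zeta> p n (x p)))))"

definition hd_dhat ::
  "('p \<Rightarrow> int \<Rightarrow> ('k, 'v) module) \<Rightarrow> (int \<Rightarrow> ('p \<Rightarrow> 'v) \<Rightarrow> ('p \<Rightarrow> 'v)) \<Rightarrow>
   int \<Rightarrow> ('p \<Rightarrow> 'v) \<Rightarrow> 'p \<Rightarrow> 'v" where
  "hd_dhat C d n x =
     lfsum (total_space C (n - 1)) (\<lambda>p. gincl C (n - 1) p (rel_diff C d p n (x p))) UNIV"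

definition hd_delta ::
  "('p \<Rightarrow> int \<Rightarrow> ('k, 'v) module) \<Rightarrow> (int \<Rightarrow> ('p \<Rightarrow> 'v) \<Rightarrow> ('p \<Rightarrow> 'v)) \<Rightarrow>
   int \<Rightarrow> ('p \<Rightarrow> 'v) \<Rightarrow> 'p \<Rightarrow> 'v" where
  "hd_delta C d n x = d n x \<ominus>\<^bsub>total_space C (n - 1)\<^esub> hd_dhat C d n x"

definition hd_S ::
  "('p \<Rightarrow> int \<Rightarrow> ('k, 'v) module) \<Rightarrow> (int \<Rightarrow> ('p \<Rightarrow> 'v) \<Rightarrow> ('p \<Rightarrow> 'v)) \<Rightarrow>
   ('p \<Rightarrow> int \<Rightarrow> 'v \<Rightarrow> 'v set \<times> 'v \<times> 'v) \<Rightarrow> int \<Rightarrow> ('p \<Rightarrow> 'v) \<Rightarrow> 'p \<Rightarrow> 'v" where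
  "hd_S C d \<zeta> = pert_S (total_space C) (hd_gamma C d \<zeta>) (hd_delta C d)"

definition bar_d where
  "bar_d C d \<zeta> = pert_d (hd_alpha \<zeta>) (hd_beta C d \<zeta>) (hd_S C d \<zeta>)"

definition bar_alpha where
  "bar_alpha C d \<zeta> = pert_f (total_space (Hsp C d)) (hd_alpha \<zeta>) (hd_gamma C d \<zeta>) (hd_S C d \<zeta>)"

definition bar_beta where
  "bar_beta C d \<zeta> = pert_g (total_space C) (hd_beta C d \<zeta>) (hd_gamma C d \<zeta>) (hd_S C d \<zeta>)"

definition bar_gamma where
  "bar_gamma C d \<zeta> = pert_h (total_space C) (hd_gamma C d \<zeta>) (hd_S C d \<zeta>)"


section \<open>Based complexes and Morse matchings\<close>

text \<open>
  \<open>bidx X n\<close> is the index set \<open>I\<^sub>n\<close>.  Since these sets are disjoint, the summands, inclusions and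
  projections are indexed by \<open>a \<in> I\<^sub>n\<close> alone.
\<close>

record ('k, 'x, 'a, 'w) based =
  bcx :: "int \<Rightarrow> ('k, 'x) module"
  bdiff :: "int \<Rightarrow> 'x \<Rightarrow> 'x"
  bidx :: "int \<Rightarrow> 'a set"
  bsum :: "'a \<Rightarrow> ('k, 'w) module"
  bincl :: "'a \<Rightarrow> 'w \<Rightarrow> 'x"
  bproj :: "'a \<Rightarrow> 'x \<Rightarrow> 'w"

definition based_complex ::
  "('k, 'e) ring_scheme \<Rightarrow> ('k, 'x, 'a, 'w) based \<Rightarrow> bool" where
  "based_complex K X \<longleftrightarrow>
     chain_complex K (bcx X) (bdiff X) \<and>
     (\<forall>m n. m \<noteq> n \<longrightarrow> bidx X m \<inter> bidx X n = {}) \<and>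
     (\<forall>n. \<forall>a\<in>bidx X n. vectorspace K (bsum X a)) \<and>
     (\<forall>n. lin_iso K (bcx X n) (dsum (bidx X n) (bsum X)) (\<lambda>x. \<lambda>a\<in>bidx X n. bproj X a x)) \<and>
     (\<forall>n. \<forall>a\<in>bidx X n. \<forall>v\<in>carrier (bsum X a).
        bincl X a v \<in> carrier (bcx X n) \<and>
        (\<lambda>b\<in>bidx X n. bproj X b (bincl X a v)) = dincl (bidx X n) (bsum X) a v)"

text \<open>\<open>bentry X n a b\<close> is \<open>d\<^sup>(\<^sup>a\<^sup>b\<^sup>)\<close> for \<open>b \<in> I\<^sub>n\<close>; the pair \<open>(b, a)\<close> is the edge from \<open>b\<close> to \<open>a\<close>.\<close>

definition bentry :: "('k, 'x, 'a, 'w) based \<Rightarrow> int \<Rightarrow> 'a \<Rightarrow> 'a \<Rightarrow> 'w \<Rightarrow> 'w" where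
  "bentry X n a b v = bproj X a (bdiff X n (bincl X b v))"

definition edges :: "('k, 'x, 'a, 'w) based \<Rightarrow> ('a \<times> 'a) set" where
  "edges X = {(b, a). \<exists>n. b \<in> bidx X n \<and> a \<in> bidx X (n - 1) \<and>
                (\<exists>v\<in>carrier (bsum X b). bentry X n a b v \<noteq> \<zero>\<^bsub>bsum X a\<^esub>)}"

definition partial_matching :: "('k, 'x, 'a, 'w) based \<Rightarrow> ('a \<times> 'a) set \<Rightarrow> bool" where
  "partial_matching X M \<longleftrightarrow> M \<subseteq> edges X \<and>
     (\<forall>e\<in>M. \<forall>e'\<in>M. e \<noteq> e' \<longrightarrow> {fst e, snd e} \<inter> {fst e', snd e'} = {})"

definition critical :: "('k, 'x, 'a, 'w) based \<Rightarrow> ('a \<times> 'a) set \<Rightarrow> int \<Rightarrow> 'a set" where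
  "critical X M n = {a \<in> bidx X n. a \<notin> fst ` M \<and> a \<notin> snd ` M}"

text \<open>
  The unreversed edges of \<open>G(C)\<^sup>M\<close> form \<open>edges X - M\<close>, the reversed ones \<open>M\<inverse>\<close>.  A pair \<open>(b, a)\<close>
  in \<open>r n\<close> means that \<open>b\<close> is below or equal to \<open>a\<close>.
\<close>

definition morse_matching ::
  "('k, 'e) ring_scheme \<Rightarrow> ('k, 'x, 'a, 'w) based \<Rightarrow> ('a \<times> 'a) set \<Rightarrow> bool" where
  "morse_matching K X M \<longleftrightarrow>
     partial_matching X M \<and>
     (\<forall>n a b. (b, a) \<in> M \<and> b \<in> bidx X n \<longrightarrow> lin_iso K (bsum X b) (bsum X a) (bentry X n a b)) \<and>
     (\<exists>r. \<forall>n. partial_order_on (bidx X n) (r n) \<and> wf (r n - Id) \<and>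
        (\<forall>a\<in>bidx X n. \<forall>b\<in>bidx X n. \<forall>c. a \<noteq> b \<and>
           ((a, c) \<in> edges X - M \<and> (c, b) \<in> M\<inverse> \<or> (a, c) \<in> M\<inverse> \<and> (c, b) \<in> edges X - M)
           \<longrightarrow> (b, a) \<in> r n))"


section \<open>The contraction associated with a Morse matching\<close>

definition sk_space ::
  "('k, 'x, 'a, 'w) based \<Rightarrow> ('a \<times> 'a) set \<Rightarrow> int \<Rightarrow> ('k, 'a \<Rightarrow> 'w) module" where
  "sk_space X M n = dsum (critical X M n) (bsum X)"

definition sk_f0 ::
  "('k, 'x, 'a, 'w) based \<Rightarrow> ('a \<times> 'a) set \<Rightarrow> int \<Rightarrow> 'x \<Rightarrow> 'a \<Rightarrow> 'w" where
  "sk_f0 X M n x = (\<lambda>a\<in>critical X M n. bproj X a x)"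

definition sk_g0 ::
  "('k, 'x, 'a, 'w) based \<Rightarrow> ('a \<times> 'a) set \<Rightarrow> int \<Rightarrow> ('a \<Rightarrow> 'w) \<Rightarrow> 'x" where
  "sk_g0 X M n y = lfsum (bcx X n) (\<lambda>a. bincl X a (y a)) (critical X M n)"

definition sk_h0 ::
  "('k, 'x, 'a, 'w) based \<Rightarrow> ('a \<times> 'a) set \<Rightarrow> int \<Rightarrow> 'x \<Rightarrow> 'x" where
  "sk_h0 X M n x =
     \<ominus>\<^bsub>bcx X (n + 1)\<^esub> lfsum (bcx X (n + 1))
       (\<lambda>(b, a). bincl X b (inv_into (carrier (bsum X b)) (bentry X (n + 1) a b) (bproj X a x)))
       {(b, a). (b, a) \<in> M \<and> b \<in> bidx X (n + 1) \<and> a \<in> bidx X n}"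

definition sk_tau ::
  "('k, 'x, 'a, 'w) based \<Rightarrow> ('a \<times> 'a) set \<Rightarrow> int \<Rightarrow> 'x \<Rightarrow> 'x" where
  "sk_tau X M n x =
     lfsum (bcx X (n - 1))
       (\<lambda>(b, a). bincl X a (bentry X n a b (bproj X b x)))
       {(b, a). (b, a) \<in> edges X - M \<and> b \<in> bidx X n \<and> a \<in> bidx X (n - 1)}"

definition sk_S where
  "sk_S X M = pert_S (bcx X) (sk_h0 X M) (sk_tau X M)"

definition sk_d where
  "sk_d X M = pert_d (sk_f0 X M) (sk_g0 X M) (sk_S X M)"

definition sk_f where
  "sk_f X M = pert_f (sk_space X M) (sk_f0 X M) (sk_h0 X M) (sk_S X M)"

definition sk_g where
  "sk_g X M = pert_g (bcx X) (sk_g0 X M) (sk_h0 X M) (sk_S X M)"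

definition sk_h where
  "sk_h X M = pert_h (bcx X) (sk_h0 X M) (sk_S X M)"


section \<open>The based complex and matching of a homology decomposition\<close>

datatype part = H_part | B_part | K_part

text \<open>
  The index \<open>(p, V\<^sub>n)\<close> is the triple \<open>(p, V, n)\<close>.  All summands of a based complex have one element
  type; homology classes are sets of chains and the elements of \<open>B\<^sup>p\<^sub>n\<close> and \<open>K\<^sup>p\<^sub>n\<close> are chains, so
  the summands live in the sum type, tagged by \<^const>\<open>Inl\<close> and \<^const>\<open>Inr\<close> respectively.
\<close>

fun part_space ::
  "('p \<Rightarrow> int \<Rightarrow> ('k, 'v) module) \<Rightarrow> (int \<Rightarrow> ('p \<Rightarrow> 'v) \<Rightarrow> ('p \<Rightarrow> 'v)) \<Rightarrow>
   'p \<times> part \<times> int \<Rightarrow> ('k, 'v set + 'v) module" where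
  "part_space C d (p, H_part, n) = relabel Inl (Hsp C d p n)"
| "part_space C d (p, B_part, n) = relabel Inr (Bsp C d p n)"
| "part_space C d (p, K_part, n) = relabel Inr (Ksp C d p n)"

definition part_idx ::
  "('p \<Rightarrow> int \<Rightarrow> ('k, 'v) module) \<Rightarrow> (int \<Rightarrow> ('p \<Rightarrow> 'v) \<Rightarrow> ('p \<Rightarrow> 'v)) \<Rightarrow>
   int \<Rightarrow> ('p \<times> part \<times> int) set" where
  "part_idx C d n = {(p, V, m). m = n \<and>
     (V = H_part \<or> carrier (part_space C d (p, V, n)) \<noteq> {\<zero>\<^bsub>part_space C d (p, V, n)\<^esub>})}"

fun part_incl ::
  "('p \<Rightarrow> int \<Rightarrow> ('k, 'v) module) \<Rightarrow> (int \<Rightarrow> ('p \<Rightarrow> 'v) \<Rightarrow> ('p \<Rightarrow> 'v)) \<Rightarrow>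
   ('p \<Rightarrow> int \<Rightarrow> 'v \<Rightarrow> 'v set \<times> 'v \<times> 'v) \<Rightarrow> 'p \<times> part \<times> int \<Rightarrow> 'v set + 'v \<Rightarrow> 'p \<Rightarrow> 'v" where
  "part_incl C d \<zeta> (p, H_part, n) w =
     gincl C n p (zeta_inv C \<zeta> p n (projl w, \<zero>\<^bsub>Bsp C d p n\<^esub>, \<zero>\<^bsub>Ksp C d p n\<^esub>))"
| "part_incl C d \<zeta> (p, B_part, n) w =
     gincl C n p (zeta_inv C \<zeta> p n (\<zero>\<^bsub>Hsp C d p n\<^esub>, projr w, \<zero>\<^bsub>Ksp C d p n\<^esub>))"
| "part_incl C d \<zeta> (p, K_part, n) w =
     gincl C n p (zeta_inv C \<zeta> p n (\<zero>\<^bsub>Hsp C d p n\<^esub>, \<zero>\<^bsub>Bsp C d p n\<^esub>, projr w))"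

fun part_proj ::
  "('p \<Rightarrow> int \<Rightarrow> 'v \<Rightarrow> 'v set \<times> 'v \<times> 'v) \<Rightarrow> 'p \<times> part \<times> int \<Rightarrow> ('p \<Rightarrow> 'v) \<Rightarrow> 'v set + 'v" where
  "part_proj \<zeta> (p, H_part, n) x = Inl (fst (\<zeta> p n (x p)))"
| "part_proj \<zeta> (p, B_part, n) x = Inr (fst (snd (\<zeta> p n (x p))))"
| "part_proj \<zeta> (p, K_part, n) x = Inr (snd (snd (\<zeta> p n (x p))))"

definition hbk_based ::
  "('p \<Rightarrow> int \<Rightarrow> ('k, 'v) module) \<Rightarrow> (int \<Rightarrow> ('p \<Rightarrow> 'v) \<Rightarrow> ('p \<Rightarrow> 'v)) \<Rightarrow>
   ('p \<Rightarrow> int \<Rightarrow> 'v \<Rightarrow> 'v set \<times> 'v \<times> 'v) \<Rightarrow>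
   ('k, 'p \<Rightarrow> 'v, 'p \<times> part \<times> int, 'v set + 'v) based" where
  "hbk_based C d \<zeta> = \<lparr>bcx = total_space C, bdiff = d, bidx = part_idx C d, bsum = part_space C d,
     bincl = part_incl C d \<zeta>, bproj = part_proj \<zeta>\<rparr>"

definition kb_matching ::
  "('p \<Rightarrow> int \<Rightarrow> ('k, 'v) module) \<Rightarrow> (int \<Rightarrow> ('p \<Rightarrow> 'v) \<Rightarrow> ('p \<Rightarrow> 'v)) \<Rightarrow>
   (('p \<times> part \<times> int) \<times> ('p \<times> part \<times> int)) set" where
  "kb_matching C d = {((p, K_part, n), (p, B_part, n - 1)) | p n.
     carrier (Ksp C d p n) \<noteq> {\<zero>\<^bsub>Ksp C d p n\<^esub>}}"

text \<open>
  The identification of \<open>\<Oplus>\<^sub>p H\<^sup>p\<^sub>n\<close>, with index \<open>p\<close>, and the direct sum of the same spaces with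
  index \<open>(p, H\<^sub>n)\<close>.
\<close>

definition reindex :: "int \<Rightarrow> ('p \<Rightarrow> 'v set) \<Rightarrow> 'p \<times> part \<times> int \<Rightarrow> 'v set + 'v" where
  "reindex n y = (\<lambda>a\<in>{(p, H_part, n) | p. True}. Inl (y (fst a)))"

end

theory Submission
  imports Defs
begin

text \<open>
  Both constructions apply one and the same formula, \<open>S = \<tau> (1 - h \<tau>)\<^sup>-\<^sup>1\<close> followed by
  \<open>f S g\<close>, \<open>f + f S h\<close>, \<open>g + h S g\<close> and \<open>h + h S h\<close>, to a quadruple \<open>(f, g, h, \<tau>)\<close>.  So the
  two outputs agree as soon as the two inputs do, and this is a statement about the matrix of \<open>d\<close>
  with respect to the summands \<open>H\<^sup>p\<^sub>n\<close>, \<open>B\<^sup>p\<^sub>n\<close>, \<open>K\<^sup>p\<^sub>n\<close>.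

  The normal form \<open>(h, b, k) \<mapsto> (0, k, 0)\<close> of the relative differential at \<open>p\<close> says that among the
  entries of \<open>d\<close> between two summands over the same \<open>p\<close> only the one from \<open>K\<^sup>p\<^sub>n\<close> to
  \<open>B\<^sup>p\<^sub>n\<^sub>-\<^sub>1\<close> can be nonzero, and that it is the identity of the space \<open>K\<^sup>p\<^sub>n = B\<^sup>p\<^sub>n\<^sub>-\<^sub>1\<close>
  (lemma \<open>entry_diagonal\<close>).  These entries are the matched ones.  Three consequences follow.
  The critical summands are the homology spaces, so \<open>f\<close> and \<open>g\<close> are \<open>\<alpha>\<close> and \<open>\<beta>\<close>
  up to renaming indices (\<open>sk_f0_eq\<close>, \<open>sk_g0_eq\<close>).  Inverting the matched entries means,
  up to sign, moving a \<open>B\<close>-component to the \<open>K\<close>-component one degree higher, so \<open>h\<close> is \<open>\<gamma>\<close>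
  (\<open>sk_h0_eq\<close>).  Deleting the matched entries from \<open>d\<close> means deleting its block diagonal part, so
  \<open>\<tau>\<close> is \<open>\<delta>\<close> (\<open>sk_tau_eq\<close>).

  The remaining claims rest on the fact that every nonzero unmatched entry strictly lowers \<open>p\<close>
  (\<open>unmatched_edge_less\<close>, \<open>\<delta>_lowering\<close>).  Since the poset is well-founded, comparing the
  degrees \<open>p\<close> gives the partial orders that a Morse matching demands, and \<open>\<gamma> \<delta>\<close> is locally
  nilpotent because a vector of degree \<open>q\<close> is sent to a finite sum of vectors of smaller degrees
  (\<open>strictly_lowering_nilpotent\<close>).  That perturbation produces a contraction is the homological
  perturbation lemma, proved in the locale \<open>perturbation\<close>; it applies to the contraction of
  \<open>C\<close> with its block diagonal differential onto \<open>\<Oplus>\<^sub>p H\<^sup>p\<close> with zero differential.  All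
  maps involved preserve the subspaces of vectors supported below a given \<open>q\<close>, hence the result is
  filtered, and Skoldberg's contraction is its transport along the renaming of indices.
\<close>

section \<open>Linear maps\<close>

lemma linear_map_iff:
  "linear_map K V W f \<longleftrightarrow> vectorspace K V \<and> vectorspace K W \<and>
     (\<forall>x\<in>carrier V. f x \<in> carrier W) \<and>
     (\<forall>x\<in>carrier V. \<forall>y\<in>carrier V. f (x \<oplus>\<^bsub>V\<^esub> y) = f x \<oplus>\<^bsub>W\<^esub> f y) \<and>
     (\<forall>c\<in>carrier K. \<forall>x\<in>carrier V. f (c \<odot>\<^bsub>V\<^esub> x) = c \<odot>\<^bsub>W\<^esub> f x)"
  unfolding linear_map_def mod_hom_def mod_hom_axioms_def module_hom_def vectorspace_def
  by (auto simp: Pi_iff)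

lemma vectorspace_abelian_group: "vectorspace K V \<Longrightarrow> abelian_group V"
  unfolding vectorspace_def module_def by blast

lemma linear_map_zero: "linear_map K V W f \<Longrightarrow> f \<zero>\<^bsub>V\<^esub> = \<zero>\<^bsub>W\<^esub>"
  by (rule mod_hom.f0_is_0[of K]) (simp add: linear_map_def)

lemma linear_map_closed: "linear_map K V W f \<Longrightarrow> x \<in> carrier V \<Longrightarrow> f x \<in> carrier W"
  by (simp add: linear_map_iff)

lemma linear_map_add:
  "linear_map K V W f \<Longrightarrow> x \<in> carrier V \<Longrightarrow> y \<in> carrier V \<Longrightarrow>
   f (x \<oplus>\<^bsub>V\<^esub> y) = f x \<oplus>\<^bsub>W\<^esub> f y"
  by (simp add: linear_map_iff)

lemma linear_map_neg:
  "linear_map K V W f \<Longrightarrow> x \<in> carrier V \<Longrightarrow> f (\<ominus>\<^bsub>V\<^esub> x) = \<ominus>\<^bsub>W\<^esub> f x"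
  by (rule mod_hom.f_neg[of K]) (simp_all add: linear_map_def)

lemma linear_map_minus:
  "linear_map K V W f \<Longrightarrow> x \<in> carrier V \<Longrightarrow> y \<in> carrier V \<Longrightarrow>
   f (x \<ominus>\<^bsub>V\<^esub> y) = f x \<ominus>\<^bsub>W\<^esub> f y"
  by (rule mod_hom.f_minus[of K]) (simp_all add: linear_map_def)

lemma linear_map_comp:
  "linear_map K U V f \<Longrightarrow> linear_map K V W g \<Longrightarrow> linear_map K U W (\<lambda>x. g (f x))"
  by (simp add: linear_map_iff)

lemma linear_map_sum:
  assumes f: "linear_map K V W f" and g: "linear_map K V W g"
  shows "linear_map K V W (\<lambda>x. f x \<oplus>\<^bsub>W\<^esub> g x)"
proof -
  interpret W: vectorspace K W using f by (simp add: linear_map_iff)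
  show ?thesis using f g by (auto simp: linear_map_iff W.M.a_ac W.smult_r_distr)
qed

lemma linear_map_neg_fun:
  assumes f: "linear_map K V W f"
  shows "linear_map K V W (\<lambda>x. \<ominus>\<^bsub>W\<^esub> f x)"
proof -
  interpret W: vectorspace K W using f by (simp add: linear_map_iff)
  show ?thesis using f
    by (auto simp: linear_map_iff W.M.a_ac W.M.minus_add W.smult_r_minus)
qed

lemma linear_map_diff:
  assumes f: "linear_map K V W f" and g: "linear_map K V W g"
  shows "linear_map K V W (\<lambda>x. f x \<ominus>\<^bsub>W\<^esub> g x)"
  unfolding a_minus_def by (intro linear_map_sum linear_map_neg_fun f g)

lemma linear_map_ident: "vectorspace K V \<Longrightarrow> linear_map K V V (\<lambda>x. x)"
  by (simp add: linear_map_iff)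

lemma linear_map_cong:
  assumes "linear_map K V W f" and "\<And>x. x \<in> carrier V \<Longrightarrow> g x = f x"
  shows "linear_map K V W g"
proof -
  interpret V: vectorspace K V using assms by (simp add: linear_map_iff)
  show ?thesis using assms by (simp add: linear_map_iff)
qed

lemma linear_map_inv_into:
  assumes f: "linear_map K V W f" and b: "bij_betw f (carrier V) (carrier W)"
  shows "linear_map K W V (inv_into (carrier V) f)"
proof -
  interpret V: vectorspace K V using f by (simp add: linear_map_iff)
  interpret W: vectorspace K W using f by (simp add: linear_map_iff)
  let ?g = "inv_into (carrier V) f"
  have inj: "inj_on f (carrier V)" and im: "f ` carrier V = carrier W"
    using b by (auto simp: bij_betw_def)
  have cl: "?g y \<in> carrier V" "f (?g y) = y" if "y \<in> carrier W" for y
    using that im by (auto simp: inv_into_into f_inv_into_f)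
  have ad: "?g (x \<oplus>\<^bsub>W\<^esub> y) = ?g x \<oplus>\<^bsub>V\<^esub> ?g y" if "x \<in> carrier W" "y \<in> carrier W" for x y
    by (rule inv_into_f_eq[OF inj]) (use that in \<open>simp_all add: cl linear_map_add[OF f]\<close>)
  have sm: "?g (c \<odot>\<^bsub>W\<^esub> y) = c \<odot>\<^bsub>V\<^esub> ?g y" if "c \<in> carrier K" "y \<in> carrier W" for c y
    by (rule inv_into_f_eq[OF inj]) (use that f in \<open>simp_all add: cl linear_map_iff\<close>)
  show ?thesis unfolding linear_map_iff
    using cl ad sm V.vectorspace_axioms W.vectorspace_axioms by blast
qed

lemma linear_map_finsum:
  assumes f: "linear_map K V W f" and "finite A" and "\<And>i. i \<in> A \<Longrightarrow> g i \<in> carrier V"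
  shows "f (finsum V g A) = finsum W (\<lambda>i. f (g i)) A"
proof -
  interpret V: vectorspace K V using f by (simp add: linear_map_iff)
  interpret W: vectorspace K W using f by (simp add: linear_map_iff)
  show ?thesis using assms(2,3)
  proof (induction A)
    case empty
    then show ?case by (simp add: linear_map_zero[OF f])
  next
    case (insert i A)
    then have "g \<in> A \<rightarrow> carrier V" by auto
    with insert show ?case
      by (simp add: linear_map_add[OF f] linear_map_closed[OF f] Pi_iff)
  qed
qed

section \<open>Inverting one minus a locally nilpotent map\<close>

text \<open>
  The solution is the finite geometric series \<open>x + N x + N\<^sup>2 x + \<dots>\<close>, so it stays inside
  every \<open>N\<close>-invariant additive subset that contains \<open>x\<close>.  Stating this for a subset \<open>U\<close> rather than
  for the whole space is what later shows that the perturbed maps are filtered.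
\<close>
lemma locally_nilpotent_solve:
  assumes V: "abelian_group V"
    and U: "U \<subseteq> carrier V" "\<And>u v. u \<in> U \<Longrightarrow> v \<in> U \<Longrightarrow> u \<oplus>\<^bsub>V\<^esub> v \<in> U"
    and zero: "\<zero>\<^bsub>V\<^esub> \<in> U" "N \<zero>\<^bsub>V\<^esub> = \<zero>\<^bsub>V\<^esub>"
    and N: "\<And>u. u \<in> U \<Longrightarrow> N u \<in> U"
    and add: "\<And>u v. u \<in> carrier V \<Longrightarrow> v \<in> carrier V \<Longrightarrow> N (u \<oplus>\<^bsub>V\<^esub> v) = N u \<oplus>\<^bsub>V\<^esub> N v"
  shows "x \<in> U \<Longrightarrow> (N ^^ k) x = \<zero>\<^bsub>V\<^esub> \<Longrightarrow> \<exists>z\<in>U. z \<ominus>\<^bsub>V\<^esub> N z = x"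
proof (induction k arbitrary: x)
  interpret abelian_group V by fact
  case 0
  then show ?case using zero by (intro bexI[of _ x]) (simp_all add: a_minus_def r_neg)
next
  interpret abelian_group V by fact
  case (Suc k)
  have "(N ^^ k) (N x) = \<zero>\<^bsub>V\<^esub>" using Suc.prems by (simp add: funpow_swap1)
  with Suc.IH[of "N x"] Suc.prems N obtain z where z: "z \<in> U" "z \<ominus>\<^bsub>V\<^esub> N z = N x" by blast
  have c: "x \<in> carrier V" "z \<in> carrier V" "N x \<in> carrier V" "N z \<in> carrier V"
    using z Suc.prems U N by auto
  have "(x \<oplus>\<^bsub>V\<^esub> z) \<ominus>\<^bsub>V\<^esub> N (x \<oplus>\<^bsub>V\<^esub> z) = x \<oplus>\<^bsub>V\<^esub> (z \<ominus>\<^bsub>V\<^esub> N z) \<ominus>\<^bsub>V\<^esub> N x"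
    using c by (simp add: add a_minus_def minus_add a_ac)
  also have "\<dots> = x" unfolding z(2) using c by (simp add: a_minus_def a_assoc r_neg)
  finally show ?case using U(2)[OF Suc.prems(1) z(1)] by blast
qed

text \<open>A vector fixed by \<open>N\<close> is fixed by all powers of \<open>N\<close>, one of which kills it.\<close>
lemma locally_nilpotent_inj:
  assumes N: "linear_map K V V N" and nil: "locally_nilpotent V N"
  shows "inj_on (\<lambda>z. z \<ominus>\<^bsub>V\<^esub> N z) (carrier V)"
proof (rule inj_onI)
  interpret V: vectorspace K V using N by (simp add: linear_map_iff)
  fix x y assume xy: "x \<in> carrier V" "y \<in> carrier V" "x \<ominus>\<^bsub>V\<^esub> N x = y \<ominus>\<^bsub>V\<^esub> N y"
  define w where "w = x \<ominus>\<^bsub>V\<^esub> y"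
  have c: "N x \<in> carrier V" "N y \<in> carrier V" "w \<in> carrier V"
    using xy N by (auto simp: w_def linear_map_closed)
  have "w \<ominus>\<^bsub>V\<^esub> N w = (x \<ominus>\<^bsub>V\<^esub> N x) \<ominus>\<^bsub>V\<^esub> (y \<ominus>\<^bsub>V\<^esub> N y)"
    using xy(1,2) c unfolding w_def a_minus_def
    by (simp add: linear_map_add[OF N] linear_map_neg[OF N] V.M.minus_add V.M.a_ac)
  also have "\<dots> = \<zero>\<^bsub>V\<^esub>" unfolding xy(3) using xy(2) c by (simp add: a_minus_def V.M.r_neg)
  finally have "N w = w"
    using c N by (metis V.M.minus_equality V.M.minus_minus a_minus_def V.M.add.inv_closed linear_map_closed V.M.a_comm)
  then have "(N ^^ k) w = w" for k by (induction k) simp_all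
  then have "w = \<zero>\<^bsub>V\<^esub>" using nil c by (metis locally_nilpotent_def)
  then show "x = y" using xy(1,2) unfolding w_def
    by (metis V.M.minus_equality V.M.minus_minus a_minus_def V.M.add.inv_closed)
qed

lemma locally_nilpotent_bij:
  assumes N: "linear_map K V V N" and nil: "locally_nilpotent V N"
  shows "bij_betw (\<lambda>z. z \<ominus>\<^bsub>V\<^esub> N z) (carrier V) (carrier V)"
proof -
  interpret V: vectorspace K V using N by (simp add: linear_map_iff)
  have "x \<in> (\<lambda>z. z \<ominus>\<^bsub>V\<^esub> N z) ` carrier V" if x: "x \<in> carrier V" for x
  proof -
    obtain k where "(N ^^ k) x = \<zero>\<^bsub>V\<^esub>" using nil x by (auto simp: locally_nilpotent_def)
    with x have "\<exists>z\<in>carrier V. z \<ominus>\<^bsub>V\<^esub> N z = x"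
      by (intro locally_nilpotent_solve[OF V.M.abelian_group_axioms])
         (auto simp: linear_map_zero[OF N] linear_map_closed[OF N] linear_map_add[OF N])
    then show ?thesis by auto
  qed
  moreover have "z \<ominus>\<^bsub>V\<^esub> N z \<in> carrier V" if "z \<in> carrier V" for z
    using that linear_map_closed[OF N] by simp
  ultimately show ?thesis
    using locally_nilpotent_inj[OF N nil] by (auto simp: bij_betw_def)
qed

section \<open>Direct sums\<close>

lemma dsum_carrier:
  "x \<in> carrier (dsum I V) \<longleftrightarrow>
   x \<in> (\<Pi>\<^sub>E i\<in>I. carrier (V i)) \<and> finite {i \<in> I. x i \<noteq> \<zero>\<^bsub>V i\<^esub>}"
  by (simp add: dsum_def)

lemma dsum_zero: "\<zero>\<^bsub>dsum I V\<^esub> = (\<lambda>i\<in>I. \<zero>\<^bsub>V i\<^esub>)"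
  by (simp add: dsum_def)

lemma dsum_add: "x \<oplus>\<^bsub>dsum I V\<^esub> y = (\<lambda>i\<in>I. x i \<oplus>\<^bsub>V i\<^esub> y i)"
  by (simp add: dsum_def)

lemma dsum_smult: "c \<odot>\<^bsub>dsum I V\<^esub> x = (\<lambda>i\<in>I. c \<odot>\<^bsub>V i\<^esub> x i)"
  by (simp add: dsum_def)

lemma vectorspace_dsum:
  assumes K: "field K" and V: "\<And>i. i \<in> I \<Longrightarrow> vectorspace K (V i)"
  shows "vectorspace K (dsum I V)"
proof -
  have ab: "abelian_group (V i)" and mo: "module K (V i)" if "i \<in> I" for i
    using V[OF that] by (simp_all add: vectorspace_def module_def)
  note [simp] = ab[THEN abelian_group.axioms(1), THEN abelian_monoid.zero_closed]
    ab[THEN abelian_group.axioms(1), THEN abelian_monoid.a_closed]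
    ab[THEN abelian_group.axioms(1), THEN abelian_monoid.l_zero]
    ab[THEN abelian_group.axioms(1), THEN abelian_monoid.r_zero]
    ab[THEN abelian_group.a_inv_closed] ab[THEN abelian_group.r_neg]
    mo[THEN module.smult_closed] mo[THEN module.smult_r_null] mo[THEN module.smult_one]
    mo[THEN module.smult_assoc1] mo[THEN module.smult_l_distr] mo[THEN module.smult_r_distr]
  have PiD: "\<And>x i. x \<in> (\<Pi>\<^sub>E i\<in>I. carrier (V i)) \<Longrightarrow> i \<in> I \<Longrightarrow> x i \<in> carrier (V i)"
    by (rule PiE_mem)
  show ?thesis
  proof (rule vs_criteria)
    show "field K" by fact
    show "\<zero>\<^bsub>dsum I V\<^esub> \<in> carrier (dsum I V)" by (auto simp: dsum_carrier dsum_zero)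
    show "\<forall>v w. v \<in> carrier (dsum I V) \<and> w \<in> carrier (dsum I V) \<longrightarrow>
        v \<oplus>\<^bsub>dsum I V\<^esub> w \<in> carrier (dsum I V)"
    proof (intro allI impI)
      fix v w assume *: "v \<in> carrier (dsum I V) \<and> w \<in> carrier (dsum I V)"
      have "{i \<in> I. v i \<oplus>\<^bsub>V i\<^esub> w i \<noteq> \<zero>\<^bsub>V i\<^esub>} \<subseteq>
          {i \<in> I. v i \<noteq> \<zero>\<^bsub>V i\<^esub>} \<union> {i \<in> I. w i \<noteq> \<zero>\<^bsub>V i\<^esub>}" by auto
      with * have "finite {i \<in> I. v i \<oplus>\<^bsub>V i\<^esub> w i \<noteq> \<zero>\<^bsub>V i\<^esub>}"
        by (auto simp: dsum_carrier intro: finite_subset)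
      with * show "v \<oplus>\<^bsub>dsum I V\<^esub> w \<in> carrier (dsum I V)"
        by (auto simp: dsum_carrier dsum_add PiD cong: conj_cong)
    qed
    show "\<forall>v\<in>carrier (dsum I V). \<exists>u\<in>carrier (dsum I V). v \<oplus>\<^bsub>dsum I V\<^esub> u = \<zero>\<^bsub>dsum I V\<^esub>"
    proof
      fix v assume *: "v \<in> carrier (dsum I V)"
      let ?u = "\<lambda>i\<in>I. \<ominus>\<^bsub>V i\<^esub> v i"
      have "{i \<in> I. \<ominus>\<^bsub>V i\<^esub> v i \<noteq> \<zero>\<^bsub>V i\<^esub>} \<subseteq> {i \<in> I. v i \<noteq> \<zero>\<^bsub>V i\<^esub>}"
      proof safe
        fix i assume "i \<in> I" "v i = \<zero>\<^bsub>V i\<^esub>" "\<ominus>\<^bsub>V i\<^esub> v i \<noteq> \<zero>\<^bsub>V i\<^esub>"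
        interpret abelian_group "V i" using ab \<open>i \<in> I\<close> .
        show False using \<open>v i = _\<close> \<open>\<ominus>\<^bsub>V i\<^esub> v i \<noteq> \<zero>\<^bsub>V i\<^esub>\<close> by simp
      qed
      with * have "?u \<in> carrier (dsum I V)"
        by (auto simp: dsum_carrier PiD intro: finite_subset cong: conj_cong)
      moreover have "v \<oplus>\<^bsub>dsum I V\<^esub> ?u = \<zero>\<^bsub>dsum I V\<^esub>"
        using * by (auto simp: dsum_add dsum_zero dsum_carrier PiD intro!: restrict_ext)
      ultimately show "\<exists>u\<in>carrier (dsum I V). v \<oplus>\<^bsub>dsum I V\<^esub> u = \<zero>\<^bsub>dsum I V\<^esub>" by blast
    qed
    show "\<forall>c v. c \<in> carrier K \<and> v \<in> carrier (dsum I V) \<longrightarrow>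
        c \<odot>\<^bsub>dsum I V\<^esub> v \<in> carrier (dsum I V)"
    proof (intro allI impI)
      fix c v assume *: "c \<in> carrier K \<and> v \<in> carrier (dsum I V)"
      then have "{i \<in> I. c \<odot>\<^bsub>V i\<^esub> v i \<noteq> \<zero>\<^bsub>V i\<^esub>} \<subseteq> {i \<in> I. v i \<noteq> \<zero>\<^bsub>V i\<^esub>}" by auto
      with * show "c \<odot>\<^bsub>dsum I V\<^esub> v \<in> carrier (dsum I V)"
        by (auto simp: dsum_carrier dsum_smult PiD intro: finite_subset cong: conj_cong)
    qed
    show "\<forall>v w. v \<in> carrier (dsum I V) \<and> w \<in> carrier (dsum I V) \<longrightarrow>
        v \<oplus>\<^bsub>dsum I V\<^esub> w = w \<oplus>\<^bsub>dsum I V\<^esub> v"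
      by (auto simp: dsum_add dsum_carrier PiD intro!: restrict_ext
          abelian_monoid.a_comm[OF ab[THEN abelian_group.axioms(1)]])
    show "\<forall>v w x. v \<in> carrier (dsum I V) \<and> w \<in> carrier (dsum I V) \<and> x \<in> carrier (dsum I V) \<longrightarrow>
        v \<oplus>\<^bsub>dsum I V\<^esub> w \<oplus>\<^bsub>dsum I V\<^esub> x = v \<oplus>\<^bsub>dsum I V\<^esub> (w \<oplus>\<^bsub>dsum I V\<^esub> x)"
      by (auto simp: dsum_add dsum_carrier PiD intro!: restrict_ext
          abelian_monoid.a_assoc[OF ab[THEN abelian_group.axioms(1)]])
    show "\<forall>v\<in>carrier (dsum I V). v \<oplus>\<^bsub>dsum I V\<^esub> \<zero>\<^bsub>dsum I V\<^esub> = v"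
      by (auto simp: dsum_add dsum_zero dsum_carrier PiD PiE_def extensional_def fun_eq_iff
          dest: Pi_mem)
    show "\<forall>a b v. a \<in> carrier K \<and> b \<in> carrier K \<and> v \<in> carrier (dsum I V) \<longrightarrow>
        (a \<otimes>\<^bsub>K\<^esub> b) \<odot>\<^bsub>dsum I V\<^esub> v = a \<odot>\<^bsub>dsum I V\<^esub> (b \<odot>\<^bsub>dsum I V\<^esub> v)"
      by (auto simp: dsum_smult dsum_carrier PiD intro!: restrict_ext)
    show "\<forall>v\<in>carrier (dsum I V). \<one>\<^bsub>K\<^esub> \<odot>\<^bsub>dsum I V\<^esub> v = v"
      proof
      fix v assume "v \<in> carrier (dsum I V)"
      then have v: "v \<in> (\<Pi>\<^sub>E i\<in>I. carrier (V i))" by (simp add: dsum_carrier)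
      then have "(\<lambda>i\<in>I. \<one>\<^bsub>K\<^esub> \<odot>\<^bsub>V i\<^esub> v i) = (\<lambda>i\<in>I. v i)"
        by (intro restrict_ext) (simp add: PiD)
      with v show "\<one>\<^bsub>K\<^esub> \<odot>\<^bsub>dsum I V\<^esub> v = v"
        by (simp add: dsum_smult PiE_restrict)
    qed
    show "\<forall>a b v. a \<in> carrier K \<and> b \<in> carrier K \<and> v \<in> carrier (dsum I V) \<longrightarrow>
        (a \<oplus>\<^bsub>K\<^esub> b) \<odot>\<^bsub>dsum I V\<^esub> v = a \<odot>\<^bsub>dsum I V\<^esub> v \<oplus>\<^bsub>dsum I V\<^esub> b \<odot>\<^bsub>dsum I V\<^esub> v"
      by (auto simp: dsum_smult dsum_add dsum_carrier PiD intro!: restrict_ext)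
    show "\<forall>a v w. a \<in> carrier K \<and> v \<in> carrier (dsum I V) \<and> w \<in> carrier (dsum I V) \<longrightarrow>
        a \<odot>\<^bsub>dsum I V\<^esub> (v \<oplus>\<^bsub>dsum I V\<^esub> w) =
        a \<odot>\<^bsub>dsum I V\<^esub> v \<oplus>\<^bsub>dsum I V\<^esub> a \<odot>\<^bsub>dsum I V\<^esub> w"
      by (auto simp: dsum_smult dsum_add dsum_carrier PiD intro!: restrict_ext)
  qed
qed

lemma linear_map_dsum_proj:
  assumes K: "field K" and V: "\<And>i. i \<in> I \<Longrightarrow> vectorspace K (V i)" and "i \<in> I"
  shows "linear_map K (dsum I V) (V i) (\<lambda>x. x i)"
  using vectorspace_dsum[of K I V] assms
  by (auto simp: linear_map_iff dsum_carrier dsum_add dsum_smult PiE_mem)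

section \<open>The homological perturbation lemma\<close>

text \<open>
  The data of a contraction of \<open>(C, t)\<close> to \<open>H\<close> with zero differential, and a perturbation
  \<open>d = t + \<delta>\<close> of its differential.  The equations \<open>\<alpha> t = 0\<close> and \<open>t \<beta> = 0\<close> say that \<open>\<alpha>\<close>
  and \<open>\<beta>\<close> are chain maps for the zero differential on \<open>H\<close>.
\<close>
locale perturbation =
  fixes K :: "('k, 'e) ring_scheme"
    and C :: "int \<Rightarrow> ('k, 'x) module" and H :: "int \<Rightarrow> ('k, 'y) module"
    and d t \<delta> \<gamma> :: "int \<Rightarrow> 'x \<Rightarrow> 'x" and \<alpha> :: "int \<Rightarrow> 'x \<Rightarrow> 'y" and \<beta> :: "int \<Rightarrow> 'y \<Rightarrow> 'x"
  assumes complex: "chain_complex K C d"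
    and lin_t: "\<And>n. linear_map K (C n) (C (n - 1)) (t n)"
    and lin_\<delta>: "\<And>n. linear_map K (C n) (C (n - 1)) (\<delta> n)"
    and lin_\<alpha>: "\<And>n. linear_map K (C n) (H n) (\<alpha> n)"
    and lin_\<beta>: "\<And>n. linear_map K (H n) (C n) (\<beta> n)"
    and lin_\<gamma>: "\<And>n. linear_map K (C n) (C (n + 1)) (\<gamma> n)"
    and split: "\<And>n x. x \<in> carrier (C n) \<Longrightarrow> d n x = t n x \<oplus>\<^bsub>C (n - 1)\<^esub> \<delta> n x"
    and tt: "\<And>n x. x \<in> carrier (C n) \<Longrightarrow> t (n - 1) (t n x) = \<zero>\<^bsub>C (n - 2)\<^esub>"
    and \<alpha>\<beta>: "\<And>n y. y \<in> carrier (H n) \<Longrightarrow> \<alpha> n (\<beta> n y) = y"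
    and \<beta>\<alpha>: "\<And>n x. x \<in> carrier (C n) \<Longrightarrow>
      \<beta> n (\<alpha> n x) = x \<oplus>\<^bsub>C n\<^esub> t (n + 1) (\<gamma> n x) \<oplus>\<^bsub>C n\<^esub> \<gamma> (n - 1) (t n x)"
    and \<alpha>\<gamma>: "\<And>n x. x \<in> carrier (C n) \<Longrightarrow> \<alpha> (n + 1) (\<gamma> n x) = \<zero>\<^bsub>H (n + 1)\<^esub>"
    and \<gamma>\<beta>: "\<And>n y. y \<in> carrier (H n) \<Longrightarrow> \<gamma> n (\<beta> n y) = \<zero>\<^bsub>C (n + 1)\<^esub>"
    and \<gamma>\<gamma>: "\<And>n x. x \<in> carrier (C n) \<Longrightarrow> \<gamma> (n + 1) (\<gamma> n x) = \<zero>\<^bsub>C (n + 2)\<^esub>"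
    and \<alpha>t: "\<And>n x. x \<in> carrier (C n) \<Longrightarrow> \<alpha> (n - 1) (t n x) = \<zero>\<^bsub>H (n - 1)\<^esub>"
    and t\<beta>: "\<And>n y. y \<in> carrier (H n) \<Longrightarrow> t n (\<beta> n y) = \<zero>\<^bsub>C (n - 1)\<^esub>"
    and nil: "\<And>n. locally_nilpotent (C n) (\<gamma> (n - 1) \<circ> \<delta> n)"
begin

definition S where "S = pert_S C \<gamma> \<delta>"

sublocale C: vectorspace K "C n" for n
  using lin_t[of n] by (simp add: linear_map_iff)

sublocale H: vectorspace K "H n" for n
  using lin_\<alpha>[of n] by (simp add: linear_map_iff)

text \<open>Degrees appear as hypotheses \<open>m = n - 1\<close> so that the simplifier can close them by arithmetic.\<close>

lemma closed:
  "x \<in> carrier (C n) \<Longrightarrow> m = n - 1 \<Longrightarrow> t n x \<in> carrier (C m)"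
  "x \<in> carrier (C n) \<Longrightarrow> m = n - 1 \<Longrightarrow> \<delta> n x \<in> carrier (C m)"
  "x \<in> carrier (C n) \<Longrightarrow> m = n + 1 \<Longrightarrow> \<gamma> n x \<in> carrier (C m)"
  "x \<in> carrier (C n) \<Longrightarrow> \<alpha> n x \<in> carrier (H n)"
  "y \<in> carrier (H n) \<Longrightarrow> \<beta> n y \<in> carrier (C n)"
  using lin_t lin_\<delta> lin_\<gamma> lin_\<alpha> lin_\<beta> by (auto simp: linear_map_iff)

lemmas additive =
  linear_map_add[OF lin_t] linear_map_add[OF lin_\<delta>] linear_map_add[OF lin_\<gamma>]
  linear_map_add[OF lin_\<alpha>] linear_map_add[OF lin_\<beta>]
  linear_map_neg[OF lin_t] linear_map_neg[OF lin_\<delta>] linear_map_neg[OF lin_\<gamma>]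
  linear_map_neg[OF lin_\<alpha>] linear_map_neg[OF lin_\<beta>]

lemmas preserve_zero =
  linear_map_zero[OF lin_t] linear_map_zero[OF lin_\<delta>] linear_map_zero[OF lin_\<gamma>]
  linear_map_zero[OF lin_\<alpha>] linear_map_zero[OF lin_\<beta>]

lemma lin_\<gamma>\<delta>: "linear_map K (C n) (C n) (\<gamma> (n - 1) \<circ> \<delta> n)"
  using linear_map_comp[OF lin_\<delta>[of n] lin_\<gamma>[of "n - 1"]] by (simp add: o_def)

lemma one_minus_bij: "bij_betw (\<lambda>z. z \<ominus>\<^bsub>C n\<^esub> \<gamma> (n - 1) (\<delta> n z)) (carrier (C n)) (carrier (C n))"
  using locally_nilpotent_bij[OF lin_\<gamma>\<delta> nil] by (simp add: o_def)

lemma S_at: "y \<in> carrier (C n) \<Longrightarrow> S n (y \<ominus>\<^bsub>C n\<^esub> \<gamma> (n - 1) (\<delta> n y)) = \<delta> n y"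
  unfolding S_def pert_S_def
  by (rule arg_cong[of _ _ "\<delta> n"], rule inv_into_f_f[OF bij_betw_imp_inj_on[OF one_minus_bij]])

lemma S_obtain:
  assumes "x \<in> carrier (C n)"
  obtains y where "y \<in> carrier (C n)" "x = y \<ominus>\<^bsub>C n\<^esub> \<gamma> (n - 1) (\<delta> n y)" "S n x = \<delta> n y"
proof -
  have "x \<in> (\<lambda>z. z \<ominus>\<^bsub>C n\<^esub> \<gamma> (n - 1) (\<delta> n z)) ` carrier (C n)"
    using assms bij_betw_imp_surj_on[OF one_minus_bij] by simp
  then obtain y where "y \<in> carrier (C n)" "x = y \<ominus>\<^bsub>C n\<^esub> \<gamma> (n - 1) (\<delta> n y)" by auto
  with that S_at show ?thesis by blast
qed

lemma lin_S: "linear_map K (C n) (C (n - 1)) (S n)"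
proof -
  have "linear_map K (C n) (C n) (\<lambda>z. z \<ominus>\<^bsub>C n\<^esub> \<gamma> (n - 1) (\<delta> n z))"
    using linear_map_diff[OF linear_map_ident[OF C.vectorspace_axioms] lin_\<gamma>\<delta>] by (simp add: o_def)
  from linear_map_comp[OF linear_map_inv_into[OF this one_minus_bij] lin_\<delta>]
  show ?thesis by (rule linear_map_cong) (simp add: S_def pert_S_def)
qed

lemma S_closed: "x \<in> carrier (C n) \<Longrightarrow> m = n - 1 \<Longrightarrow> S n x \<in> carrier (C m)"
  using lin_S by (simp add: linear_map_iff)

lemmas S_additive = linear_map_add[OF lin_S] linear_map_neg[OF lin_S]
lemmas S_zero = linear_map_zero[OF lin_S]

lemmas [simp] = closed S_closed additive S_additive preserve_zero S_zero

lemma add_neg_cancel: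
  assumes "a \<in> carrier (C n)" "b \<in> carrier (C n)"
  shows "a \<oplus>\<^bsub>C n\<^esub> (b \<oplus>\<^bsub>C n\<^esub> \<ominus>\<^bsub>C n\<^esub> a) = b"
proof -
  have "a \<oplus>\<^bsub>C n\<^esub> (b \<oplus>\<^bsub>C n\<^esub> \<ominus>\<^bsub>C n\<^esub> a) = (a \<oplus>\<^bsub>C n\<^esub> \<ominus>\<^bsub>C n\<^esub> a) \<oplus>\<^bsub>C n\<^esub> b"
    using assms by (simp add: C.M.a_ac)
  with assms show ?thesis by (simp add: C.M.r_neg)
qed

lemma \<alpha>\<gamma>_shifted: "x \<in> carrier (C m) \<Longrightarrow> n = m + 1 \<Longrightarrow> \<alpha> n (\<gamma> m x) = \<zero>\<^bsub>H n\<^esub>"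
  and \<gamma>\<gamma>_shifted: "x \<in> carrier (C m) \<Longrightarrow> n = m + 1 \<Longrightarrow> \<gamma> n (\<gamma> m x) = \<zero>\<^bsub>C (n + 1)\<^esub>"
  using \<alpha>\<gamma>[of x m] \<gamma>\<gamma>[of x m] by (simp_all add: add.commute)

text \<open>
  The next two lemmas are the equations \<open>S = \<delta> + \<delta> \<gamma> S = \<delta> + S \<gamma> \<delta>\<close> satisfied by the
  series \<open>S = \<Sum>\<^sub>i \<delta> (\<gamma> \<delta>)\<^sup>i\<close>.
\<close>
lemma S_right:
  assumes "x \<in> carrier (C n)"
  shows "S n x = \<delta> n x \<oplus>\<^bsub>C (n - 1)\<^esub> \<delta> n (\<gamma> (n - 1) (S n x))"
proof -
  obtain y where y: "y \<in> carrier (C n)" "x = y \<ominus>\<^bsub>C n\<^esub> \<gamma> (n - 1) (\<delta> n y)" "S n x = \<delta> n y"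
    using S_obtain[OF assms] .
  show ?thesis using y(1) unfolding y(3) unfolding y(2) a_minus_def
    by (simp add: C.M.a_assoc C.M.l_neg)
qed

lemma S_left:
  assumes x: "x \<in> carrier (C n)"
  shows "S n x = \<delta> n x \<oplus>\<^bsub>C (n - 1)\<^esub> S n (\<gamma> (n - 1) (\<delta> n x))"
proof -
  let ?w = "S n (\<gamma> (n - 1) (\<delta> n x))"
  have "\<delta> n x = S n (x \<ominus>\<^bsub>C n\<^esub> \<gamma> (n - 1) (\<delta> n x))" using S_at[OF x] by simp
  also have "\<dots> = S n x \<ominus>\<^bsub>C (n - 1)\<^esub> ?w"
    using x by (simp add: a_minus_def)
  finally have "\<delta> n x \<oplus>\<^bsub>C (n - 1)\<^esub> ?w = S n x \<ominus>\<^bsub>C (n - 1)\<^esub> ?w \<oplus>\<^bsub>C (n - 1)\<^esub> ?w"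
    by (rule arg_cong)
  then show ?thesis using x by (simp add: a_minus_def C.M.a_assoc C.M.l_neg)
qed

text \<open>This is \<open>d\<^sup>2 = 0\<close> with the term \<open>t\<^sup>2 = 0\<close> removed.\<close>
lemma square_zero_split:
  assumes x: "x \<in> carrier (C n)"
  shows "t (n - 1) (\<delta> n x) \<oplus>\<^bsub>C (n - 2)\<^esub> \<delta> (n - 1) (t n x) \<oplus>\<^bsub>C (n - 2)\<^esub> \<delta> (n - 1) (\<delta> n x)
    = \<zero>\<^bsub>C (n - 2)\<^esub>"
proof -
  have "\<zero>\<^bsub>C (n - 2)\<^esub> = d (n - 1) (d n x)"
    using complex x by (simp add: chain_complex_def)
  also have "\<dots> = t (n - 1) (\<delta> n x) \<oplus>\<^bsub>C (n - 2)\<^esub> \<delta> (n - 1) (t n x) \<oplus>\<^bsub>C (n - 2)\<^esub> \<delta> (n - 1) (\<delta> n x)"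
    using x by (simp add: split tt C.M.a_ac)
  finally show ?thesis by simp
qed

text \<open>
  The identity \<open>S \<beta> \<alpha> S + t S + S t = 0\<close> carries the whole perturbation lemma: it gives
  \<open>d'\<^sup>2 = 0\<close> once \<open>\<alpha>\<close> and \<open>\<beta>\<close> are applied on the two sides, and it removes the term
  \<open>S \<beta> \<alpha> S\<close> from the chain map equations and from the homotopy equation.
\<close>
lemma S_transfer:
  assumes x: "x \<in> carrier (C n)"
  shows "S (n - 1) (\<beta> (n - 1) (\<alpha> (n - 1) (S n x))) \<oplus>\<^bsub>C (n - 2)\<^esub>
    (t (n - 1) (S n x) \<oplus>\<^bsub>C (n - 2)\<^esub> S (n - 1) (t n x)) = \<zero>\<^bsub>C (n - 2)\<^esub>"
proof -
  obtain y where y: "y \<in> carrier (C n)" "x = y \<ominus>\<^bsub>C n\<^esub> \<gamma> (n - 1) (\<delta> n y)" "S n x = \<delta> n y"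
    using S_obtain[OF x] .
  \<comment> \<open>Writing \<open>x = (1 - \<gamma> \<delta>) y\<close> turns every occurrence of \<open>S x\<close> into \<open>\<delta> y\<close>.  After \<open>\<beta> \<alpha>\<close>
    is expanded, \<open>k\<close> cancels; \<open>a = g + q\<close> and \<open>e = f + p\<close> split the remaining terms into
    \<open>c + f + g\<close>, which is the vanishing square of \<open>t + \<delta>\<close>, and its image \<open>b + p + q\<close> under
    \<open>S \<gamma>\<close>.\<close>
  define a where "a = S (n - 1) (\<delta> n y)"
  define b where "b = S (n - 1) (\<gamma> (n - 2) (t (n - 1) (\<delta> n y)))"
  define c where "c = t (n - 1) (\<delta> n y)"
  define e where "e = S (n - 1) (t n y)"
  define f where "f = \<delta> (n - 1) (t n y)"
  define g where "g = \<delta> (n - 1) (\<delta> n y)"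
  define k where "k = S (n - 1) (t n (\<gamma> (n - 1) (\<delta> n y)))"
  define p where "p = S (n - 1) (\<gamma> (n - 2) (\<delta> (n - 1) (t n y)))"
  define q where "q = S (n - 1) (\<gamma> (n - 2) (\<delta> (n - 1) (\<delta> n y)))"
  have cl: "a \<in> carrier (C (n - 2))" "b \<in> carrier (C (n - 2))" "c \<in> carrier (C (n - 2))"
    "e \<in> carrier (C (n - 2))" "f \<in> carrier (C (n - 2))" "g \<in> carrier (C (n - 2))"
    "k \<in> carrier (C (n - 2))" "p \<in> carrier (C (n - 2))" "q \<in> carrier (C (n - 2))"
    using y(1) by (simp_all add: a_def b_def c_def e_def f_def g_def k_def p_def q_def)
  have 1: "c \<oplus>\<^bsub>C (n - 2)\<^esub> f \<oplus>\<^bsub>C (n - 2)\<^esub> g = \<zero>\<^bsub>C (n - 2)\<^esub>"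
    using square_zero_split[OF y(1)] by (simp add: c_def f_def g_def)
  have "b \<oplus>\<^bsub>C (n - 2)\<^esub> p \<oplus>\<^bsub>C (n - 2)\<^esub> q = S (n - 1) (\<gamma> (n - 2) (c \<oplus>\<^bsub>C (n - 2)\<^esub> f \<oplus>\<^bsub>C (n - 2)\<^esub> g))"
    using y(1) linear_map_add[OF lin_\<gamma>[of "n - 2"]] linear_map_add[OF lin_S[of "n - 1"]]
    by (simp add: b_def p_def q_def c_def f_def g_def)
  then have 2: "b \<oplus>\<^bsub>C (n - 2)\<^esub> p \<oplus>\<^bsub>C (n - 2)\<^esub> q = \<zero>\<^bsub>C (n - 2)\<^esub>"
    unfolding 1 using linear_map_zero[OF lin_\<gamma>[of "n - 2"]] linear_map_zero[OF lin_S[of "n - 1"]] by simp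
  have ag: "a = g \<oplus>\<^bsub>C (n - 2)\<^esub> q" and ef: "e = f \<oplus>\<^bsub>C (n - 2)\<^esub> p"
    using S_left[of "\<delta> n y" "n - 1"] S_left[of "t n y" "n - 1"] y(1)
    by (simp_all add: a_def g_def q_def e_def f_def p_def)
  have "S (n - 1) (\<beta> (n - 1) (\<alpha> (n - 1) (S n x))) = a \<oplus>\<^bsub>C (n - 2)\<^esub> k \<oplus>\<^bsub>C (n - 2)\<^esub> b"
    using y(1) linear_map_add[OF lin_S[of "n - 1"]] by (simp add: y(3) \<beta>\<alpha> a_def k_def b_def)
  moreover have "S (n - 1) (t n x) = e \<ominus>\<^bsub>C (n - 2)\<^esub> k"
    using y(1) linear_map_add[OF lin_S[of "n - 1"]] linear_map_neg[OF lin_S[of "n - 1"]]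
    by (simp add: y(2) e_def k_def a_minus_def)
  moreover have "t (n - 1) (S n x) = c" by (simp add: y(3) c_def)
  moreover have "a \<oplus>\<^bsub>C (n - 2)\<^esub> k \<oplus>\<^bsub>C (n - 2)\<^esub> b \<oplus>\<^bsub>C (n - 2)\<^esub> (c \<oplus>\<^bsub>C (n - 2)\<^esub> (e \<ominus>\<^bsub>C (n - 2)\<^esub> k))
      = (c \<oplus>\<^bsub>C (n - 2)\<^esub> f \<oplus>\<^bsub>C (n - 2)\<^esub> g) \<oplus>\<^bsub>C (n - 2)\<^esub> (b \<oplus>\<^bsub>C (n - 2)\<^esub> p \<oplus>\<^bsub>C (n - 2)\<^esub> q) \<oplus>\<^bsub>C (n - 2)\<^esub> (k \<ominus>\<^bsub>C (n - 2)\<^esub> k)"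
    unfolding ag ef a_minus_def using cl by (simp add: C.M.a_ac)
  ultimately show ?thesis using cl(7) by (simp add: 1 2 a_minus_def C.M.r_neg)
qed

abbreviation "d' \<equiv> pert_d \<alpha> \<beta> S"
abbreviation "f' \<equiv> pert_f H \<alpha> \<gamma> S"
abbreviation "g' \<equiv> pert_g C \<beta> \<gamma> S"
abbreviation "h' \<equiv> pert_h C \<gamma> S"

lemma lin_d': "linear_map K (H n) (H (n - 1)) (d' n)"
  unfolding pert_d_def
  by (rule linear_map_comp[OF _ lin_\<alpha>], rule linear_map_comp[OF lin_\<beta> lin_S])

lemma lin_S\<gamma>: "linear_map K (C n) (C n) (\<lambda>x. S (n + 1) (\<gamma> n x))"
  using linear_map_comp[OF lin_\<gamma>[of n] lin_S[of "n + 1"]] by simp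

lemma lin_\<gamma>S: "linear_map K (C n) (C n) (\<lambda>x. \<gamma> (n - 1) (S n x))"
  using linear_map_comp[OF lin_S[of n] lin_\<gamma>[of "n - 1"]] by simp

lemma lin_f': "linear_map K (C n) (H n) (f' n)"
  unfolding pert_f_def
  by (rule linear_map_sum[OF lin_\<alpha>], rule linear_map_comp[OF lin_S\<gamma> lin_\<alpha>])

lemma lin_g': "linear_map K (H n) (C n) (g' n)"
  unfolding pert_g_def
  by (rule linear_map_sum[OF lin_\<beta>], rule linear_map_comp[OF lin_\<beta> lin_\<gamma>S])

lemma lin_h': "linear_map K (C n) (C (n + 1)) (h' n)"
  unfolding pert_h_def
  by (rule linear_map_sum[OF lin_\<gamma>], rule linear_map_comp[OF lin_S\<gamma> lin_\<gamma>])

lemma S\<beta>\<alpha>S: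
  assumes x: "x \<in> carrier (C n)"
  shows "S (n - 1) (\<beta> (n - 1) (\<alpha> (n - 1) (S n x))) =
    \<ominus>\<^bsub>C (n - 2)\<^esub> (t (n - 1) (S n x) \<oplus>\<^bsub>C (n - 2)\<^esub> S (n - 1) (t n x))"
  using x by (intro C.M.minus_equality[symmetric] S_transfer) simp_all

lemma complex': "chain_complex K H d'"
  unfolding chain_complex_def
proof (intro conjI allI ballI lin_d')
  fix n y assume y: "y \<in> carrier (H n)"
  have *: "\<alpha> (n - 2) (t (n - 1) x) = \<zero>\<^bsub>H (n - 2)\<^esub>" if "x \<in> carrier (C (n - 1))" for x
    using \<alpha>t[OF that] by simp
  show "d' (n - 1) (d' n y) = \<zero>\<^bsub>H (n - 2)\<^esub>"
    using y linear_map_neg[OF lin_\<alpha>] by (simp add: pert_d_def S\<beta>\<alpha>S t\<beta> S_zero[of "n - 1", simplified] * )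
qed

lemma chain_map_f': "chain_map K C d H d' f'"
  unfolding chain_map_def
proof (intro conjI allI ballI lin_f')
  fix n x assume x: "x \<in> carrier (C n)"
  have "f' (n - 1) (d n x) = \<alpha> (n - 1) (\<delta> n x) \<oplus>\<^bsub>H (n - 1)\<^esub>
      (\<alpha> (n - 1) (S n (\<gamma> (n - 1) (t n x))) \<oplus>\<^bsub>H (n - 1)\<^esub> \<alpha> (n - 1) (S n (\<gamma> (n - 1) (\<delta> n x))))"
    using x by (simp add: pert_f_def split \<alpha>t)
  also have "\<dots> = \<alpha> (n - 1) (S n (\<gamma> (n - 1) (t n x))) \<oplus>\<^bsub>H (n - 1)\<^esub> \<alpha> (n - 1) (S n x)"
    using x by (subst S_left[OF x]) (simp add: H.M.a_ac)
  also have "\<dots> = d' n (f' n x)"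
  proof -
    have "S n (\<beta> n (\<alpha> n (S (n + 1) (\<gamma> n x)))) =
        \<ominus>\<^bsub>C (n - 1)\<^esub> (t n (S (n + 1) (\<gamma> n x)) \<oplus>\<^bsub>C (n - 1)\<^esub> S n (t (n + 1) (\<gamma> n x)))"
      using S\<beta>\<alpha>S[of "\<gamma> n x" "n + 1"] x by simp
    then have "d' n (f' n x) = \<alpha> (n - 1) (S n (\<beta> n (\<alpha> n x)))
      \<oplus>\<^bsub>H (n - 1)\<^esub> (\<ominus>\<^bsub>H (n - 1)\<^esub> \<alpha> (n - 1) (S n (t (n + 1) (\<gamma> n x))))"
      using x by (simp add: pert_d_def pert_f_def \<alpha>t)
    also have "\<dots> = \<alpha> (n - 1) (S n x) \<oplus>\<^bsub>H (n - 1)\<^esub> \<alpha> (n - 1) (S n (\<gamma> (n - 1) (t n x)))"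
      using x by (simp add: \<beta>\<alpha> H.M.a_ac H.M.r_neg H.M.r_neg1 H.M.r_neg2)
    finally show ?thesis using x by (simp add: H.M.a_comm)
  qed
  finally show "f' (n - 1) (d n x) = d' n (f' n x)" .
qed

lemma chain_map_g': "chain_map K H d' C d g'"
  unfolding chain_map_def
proof (intro conjI allI ballI lin_g')
  fix n y assume y: "y \<in> carrier (H n)"
  let ?x = "\<beta> n y"
  have "\<gamma> (n - 2) (S (n - 1) (\<beta> (n - 1) (\<alpha> (n - 1) (S n ?x)))) =
      \<ominus>\<^bsub>C (n - 1)\<^esub> \<gamma> (n - 2) (t (n - 1) (S n ?x))"
    using y linear_map_neg[OF lin_\<gamma>[of "n - 2"]]
    by (simp add: S\<beta>\<alpha>S t\<beta> S_zero[of "n - 1", simplified])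
  then have "g' (n - 1) (d' n y) = S n ?x \<oplus>\<^bsub>C (n - 1)\<^esub> t n (\<gamma> (n - 1) (S n ?x))"
    using y by (simp add: pert_g_def pert_d_def \<beta>\<alpha> C.M.a_ac C.M.r_neg C.M.r_neg1 C.M.r_neg2)
  moreover have "d n (g' n y) = \<delta> n ?x \<oplus>\<^bsub>C (n - 1)\<^esub> \<delta> n (\<gamma> (n - 1) (S n ?x)) \<oplus>\<^bsub>C (n - 1)\<^esub> t n (\<gamma> (n - 1) (S n ?x))"
    using y by (simp add: pert_g_def split t\<beta> C.M.a_ac)
  ultimately show "g' (n - 1) (d' n y) = d n (g' n y)"
    using y by (simp flip: S_right)
qed

lemma homotopy':
  assumes x: "x \<in> carrier (C n)"
  shows "g' n (f' n x) = x \<oplus>\<^bsub>C n\<^esub> d (n + 1) (h' n x) \<oplus>\<^bsub>C n\<^esub> h' (n - 1) (d n x)"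
proof -
  let ?s = "S (n + 1) (\<gamma> n x)"
  have s: "?s \<in> carrier (C n)" using x by simp
  have "S n (\<beta> n (\<alpha> n ?s)) = \<ominus>\<^bsub>C (n - 1)\<^esub> (t n ?s \<oplus>\<^bsub>C (n - 1)\<^esub> S n (t (n + 1) (\<gamma> n x)))"
    using S\<beta>\<alpha>S[of "\<gamma> n x" "n + 1"] x by simp
  then have "g' n (f' n x) = x \<oplus>\<^bsub>C n\<^esub> t (n + 1) (\<gamma> n x) \<oplus>\<^bsub>C n\<^esub> \<gamma> (n - 1) (t n x) \<oplus>\<^bsub>C n\<^esub>
    (?s \<oplus>\<^bsub>C n\<^esub> t (n + 1) (\<gamma> n ?s)) \<oplus>\<^bsub>C n\<^esub>
    (\<gamma> (n - 1) (S n x) \<oplus>\<^bsub>C n\<^esub> \<gamma> (n - 1) (S n (\<gamma> (n - 1) (t n x))))"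
    using x s by (simp add: pert_g_def pert_f_def \<beta>\<alpha> C.M.a_ac C.M.minus_add C.M.r_neg C.M.r_neg1 C.M.r_neg2 add_neg_cancel)
  also have "?s \<oplus>\<^bsub>C n\<^esub> t (n + 1) (\<gamma> n ?s) =
      \<delta> (n + 1) (\<gamma> n x) \<oplus>\<^bsub>C n\<^esub> \<delta> (n + 1) (\<gamma> n ?s) \<oplus>\<^bsub>C n\<^esub> t (n + 1) (\<gamma> n ?s)"
    using S_right[of "\<gamma> n x" "n + 1"] x by simp
  also have "\<gamma> (n - 1) (S n x) = \<gamma> (n - 1) (\<delta> n x) \<oplus>\<^bsub>C n\<^esub> \<gamma> (n - 1) (S n (\<gamma> (n - 1) (\<delta> n x)))"
    using x by (subst S_left[OF x]) simp
  \<comment> \<open>The sum now consists of \<open>x\<close> and the terms of \<open>d h' x\<close> and \<open>h' d x\<close>.\<close>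
  finally show ?thesis
    using x s by (simp add: pert_h_def split C.M.a_ac)
qed

theorem contraction': "contraction K C d H d' f' g' h'"
  unfolding contraction_def
proof (intro conjI allI ballI complex complex' chain_map_f' chain_map_g' lin_h' homotopy')
  fix n y assume y: "y \<in> carrier (H n)"
  show "f' n (g' n y) = y"
    using y by (simp add: pert_f_def pert_g_def \<alpha>\<beta> \<gamma>\<beta> \<alpha>\<gamma>_shifted \<gamma>\<gamma>_shifted)
  show "h' n (g' n y) = \<zero>\<^bsub>C (n + 1)\<^esub>"
    using y by (simp add: pert_h_def pert_g_def \<gamma>\<beta> \<gamma>\<gamma>_shifted)
next
  fix n x assume x: "x \<in> carrier (C n)"
  show "f' (n + 1) (h' n x) = \<zero>\<^bsub>H (n + 1)\<^esub>"
    using x by (simp add: pert_f_def pert_h_def \<alpha>\<gamma> \<gamma>\<gamma> add.commute[of 1 n] add.commute[of 2 n])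
  show "h' (n + 1) (h' n x) = \<zero>\<^bsub>C (n + 2)\<^esub>"
    using x by (simp add: pert_h_def \<gamma>\<gamma> add.commute[of 1 n] add.commute[of 2 n])
qed

end

section \<open>Spaces graded by a poset\<close>

lemma total_space_carrier:
  "x \<in> carrier (total_space C n) \<longleftrightarrow>
   (\<forall>p. x p \<in> carrier (C p n)) \<and> finite {p. x p \<noteq> \<zero>\<^bsub>C p n\<^esub>}"
  by (auto simp: total_space_def dsum_carrier PiE_def Pi_def)

lemma total_space_zero: "\<zero>\<^bsub>total_space C n\<^esub> = (\<lambda>p. \<zero>\<^bsub>C p n\<^esub>)"
  by (simp add: total_space_def dsum_zero restrict_def)

lemma total_space_add: "x \<oplus>\<^bsub>total_space C n\<^esub> y = (\<lambda>p. x p \<oplus>\<^bsub>C p n\<^esub> y p)"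
  by (simp add: total_space_def dsum_add restrict_def)

lemma total_space_smult: "c \<odot>\<^bsub>total_space C n\<^esub> x = (\<lambda>p. c \<odot>\<^bsub>C p n\<^esub> x p)"
  by (simp add: total_space_def dsum_smult restrict_def)

lemma gincl_apply: "gincl C n q v p = (if p = q then v else \<zero>\<^bsub>C p n\<^esub>)"
  by (simp add: gincl_def dincl_def)

locale graded_space =
  fixes K :: "('k, 'e) ring_scheme" and C :: "'p::order \<Rightarrow> int \<Rightarrow> ('k, 'v) module"
  assumes field: "field K" and spaces: "\<And>p n. vectorspace K (C p n)"
begin

sublocale C: vectorspace K "C p n" for p n
  by (rule spaces)

sublocale T: vectorspace K "total_space C n" for n
  unfolding total_space_def by (rule vectorspace_dsum[OF field spaces])

lemma linear_proj: "linear_map K (total_space C n) (C p n) (\<lambda>x. x p)"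
  unfolding total_space_def
  by (rule linear_map_dsum_proj[of K UNIV "\<lambda>p. C p n", OF field spaces]) simp

lemma proj_closed: "x \<in> carrier (total_space C n) \<Longrightarrow> x p \<in> carrier (C p n)"
  by (simp add: total_space_carrier)

lemma total_space_neg:
  "x \<in> carrier (total_space C n) \<Longrightarrow> (\<ominus>\<^bsub>total_space C n\<^esub> x) p = \<ominus>\<^bsub>C p n\<^esub> x p"
  by (rule linear_map_neg[OF linear_proj])

lemma total_space_minus:
  "x \<in> carrier (total_space C n) \<Longrightarrow> y \<in> carrier (total_space C n) \<Longrightarrow>
   (x \<ominus>\<^bsub>total_space C n\<^esub> y) p = x p \<ominus>\<^bsub>C p n\<^esub> y p"
  by (rule linear_map_minus[OF linear_proj])

lemma gincl_closed: "v \<in> carrier (C q n) \<Longrightarrow> gincl C n q v \<in> carrier (total_space C n)"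
  by (auto simp: total_space_carrier gincl_apply intro: finite_subset[of _ "{q}"])

lemma gincl_linear: "linear_map K (C q n) (total_space C n) (gincl C n q)"
  unfolding linear_map_iff
  by (auto simp: gincl_closed spaces T.vectorspace_axioms total_space_add total_space_smult
      gincl_apply fun_eq_iff)

text \<open>
  A vector of the total space is a finite sum of vectors concentrated in a single degree.  The
  hypothesis \<open>single\<close> only concerns the components of \<open>x\<close> itself, so it can exploit what is known
  about the support of \<open>x\<close>.
\<close>

lemma total_space_induct [consumes 1, case_names zero single add]:
  assumes x: "x \<in> carrier (total_space C n)"
    and zero: "P \<zero>\<^bsub>total_space C n\<^esub>"
    and single: "\<And>p. x p \<noteq> \<zero>\<^bsub>C p n\<^esub> \<Longrightarrow> P (gincl C n p (x p))"
    and add: "\<And>y z. y \<in> carrier (total_space C n) \<Longrightarrow> z \<in> carrier (total_space C n) \<Longrightarrow>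
      P y \<Longrightarrow> P z \<Longrightarrow> P (y \<oplus>\<^bsub>total_space C n\<^esub> z)"
  shows "P x"
proof -
  let ?r = "\<lambda>A p. if p \<in> A then x p else \<zero>\<^bsub>C p n\<^esub>"
  have xc: "\<And>p. x p \<in> carrier (C p n)" using x by (simp add: total_space_carrier)
  have r: "?r A \<in> carrier (total_space C n)" if "finite A" for A
    using that xc by (auto simp: total_space_carrier intro: finite_subset[of _ A])
  have "P (?r A)" if "finite A" "A \<subseteq> {p. x p \<noteq> \<zero>\<^bsub>C p n\<^esub>}" for A
    using that
  proof (induction A)
    case empty
    then show ?case using zero by (simp add: total_space_zero)
  next
    case (insert q A)
    have "?r (insert q A) = gincl C n q (x q) \<oplus>\<^bsub>total_space C n\<^esub> ?r A"
      using insert(2) xc by (auto simp: total_space_add gincl_apply fun_eq_iff)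
    then show ?case
      using add[OF gincl_closed[OF xc[of q]] r[of A]] insert single[of q] by auto
  qed
  from this[of "{p. x p \<noteq> \<zero>\<^bsub>C p n\<^esub>}"] have "P (?r {p. x p \<noteq> \<zero>\<^bsub>C p n\<^esub>})"
    using x by (simp add: total_space_carrier)
  moreover have "?r {p. x p \<noteq> \<zero>\<^bsub>C p n\<^esub>} = x" by (auto simp: fun_eq_iff)
  ultimately show ?thesis by simp
qed

end

lemma componentwise_closed:
  assumes f: "\<And>p. linear_map K (C p m) (C' p n) (f p)" and x: "x \<in> carrier (total_space C m)"
  shows "(\<lambda>p. f p (x p)) \<in> carrier (total_space C' n)"
proof -
  have "{p. f p (x p) \<noteq> \<zero>\<^bsub>C' p n\<^esub>} \<subseteq> {p. x p \<noteq> \<zero>\<^bsub>C p m\<^esub>}"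
    using linear_map_zero[OF f] by auto
  then show ?thesis
    using x linear_map_closed[OF f] by (auto simp: total_space_carrier intro: finite_subset)
qed

lemma linear_map_componentwise:
  assumes "graded_space K C" "graded_space K C'"
    and f: "\<And>p. linear_map K (C p m) (C' p n) (f p)"
  shows "linear_map K (total_space C m) (total_space C' n) (\<lambda>x p. f p (x p))"
proof -
  interpret C: graded_space K C by fact
  interpret C': graded_space K C' by fact
  show ?thesis
    using f componentwise_closed[where C = C and C' = C' and f = f and K = K, OF f] C.T.vectorspace_axioms C'.T.vectorspace_axioms
    by (auto simp: linear_map_iff total_space_add total_space_smult total_space_carrier)
qed

lemma (in abelian_monoid) finsum_single:
  assumes "finite S" and "\<And>i. i \<in> S \<Longrightarrow> i \<noteq> i0 \<Longrightarrow> g i = \<zero>" and "g i0 \<in> carrier G"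
    and "i0 \<notin> S \<Longrightarrow> g i0 = \<zero>"
  shows "finsum G g S = g i0"
proof -
  have "g \<in> S \<rightarrow> carrier G" using assms by (metis Pi_I zero_closed)
  then have "finsum G g S = finsum G g {i0}"
    using assms by (intro add.finprod_mono_neutral_cong) auto
  then show ?thesis using assms by simp
qed

lemma (in graded_space) lfsum_apply:
  assumes "\<And>i. i \<in> A \<Longrightarrow> F i \<in> carrier (total_space C n)"
    and "finite {i \<in> A. F i \<noteq> \<zero>\<^bsub>total_space C n\<^esub>}"
  shows "lfsum (total_space C n) F A p =
    finsum (C p n) (\<lambda>i. F i p) {i \<in> A. F i \<noteq> \<zero>\<^bsub>total_space C n\<^esub>}"
  unfolding lfsum_def using assms by (intro linear_map_finsum[OF linear_proj]) auto

text \<open>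
  If the summands lie in pairwise different degrees, then in each degree at most one of them
  contributes, and the sum is the vector \<open>y\<close> whose components are the summands.
\<close>

lemma (in graded_space) lfsum_gincl:
  assumes y: "y \<in> carrier (total_space C n)" and inj: "inj_on \<pi> A"
    and F: "\<And>i. i \<in> A \<Longrightarrow> F i = gincl C n (\<pi> i) (y (\<pi> i))"
    and out: "\<And>p. p \<notin> \<pi> ` A \<Longrightarrow> y p = \<zero>\<^bsub>C p n\<^esub>"
  shows "lfsum (total_space C n) F A = y"
proof
  fix p
  let ?S = "{i \<in> A. F i \<noteq> \<zero>\<^bsub>total_space C n\<^esub>}"
  have yc: "\<And>p. y p \<in> carrier (C p n)" using y by (simp add: total_space_carrier)
  have Fc: "\<And>i. i \<in> A \<Longrightarrow> F i \<in> carrier (total_space C n)" by (simp add: F gincl_closed yc)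
  have S: "i \<in> ?S \<longleftrightarrow> i \<in> A \<and> y (\<pi> i) \<noteq> \<zero>\<^bsub>C (\<pi> i) n\<^esub>" for i
    by (auto simp: F total_space_zero gincl_apply fun_eq_iff split: if_splits)
  have "\<pi> ` ?S \<subseteq> {p. y p \<noteq> \<zero>\<^bsub>C p n\<^esub>}" using S by blast
  then have "finite (\<pi> ` ?S)" using y by (auto simp: total_space_carrier intro: finite_subset)
  then have fin: "finite ?S" by (rule finite_imageD) (use inj in \<open>auto simp: inj_on_def\<close>)
  have *: "lfsum (total_space C n) F A p = finsum (C p n) (\<lambda>i. F i p) ?S"
    by (rule lfsum_apply[OF Fc fin])
  show "lfsum (total_space C n) F A p = y p"
  proof (cases "p \<in> \<pi> ` A")
    case True
    then obtain i where i: "i \<in> A" "p = \<pi> i" by auto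
    have "finsum (C p n) (\<lambda>i. F i p) ?S = F i p"
    proof (rule C.M.finsum_single[OF fin])
      show "F j p = \<zero>\<^bsub>C p n\<^esub>" if "j \<in> ?S" "j \<noteq> i" for j
        using that i inj by (auto simp: F gincl_apply inj_on_def)
      show "F i p \<in> carrier (C p n)" using i yc by (simp add: F gincl_apply)
      show "F i p = \<zero>\<^bsub>C p n\<^esub>" if "i \<notin> ?S"
        using that i by (auto simp: F gincl_apply total_space_zero)
    qed
    then show ?thesis using * i by (simp add: F gincl_apply)
  next
    case False
    have "finsum (C p n) (\<lambda>i. F i p) ?S = finsum (C p n) (\<lambda>i. \<zero>\<^bsub>C p n\<^esub>) ?S"
      using False by (intro C.M.finsum_cong') (auto simp: F gincl_apply)
    then show ?thesis using * out[OF False] by (simp add: C.M.finsum_zero)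
  qed
qed

section \<open>Filtered maps\<close>

text \<open>
  Filteredness is defined by matrix entries, for which composites are awkward: an entry of a
  composite is a sum over all intermediate degrees.  Equivalently, a filtered map preserves the
  subspaces of vectors supported below each \<open>q\<close>, and this property is visibly closed under
  composition, sums and inverses of \<open>1 - N\<close> with \<open>N\<close> locally nilpotent.
\<close>
definition supported ::
  "('p \<Rightarrow> int \<Rightarrow> ('k, 'v) module) \<Rightarrow> int \<Rightarrow> 'p set \<Rightarrow> ('p \<Rightarrow> 'v) set" where
  "supported C n D = {x \<in> carrier (total_space C n). \<forall>p. x p \<noteq> \<zero>\<^bsub>C p n\<^esub> \<longrightarrow> p \<in> D}"

lemma (in graded_space) supported_gincl:
  "v \<in> carrier (C q n) \<Longrightarrow> q \<in> D \<Longrightarrow> gincl C n q v \<in> supported C n D"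
  by (auto simp: supported_def gincl_closed gincl_apply)

lemma (in graded_space) supported_zero: "\<zero>\<^bsub>total_space C n\<^esub> \<in> supported C n D"
  unfolding supported_def using T.M.zero_closed by (simp add: total_space_zero)

lemma (in graded_space) supported_add:
  assumes "x \<in> supported C n D" "y \<in> supported C n D"
  shows "x \<oplus>\<^bsub>total_space C n\<^esub> y \<in> supported C n D"
proof -
  have "x p \<oplus>\<^bsub>C p n\<^esub> y p \<noteq> \<zero>\<^bsub>C p n\<^esub> \<Longrightarrow> x p \<noteq> \<zero>\<^bsub>C p n\<^esub> \<or> y p \<noteq> \<zero>\<^bsub>C p n\<^esub>" for p by auto
  with assms show ?thesis using T.M.a_closed[of x n y] by (fastforce simp: supported_def total_space_add)
qed

lemma supported_linear:
  assumes "graded_space K C" "graded_space K C'"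
    and f: "linear_map K (total_space C m) (total_space C' n) f"
    and gen: "\<And>q v. q \<in> D \<Longrightarrow> v \<in> carrier (C q m) \<Longrightarrow> f (gincl C m q v) \<in> supported C' n D'"
    and x: "x \<in> supported C m D"
  shows "f x \<in> supported C' n D'"
proof -
  interpret C: graded_space K C by fact
  interpret C': graded_space K C' by fact
  have "x \<in> carrier (total_space C m)" using x by (simp add: supported_def)
  then show ?thesis
  proof (induction x rule: C.total_space_induct)
    case zero
    show ?case using C'.supported_zero by (simp add: linear_map_zero[OF f])
  next
    case (single p)
    then show ?case using x gen[of p "x p"] by (auto simp: supported_def total_space_carrier)
  next
    case (add y z)
    then show ?case by (simp add: linear_map_add[OF f] C'.supported_add)
  qed
qed

lemma filtered_iff_supported:
  assumes C: "graded_space K C" and C': "graded_space K C'"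
    and f: "linear_map K (total_space C m) (total_space C' n) f"
  shows "filtered C m C' n f \<longleftrightarrow> (\<forall>q. \<forall>x\<in>supported C m {..q}. f x \<in> supported C' n {..q})"
    (is "?L \<longleftrightarrow> ?R")
proof
  interpret C: graded_space K C by fact
  assume L: ?L
  show ?R
  proof (intro allI ballI)
    fix q x assume x: "x \<in> supported C m {..q}"
    show "f x \<in> supported C' n {..q}"
    proof (rule supported_linear[OF C C' f _ x])
      fix r v assume "r \<in> {..q}" "v \<in> carrier (C r m)"
      then show "f (gincl C m r v) \<in> supported C' n {..q}"
        using L linear_map_closed[OF f C.gincl_closed[of v r]]
        unfolding supported_def filtered_def by fastforce
    qed
  qed
next
  interpret C: graded_space K C by fact
  assume R: ?R
  show ?L unfolding filtered_def
  proof (intro allI impI)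
    fix p q assume "\<exists>v\<in>carrier (C q m). f (gincl C m q v) p \<noteq> \<zero>\<^bsub>C' p n\<^esub>"
    then obtain v where v: "v \<in> carrier (C q m)" "f (gincl C m q v) p \<noteq> \<zero>\<^bsub>C' p n\<^esub>" by auto
    have "f (gincl C m q v) \<in> supported C' n {..q}" using R C.supported_gincl[of v q] v by blast
    with v show "p \<le> q" by (auto simp: supported_def)
  qed
qed

lemma filtered_comp:
  assumes C: "graded_space K C" and C': "graded_space K C'" and C'': "graded_space K C''"
    and f: "linear_map K (total_space C l) (total_space C' m) f" "filtered C l C' m f"
    and g: "linear_map K (total_space C' m) (total_space C'' n) g" "filtered C' m C'' n g"
  shows "filtered C l C'' n (\<lambda>x. g (f x))"
  using f(2) g(2)
  unfolding filtered_iff_supported[OF C C' f(1)] filtered_iff_supported[OF C' C'' g(1)]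
    filtered_iff_supported[OF C C'' linear_map_comp[OF f(1) g(1)]] by blast

lemma filtered_sum:
  assumes C: "graded_space K C" and C': "graded_space K C'"
    and f: "linear_map K (total_space C m) (total_space C' n) f" "filtered C m C' n f"
    and g: "linear_map K (total_space C m) (total_space C' n) g" "filtered C m C' n g"
  shows "filtered C m C' n (\<lambda>x. f x \<oplus>\<^bsub>total_space C' n\<^esub> g x)"
  using f(2) g(2) graded_space.supported_add[OF C']
  unfolding filtered_iff_supported[OF C C' f(1)] filtered_iff_supported[OF C C' g(1)]
    filtered_iff_supported[OF C C' linear_map_sum[OF f(1) g(1)]] by blast

lemma filtered_componentwise:
  assumes "\<And>p. linear_map K (C p m) (C' p n) (f p)"
  shows "filtered C m C' n (\<lambda>x p. f p (x p))"
  unfolding filtered_def gincl_apply using linear_map_zero[OF assms] by auto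

text \<open>
  By well-founded induction on \<open>q\<close>: a vector of degree \<open>q\<close> is sent to a finite sum of vectors of
  smaller degrees, each killed by some power of \<open>N\<close>, and the sum is killed by a sufficiently high
  power.
\<close>

lemma strictly_lowering_nilpotent:
  assumes C: "graded_space K C" and wf: "wfp ((<) :: 'p::order \<Rightarrow> 'p \<Rightarrow> bool)"
    and N: "linear_map K (total_space C n) (total_space C n) N"
    and lower: "\<And>(q::'p) v. v \<in> carrier (C q n) \<Longrightarrow> N (gincl C n q v) \<in> supported C n {..<q}"
  shows "locally_nilpotent (total_space C n) N"
proof -
  interpret C: graded_space K C by fact
  let ?Z = "\<zero>\<^bsub>total_space C n\<^esub>"
  have lin: "linear_map K (total_space C n) (total_space C n) (N ^^ k)" for k
  proof (induction k)
    case 0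
    then show ?case using linear_map_ident[OF C.T.vectorspace_axioms] by (simp add: id_def)
  next
    case (Suc k)
    then show ?case using linear_map_comp[OF _ N] by (simp add: o_def)
  qed
  have sums: "\<exists>k. (N ^^ k) (y \<oplus>\<^bsub>total_space C n\<^esub> z) = ?Z"
    if "y \<in> carrier (total_space C n)" "z \<in> carrier (total_space C n)"
      "\<exists>k. (N ^^ k) y = ?Z" "\<exists>k. (N ^^ k) z = ?Z" for y z
  proof -
    obtain k l where kl: "(N ^^ k) y = ?Z" "(N ^^ l) z = ?Z" using \<open>\<exists>k. (N ^^ k) y = ?Z\<close> \<open>\<exists>k. (N ^^ k) z = ?Z\<close> by auto
    have "(N ^^ (k + l)) (y \<oplus>\<^bsub>total_space C n\<^esub> z) = (N ^^ (l + k)) y \<oplus>\<^bsub>total_space C n\<^esub> (N ^^ (k + l)) z"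
      using that(1,2) by (simp add: linear_map_add[OF lin] add.commute)
    also have "\<dots> = ?Z" by (simp add: funpow_add kl linear_map_zero[OF lin])
    finally show ?thesis ..
  qed
  \<comment> \<open>First for vectors of a single degree, by induction on that degree.\<close>
  have homogeneous: "\<exists>k. (N ^^ k) (gincl C n q v) = ?Z" if "v \<in> carrier (C q n)" for q v
    using that
  proof (induction q arbitrary: v rule: wfp_induct_rule[OF wf])
    case (1 q)
    define y where "y = N (gincl C n q v)"
    have y: "y \<in> supported C n {..<q}" unfolding y_def by (rule lower[OF 1(2)])
    then have "y \<in> carrier (total_space C n)" by (simp add: supported_def)
    then have "\<exists>k. (N ^^ k) y = ?Z"
    proof (induction y rule: C.total_space_induct)
      case zero
      show ?case by (rule exI[of _ 0]) simp
    next
      case (single p)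
      with y have "p < q" by (auto simp: supported_def)
      then show ?case using 1(1) y by (auto simp: supported_def total_space_carrier)
    next
      case (add y z)
      then show ?case by (intro sums)
    qed
    then obtain k where "(N ^^ k) y = ?Z" ..
    then have "(N ^^ Suc k) (gincl C n q v) = ?Z" by (simp add: y_def funpow_swap1)
    then show ?case by blast
  qed
  show ?thesis unfolding locally_nilpotent_def
  proof
    fix x assume x: "x \<in> carrier (total_space C n)"
    then show "\<exists>k. (N ^^ k) x = ?Z"
    proof (induction x rule: C.total_space_induct)
      case zero
      show ?case by (rule exI[of _ 0]) simp
    next
      case (single p)
      then show ?case using homogeneous x by (simp add: total_space_carrier)
    next
      case (add y z)
      then show ?case by (intro sums)
    qed
  qed
qed

section \<open>The contraction of a homology decomposition\<close>

text \<open>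
  A homology decomposition is linear, hence its codomain \<open>H \<oplus> B \<oplus> K\<close> is a vector space.
  Reading off the axioms in each component shows that the three factors are vector spaces,
  including the homology \<open>H\<close>.
\<close>
lemma vectorspace_direct_sumD:
  assumes "vectorspace K (direct_sum V W)"
  shows "vectorspace K V" "vectorspace K W"
proof -
  interpret vectorspace K "direct_sum V W" by fact
  have F: "field K" ..
  have zV: "\<zero>\<^bsub>V\<^esub> \<in> carrier V" and zW: "\<zero>\<^bsub>W\<^esub> \<in> carrier W"
    using M.zero_closed by (simp_all add: direct_sum_def)
  have cl: "fst x \<oplus>\<^bsub>V\<^esub> fst y \<in> carrier V \<and> snd x \<oplus>\<^bsub>W\<^esub> snd y \<in> carrier W"
    if "x \<in> carrier V \<times> carrier W" "y \<in> carrier V \<times> carrier W" for x y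
    using M.a_closed[of x y] that by (simp add: direct_sum_def)
  have neg: "\<exists>y\<in>carrier V \<times> carrier W. fst x \<oplus>\<^bsub>V\<^esub> fst y = \<zero>\<^bsub>V\<^esub> \<and> snd x \<oplus>\<^bsub>W\<^esub> snd y = \<zero>\<^bsub>W\<^esub>"
    if "x \<in> carrier V \<times> carrier W" for x
    using M.r_neg[of x] M.a_inv_closed[of x] that
    by (intro bexI[of _ "\<ominus>\<^bsub>direct_sum V W\<^esub> x"]) (simp_all add: direct_sum_def)
  have sm: "c \<odot>\<^bsub>V\<^esub> fst x \<in> carrier V \<and> c \<odot>\<^bsub>W\<^esub> snd x \<in> carrier W"
    if "c \<in> carrier K" "x \<in> carrier V \<times> carrier W" for c x
    using smult_closed[of c x] that by (simp add: direct_sum_def)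
  have comm: "fst x \<oplus>\<^bsub>V\<^esub> fst y = fst y \<oplus>\<^bsub>V\<^esub> fst x \<and> snd x \<oplus>\<^bsub>W\<^esub> snd y = snd y \<oplus>\<^bsub>W\<^esub> snd x"
    if "x \<in> carrier V \<times> carrier W" "y \<in> carrier V \<times> carrier W" for x y
    using M.a_comm[of x y] that by (simp add: direct_sum_def)
  have assoc: "fst x \<oplus>\<^bsub>V\<^esub> fst y \<oplus>\<^bsub>V\<^esub> fst z = fst x \<oplus>\<^bsub>V\<^esub> (fst y \<oplus>\<^bsub>V\<^esub> fst z) \<and>
      snd x \<oplus>\<^bsub>W\<^esub> snd y \<oplus>\<^bsub>W\<^esub> snd z = snd x \<oplus>\<^bsub>W\<^esub> (snd y \<oplus>\<^bsub>W\<^esub> snd z)"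
    if "x \<in> carrier V \<times> carrier W" "y \<in> carrier V \<times> carrier W" "z \<in> carrier V \<times> carrier W" for x y z
    using M.a_assoc[of x y z] that by (simp add: direct_sum_def)
  have id: "fst x \<oplus>\<^bsub>V\<^esub> \<zero>\<^bsub>V\<^esub> = fst x \<and> snd x \<oplus>\<^bsub>W\<^esub> \<zero>\<^bsub>W\<^esub> = snd x"
    if "x \<in> carrier V \<times> carrier W" for x
    using M.r_zero[of x] that by (auto simp: direct_sum_def prod_eq_iff)
  have compat: "(a \<otimes>\<^bsub>K\<^esub> b) \<odot>\<^bsub>V\<^esub> fst x = a \<odot>\<^bsub>V\<^esub> (b \<odot>\<^bsub>V\<^esub> fst x) \<and>
      (a \<otimes>\<^bsub>K\<^esub> b) \<odot>\<^bsub>W\<^esub> snd x = a \<odot>\<^bsub>W\<^esub> (b \<odot>\<^bsub>W\<^esub> snd x)"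
    if "a \<in> carrier K" "b \<in> carrier K" "x \<in> carrier V \<times> carrier W" for a b x
    using smult_assoc1[of a b x] that by (simp add: direct_sum_def)
  have one: "\<one>\<^bsub>K\<^esub> \<odot>\<^bsub>V\<^esub> fst x = fst x \<and> \<one>\<^bsub>K\<^esub> \<odot>\<^bsub>W\<^esub> snd x = snd x"
    if "x \<in> carrier V \<times> carrier W" for x
    using smult_one[of x] that by (auto simp: direct_sum_def prod_eq_iff)
  have dl: "(a \<oplus>\<^bsub>K\<^esub> b) \<odot>\<^bsub>V\<^esub> fst x = a \<odot>\<^bsub>V\<^esub> fst x \<oplus>\<^bsub>V\<^esub> b \<odot>\<^bsub>V\<^esub> fst x \<and>
      (a \<oplus>\<^bsub>K\<^esub> b) \<odot>\<^bsub>W\<^esub> snd x = a \<odot>\<^bsub>W\<^esub> snd x \<oplus>\<^bsub>W\<^esub> b \<odot>\<^bsub>W\<^esub> snd x"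
    if "a \<in> carrier K" "b \<in> carrier K" "x \<in> carrier V \<times> carrier W" for a b x
    using smult_l_distr[of a b x] that by (simp add: direct_sum_def)
  have dr: "a \<odot>\<^bsub>V\<^esub> (fst x \<oplus>\<^bsub>V\<^esub> fst y) = a \<odot>\<^bsub>V\<^esub> fst x \<oplus>\<^bsub>V\<^esub> a \<odot>\<^bsub>V\<^esub> fst y \<and>
      a \<odot>\<^bsub>W\<^esub> (snd x \<oplus>\<^bsub>W\<^esub> snd y) = a \<odot>\<^bsub>W\<^esub> snd x \<oplus>\<^bsub>W\<^esub> a \<odot>\<^bsub>W\<^esub> snd y"
    if "a \<in> carrier K" "x \<in> carrier V \<times> carrier W" "y \<in> carrier V \<times> carrier W" for a x y
    using smult_r_distr[of a x y] that by (simp add: direct_sum_def)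
  have V: "(v, \<zero>\<^bsub>W\<^esub>) \<in> carrier V \<times> carrier W" if "v \<in> carrier V" for v
    using that zW by simp
  have W: "(\<zero>\<^bsub>V\<^esub>, w) \<in> carrier V \<times> carrier W" if "w \<in> carrier W" for w
    using that zV by simp
  show "vectorspace K V"
    using V cl[OF V V] neg[OF V] sm[OF _ V] comm[OF V V] assoc[OF V V V] id[OF V]
      compat[OF _ _ V] one[OF V] dl[OF _ _ V] dr[OF _ V V]
    by (intro vs_criteria F zV) auto
  show "vectorspace K W"
    using W cl[OF W W] neg[OF W] sm[OF _ W] comm[OF W W] assoc[OF W W W] id[OF W]
      compat[OF _ _ W] one[OF W] dl[OF _ _ W] dr[OF _ W W]
    by (intro vs_criteria F zW) auto
qed

lemma fst_linear:
  assumes "vectorspace K V" "vectorspace K W" shows "linear_map K (direct_sum V W) V fst"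
  using direct_sum_is_vs[OF assms] assms by (auto simp: linear_map_iff direct_sum_def)

lemma snd_linear:
  assumes "vectorspace K V" "vectorspace K W" shows "linear_map K (direct_sum V W) W snd"
  using direct_sum_is_vs[OF assms] assms by (auto simp: linear_map_iff direct_sum_def)

locale decomposed_complex =
  fixes K :: "('k, 'e) ring_scheme" and C :: "'p::order \<Rightarrow> int \<Rightarrow> ('k, 'v) module"
    and d :: "int \<Rightarrow> ('p \<Rightarrow> 'v) \<Rightarrow> ('p \<Rightarrow> 'v)"
    and \<zeta> :: "'p \<Rightarrow> int \<Rightarrow> 'v \<Rightarrow> 'v set \<times> 'v \<times> 'v"
  assumes field: "field K" and wf: "wfp ((<) :: 'p \<Rightarrow> 'p \<Rightarrow> bool)"
    and graded: "graded_complex K C d" and decomposition: "homology_decomposition K C d \<zeta>"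
begin

abbreviation "H \<equiv> Hsp C d"
abbreviation "B \<equiv> Bsp C d"
abbreviation "Kp \<equiv> Ksp C d"

sublocale C: graded_space K C
  using field graded by (intro graded_space.intro) (simp_all add: graded_complex_def)

lemma complex: "chain_complex K (total_space C) d"
  and filtered_d: "filtered C n C (n - 1) (d n)"
  using graded by (simp_all add: graded_complex_def)

lemma d_linear: "linear_map K (total_space C n) (total_space C (n - 1)) (d n)"
  using complex by (simp add: chain_complex_def)

lemma \<zeta>_linear: "linear_map K (C p n) (HBK C d p n) (\<zeta> p n)"
  and \<zeta>_bij: "bij_betw (\<zeta> p n) (carrier (C p n)) (carrier (HBK C d p n))"
  using decomposition by (simp_all add: homology_decomposition_def lin_iso_def)

lemma HBK_spaces: "vectorspace K (H p n)" "vectorspace K (B p n)" "vectorspace K (Kp p n)"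
  "vectorspace K (direct_sum (B p n) (Kp p n))"
proof -
  have v: "vectorspace K (direct_sum (H p n) (direct_sum (B p n) (Kp p n)))"
    using \<zeta>_linear[of p n] by (simp add: linear_map_iff HBK_def)
  show "vectorspace K (H p n)" "vectorspace K (direct_sum (B p n) (Kp p n))"
    using vectorspace_direct_sumD[OF v] .
  then show "vectorspace K (B p n)" "vectorspace K (Kp p n)"
    using vectorspace_direct_sumD by blast+
qed

sublocale H: graded_space K H by (intro graded_space.intro field HBK_spaces)
sublocale B: graded_space K B by (intro graded_space.intro field HBK_spaces)
sublocale Kp: graded_space K Kp by (intro graded_space.intro field HBK_spaces)

definition h_part :: "'p \<Rightarrow> int \<Rightarrow> 'v \<Rightarrow> 'v set" where "h_part p n v = fst (\<zeta> p n v)"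
definition b_part :: "'p \<Rightarrow> int \<Rightarrow> 'v \<Rightarrow> 'v" where "b_part p n v = fst (snd (\<zeta> p n v))"
definition k_part :: "'p \<Rightarrow> int \<Rightarrow> 'v \<Rightarrow> 'v" where "k_part p n v = snd (snd (\<zeta> p n v))"
definition h_in :: "'p \<Rightarrow> int \<Rightarrow> 'v set \<Rightarrow> 'v" where
  "h_in p n h = zeta_inv C \<zeta> p n (h, \<zero>\<^bsub>B p n\<^esub>, \<zero>\<^bsub>Kp p n\<^esub>)"
definition b_in :: "'p \<Rightarrow> int \<Rightarrow> 'v \<Rightarrow> 'v" where
  "b_in p n b = zeta_inv C \<zeta> p n (\<zero>\<^bsub>H p n\<^esub>, b, \<zero>\<^bsub>Kp p n\<^esub>)"
definition k_in :: "'p \<Rightarrow> int \<Rightarrow> 'v \<Rightarrow> 'v" where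
  "k_in p n k = zeta_inv C \<zeta> p n (\<zero>\<^bsub>H p n\<^esub>, \<zero>\<^bsub>B p n\<^esub>, k)"

lemma HBK_carrier: "(h, b, k) \<in> carrier (HBK C d p n) \<longleftrightarrow>
    h \<in> carrier (H p n) \<and> b \<in> carrier (B p n) \<and> k \<in> carrier (Kp p n)"
  by (simp add: HBK_def direct_sum_def)

lemma zeta_inv_linear: "linear_map K (HBK C d p n) (C p n) (zeta_inv C \<zeta> p n)"
  unfolding zeta_inv_def by (rule linear_map_inv_into[OF \<zeta>_linear \<zeta>_bij])

lemma part_linear:
  "linear_map K (C p n) (H p n) (h_part p n)"
  "linear_map K (C p n) (B p n) (b_part p n)"
  "linear_map K (C p n) (Kp p n) (k_part p n)"
proof -
  note l = \<zeta>_linear[of p n, unfolded HBK_def]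
  note s = linear_map_comp[OF l snd_linear[OF HBK_spaces(1) HBK_spaces(4)]]
  show "linear_map K (C p n) (H p n) (h_part p n)"
    using linear_map_comp[OF l fst_linear[OF HBK_spaces(1) HBK_spaces(4)]]
    by (rule linear_map_cong) (simp add: h_part_def)
  show "linear_map K (C p n) (B p n) (b_part p n)"
    using linear_map_comp[OF s fst_linear[OF HBK_spaces(2) HBK_spaces(3)]]
    by (rule linear_map_cong) (simp add: b_part_def)
  show "linear_map K (C p n) (Kp p n) (k_part p n)"
    using linear_map_comp[OF s snd_linear[OF HBK_spaces(2) HBK_spaces(3)]]
    by (rule linear_map_cong) (simp add: k_part_def)
qed

lemma in_linear:
  "linear_map K (H p n) (C p n) (h_in p n)"
  "linear_map K (B p n) (C p n) (b_in p n)"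
  "linear_map K (Kp p n) (C p n) (k_in p n)"
proof -
  note z = zeta_inv_linear[of p n, unfolded HBK_def]
  note i2 = inj2_linear[OF HBK_spaces(1) HBK_spaces(4)]
  show "linear_map K (H p n) (C p n) (h_in p n)"
    using linear_map_comp[OF inj1_linear[OF HBK_spaces(1) HBK_spaces(4)] z]
    by (rule linear_map_cong) (simp add: h_in_def inj1_def direct_sum_def)
  show "linear_map K (B p n) (C p n) (b_in p n)"
    using linear_map_comp[OF linear_map_comp[OF inj1_linear[OF HBK_spaces(2) HBK_spaces(3)] i2] z]
    by (rule linear_map_cong) (simp add: b_in_def inj1_def inj2_def)
  show "linear_map K (Kp p n) (C p n) (k_in p n)"
    using linear_map_comp[OF linear_map_comp[OF inj2_linear[OF HBK_spaces(2) HBK_spaces(3)] i2] z]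
    by (rule linear_map_cong) (simp add: k_in_def inj2_def)
qed

lemmas part_closed = part_linear[THEN linear_map_closed]
lemmas in_closed = in_linear[THEN linear_map_closed]
lemmas in_zero = in_linear[THEN linear_map_zero]

lemma \<zeta>_zeta_inv: "w \<in> carrier (HBK C d p n) \<Longrightarrow> \<zeta> p n (zeta_inv C \<zeta> p n w) = w"
  unfolding zeta_inv_def using \<zeta>_bij[of p n] by (simp add: f_inv_into_f bij_betw_def)

lemma zeta_inv_\<zeta>: "v \<in> carrier (C p n) \<Longrightarrow> zeta_inv C \<zeta> p n (\<zeta> p n v) = v"
  unfolding zeta_inv_def using \<zeta>_bij[of p n] by (simp add: inv_into_f_f bij_betw_def)

lemma part_in [simp]:
  "h \<in> carrier (H p n) \<Longrightarrow> h_part p n (h_in p n h) = h"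
  "h \<in> carrier (H p n) \<Longrightarrow> b_part p n (h_in p n h) = \<zero>\<^bsub>B p n\<^esub>"
  "h \<in> carrier (H p n) \<Longrightarrow> k_part p n (h_in p n h) = \<zero>\<^bsub>Kp p n\<^esub>"
  "b \<in> carrier (B p n) \<Longrightarrow> h_part p n (b_in p n b) = \<zero>\<^bsub>H p n\<^esub>"
  "b \<in> carrier (B p n) \<Longrightarrow> b_part p n (b_in p n b) = b"
  "b \<in> carrier (B p n) \<Longrightarrow> k_part p n (b_in p n b) = \<zero>\<^bsub>Kp p n\<^esub>"
  "k \<in> carrier (Kp p n) \<Longrightarrow> h_part p n (k_in p n k) = \<zero>\<^bsub>H p n\<^esub>"
  "k \<in> carrier (Kp p n) \<Longrightarrow> b_part p n (k_in p n k) = \<zero>\<^bsub>B p n\<^esub>"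
  "k \<in> carrier (Kp p n) \<Longrightarrow> k_part p n (k_in p n k) = k"
  by (simp_all add: h_part_def b_part_def k_part_def h_in_def b_in_def k_in_def
      \<zeta>_zeta_inv HBK_carrier)

lemma parts_sum:
  assumes v: "v \<in> carrier (C p n)"
  shows "v = h_in p n (h_part p n v) \<oplus>\<^bsub>C p n\<^esub> b_in p n (b_part p n v) \<oplus>\<^bsub>C p n\<^esub> k_in p n (k_part p n v)"
proof -
  have c: "(h_part p n v, \<zero>\<^bsub>B p n\<^esub>, \<zero>\<^bsub>Kp p n\<^esub>) \<in> carrier (HBK C d p n)"
    "(\<zero>\<^bsub>H p n\<^esub>, b_part p n v, \<zero>\<^bsub>Kp p n\<^esub>) \<in> carrier (HBK C d p n)"
    "(\<zero>\<^bsub>H p n\<^esub>, \<zero>\<^bsub>B p n\<^esub>, k_part p n v) \<in> carrier (HBK C d p n)"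
    "(h_part p n v, b_part p n v, \<zero>\<^bsub>Kp p n\<^esub>) \<in> carrier (HBK C d p n)"
    using v by (simp_all add: HBK_carrier part_closed)
  have "h_in p n (h_part p n v) \<oplus>\<^bsub>C p n\<^esub> b_in p n (b_part p n v)
      = zeta_inv C \<zeta> p n (h_part p n v, b_part p n v, \<zero>\<^bsub>Kp p n\<^esub>)"
    unfolding h_in_def b_in_def linear_map_add[OF zeta_inv_linear c(1,2), symmetric]
    using v by (simp add: HBK_def direct_sum_def part_closed)
  also have "\<dots> \<oplus>\<^bsub>C p n\<^esub> k_in p n (k_part p n v)
      = zeta_inv C \<zeta> p n (h_part p n v, b_part p n v, k_part p n v)"
    unfolding k_in_def linear_map_add[OF zeta_inv_linear c(4,3), symmetric]
    using v by (simp add: HBK_def direct_sum_def part_closed)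
  also have "\<dots> = v" using zeta_inv_\<zeta>[OF v] by (simp add: h_part_def b_part_def k_part_def)
  finally show ?thesis by simp
qed

lemma parts_eqI:
  assumes "v \<in> carrier (C p n)" "w \<in> carrier (C p n)"
    and "h_part p n v = h_part p n w" "b_part p n v = b_part p n w" "k_part p n v = k_part p n w"
  shows "v = w"
  using parts_sum[OF assms(1)] parts_sum[OF assms(2)] assms(3-) by simp

lemma Kp_eq: "Kp p n = B p (n - 1)" "Kp p (n + 1) = B p n"
  by (simp_all add: Ksp_def)

lemma rel_diff_linear: "linear_map K (C p n) (C p (n - 1)) (rel_diff C d p n)"
  using linear_map_comp[OF linear_map_comp[OF C.gincl_linear d_linear] C.linear_proj]
  by (rule linear_map_cong) (simp add: rel_diff_def)

lemma rel_diff_zeta_inv: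
  assumes "h \<in> carrier (H p n)" "b \<in> carrier (B p n)" "k \<in> carrier (Kp p n)"
  shows "rel_diff C d p n (zeta_inv C \<zeta> p n (h, b, k)) = b_in p (n - 1) k"
proof -
  have "zeta_inv C \<zeta> p n (h, b, k) \<in> carrier (C p n)"
    using assms by (intro linear_map_closed[OF zeta_inv_linear]) (simp add: HBK_carrier)
  then have "rel_diff C d p n (zeta_inv C \<zeta> p n (h, b, k)) \<in> carrier (C p (n - 1))"
    by (rule linear_map_closed[OF rel_diff_linear])
  moreover have "\<zeta> p (n - 1) (rel_diff C d p n (zeta_inv C \<zeta> p n (h, b, k))) =
      (\<zero>\<^bsub>H p (n - 1)\<^esub>, k, \<zero>\<^bsub>Kp p (n - 1)\<^esub>)"
    using decomposition assms by (simp add: homology_decomposition_def)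
  ultimately show ?thesis using zeta_inv_\<zeta> by (metis b_in_def)
qed

lemma rel_diff_in [simp]:
  "h \<in> carrier (H p n) \<Longrightarrow> rel_diff C d p n (h_in p n h) = \<zero>\<^bsub>C p (n - 1)\<^esub>"
  "b \<in> carrier (B p n) \<Longrightarrow> rel_diff C d p n (b_in p n b) = \<zero>\<^bsub>C p (n - 1)\<^esub>"
  "k \<in> carrier (Kp p n) \<Longrightarrow> rel_diff C d p n (k_in p n k) = b_in p (n - 1) k"
  using in_zero(2)[of p "n - 1"]
  by (simp_all add: h_in_def b_in_def[of p n] k_in_def rel_diff_zeta_inv) (simp_all add: Ksp_def)

text \<open>The normal form \<open>(h, b, k) \<mapsto> (0, k, 0)\<close> of the relative differential.\<close>
lemma rel_diff_eq:
  assumes v: "v \<in> carrier (C p n)"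
  shows "rel_diff C d p n v = b_in p (n - 1) (k_part p n v)"
proof -
  have k: "b_in p (n - 1) (k_part p n v) \<in> carrier (C p (n - 1))"
    using in_closed(2)[of _ p "n - 1"] part_closed(3)[OF v] by (simp add: Kp_eq)
  show ?thesis using v k
    by (subst parts_sum[OF v]) (simp add: linear_map_add[OF rel_diff_linear] in_closed part_closed)
qed

definition \<gamma>p :: "'p \<Rightarrow> int \<Rightarrow> 'v \<Rightarrow> 'v" where
  "\<gamma>p p n v = \<ominus>\<^bsub>C p (n + 1)\<^esub> k_in p (n + 1) (b_part p n v)"

lemma \<gamma>p_linear: "linear_map K (C p n) (C p (n + 1)) (\<gamma>p p n)"
  using linear_map_neg_fun[OF linear_map_comp[OF part_linear(2) in_linear(3)[of p "n + 1", unfolded Kp_eq(2)]]]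
  by (rule linear_map_cong) (simp add: \<gamma>p_def)

abbreviation "T \<equiv> total_space C"
abbreviation "\<alpha> \<equiv> hd_alpha \<zeta>"
abbreviation "\<beta> \<equiv> hd_beta C d \<zeta>"
abbreviation "\<gamma> \<equiv> hd_gamma C d \<zeta>"
abbreviation "\<delta> \<equiv> hd_delta C d"
text \<open>
  The block diagonal part of \<open>d\<close>, given by its components; it agrees with \<^const>\<open>hd_dhat\<close> on
  vectors of the total space.
\<close>
definition "t n x = (\<lambda>p. rel_diff C d p n (x p))"

lemma \<alpha>_eq: "\<alpha> n x = (\<lambda>p. h_part p n (x p))"
  and \<beta>_eq: "\<beta> n y = (\<lambda>p. h_in p n (y p))"
  and \<gamma>_eq: "\<gamma> n x = (\<lambda>p. \<gamma>p p n (x p))"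
  by (simp_all add: hd_alpha_def hd_beta_def hd_gamma_def h_part_def h_in_def \<gamma>p_def k_in_def b_part_def)

lemma \<alpha>_linear: "linear_map K (T n) (total_space H n) (\<alpha> n)"
  using linear_map_componentwise[OF C.graded_space_axioms H.graded_space_axioms part_linear(1)]
  by (simp add: \<alpha>_eq[abs_def])

lemma \<beta>_linear: "linear_map K (total_space H n) (T n) (\<beta> n)"
  using linear_map_componentwise[OF H.graded_space_axioms C.graded_space_axioms in_linear(1)]
  by (simp add: \<beta>_eq[abs_def])

lemma \<gamma>_linear: "linear_map K (T n) (T (n + 1)) (\<gamma> n)"
  using linear_map_componentwise[OF C.graded_space_axioms C.graded_space_axioms \<gamma>p_linear]
  by (simp add: \<gamma>_eq[abs_def])

lemma t_linear: "linear_map K (T n) (T (n - 1)) (t n)"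
  using linear_map_componentwise[OF C.graded_space_axioms C.graded_space_axioms rel_diff_linear]
  by (simp add: t_def[abs_def])

lemma dhat_eq: "x \<in> carrier (T n) \<Longrightarrow> hd_dhat C d n x = t n x"
  unfolding hd_dhat_def
  by (rule C.lfsum_gincl[where \<pi> = "\<lambda>p. p"]) (auto simp: linear_map_closed[OF t_linear, unfolded t_def] t_def)

lemma \<delta>_linear: "linear_map K (T n) (T (n - 1)) (\<delta> n)"
  using linear_map_diff[OF d_linear t_linear]
  by (rule linear_map_cong) (simp add: hd_delta_def dhat_eq)

lemma \<delta>_apply:
  "x \<in> carrier (T n) \<Longrightarrow> \<delta> n x p = d n x p \<ominus>\<^bsub>C p (n - 1)\<^esub> rel_diff C d p n (x p)"
  by (simp add: hd_delta_def dhat_eq C.total_space_minus linear_map_closed[OF d_linear]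
      linear_map_closed[OF t_linear]) (simp add: t_def)

text \<open>
  Off the diagonal \<open>\<delta>\<close> agrees with the filtered map \<open>d\<close>, and on the diagonal it vanishes.
\<close>
lemma \<delta>_lowering:
  assumes v: "v \<in> carrier (C q n)"
  shows "\<delta> n (gincl C n q v) \<in> supported C (n - 1) {..<q}"
  unfolding supported_def
proof (intro CollectI conjI allI impI)
  note g = C.gincl_closed[OF v]
  show "\<delta> n (gincl C n q v) \<in> carrier (T (n - 1))" by (rule linear_map_closed[OF \<delta>_linear g])
  fix p assume nz: "\<delta> n (gincl C n q v) p \<noteq> \<zero>\<^bsub>C p (n - 1)\<^esub>"
  have dc: "d n (gincl C n q v) p \<in> carrier (C p (n - 1))"
    using C.proj_closed[OF linear_map_closed[OF d_linear g]] .
  show "p \<in> {..<q}"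
  proof (cases "p = q")
    case True
    then show ?thesis
      using nz dc by (simp add: \<delta>_apply[OF g]) (simp add: rel_diff_def gincl_apply a_minus_def C.C.M.r_neg)
  next
    case False
    then have "d n (gincl C n q v) p \<noteq> \<zero>\<^bsub>C p (n - 1)\<^esub>"
      using nz dc
      by (auto simp: \<delta>_apply[OF g] gincl_apply linear_map_zero[OF rel_diff_linear] a_minus_def)
    then have "p \<le> q" using filtered_d[of n] v by (auto simp: filtered_def)
    with False show ?thesis by simp
  qed
qed

lemma \<delta>_filtered: "filtered C n C (n - 1) (\<delta> n)"
  unfolding filtered_def
  using \<delta>_lowering by (fastforce simp: supported_def)

lemma \<alpha>_filtered: "filtered C n H n (\<alpha> n)"
  using filtered_componentwise[of K C n H n "\<lambda>p. h_part p n", OF part_linear(1)] by (simp add: \<alpha>_eq[abs_def])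

lemma \<beta>_filtered: "filtered H n C n (\<beta> n)"
  using filtered_componentwise[of K H n C n "\<lambda>p. h_in p n", OF in_linear(1)] by (simp add: \<beta>_eq[abs_def])

lemma \<gamma>_filtered: "filtered C n C (n + 1) (\<gamma> n)"
  using filtered_componentwise[of K C n C "n + 1" "\<lambda>p. \<gamma>p p n", OF \<gamma>p_linear] by (simp add: \<gamma>_eq[abs_def])

lemma \<gamma>\<delta>_linear: "linear_map K (T n) (T n) (\<gamma> (n - 1) \<circ> \<delta> n)"
  using linear_map_comp[OF \<delta>_linear[of n] \<gamma>_linear[of "n - 1"]] by (simp add: o_def)

lemma \<gamma>\<delta>_nilpotent: "locally_nilpotent (T n) (\<gamma> (n - 1) \<circ> \<delta> n)"
proof (rule strictly_lowering_nilpotent[OF C.graded_space_axioms wf \<gamma>\<delta>_linear])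
  fix q v assume "v \<in> carrier (C q n)"
  from \<delta>_lowering[OF this] have \<delta>: "\<delta> n (gincl C n q v) \<in> supported C (n - 1) {..<q}" .
  show "(\<gamma> (n - 1) \<circ> \<delta> n) (gincl C n q v) \<in> supported C n {..<q}"
    unfolding supported_def
  proof (intro CollectI conjI allI impI)
    show "(\<gamma> (n - 1) \<circ> \<delta> n) (gincl C n q v) \<in> carrier (T n)"
      using linear_map_closed[OF \<gamma>_linear, of _ "n - 1"] \<delta> by (simp add: supported_def)
    fix p assume "(\<gamma> (n - 1) \<circ> \<delta> n) (gincl C n q v) p \<noteq> \<zero>\<^bsub>C p n\<^esub>"
    then have "\<delta> n (gincl C n q v) p \<noteq> \<zero>\<^bsub>C p (n - 1)\<^esub>"
      using linear_map_zero[OF \<gamma>p_linear, of p "n - 1"] by (auto simp: \<gamma>_eq)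
    with \<delta> show "p \<in> {..<q}" by (simp add: supported_def)
  qed
qed

sublocale perturbation K T "total_space H" d t \<delta> \<gamma> \<alpha> \<beta>
proof (rule perturbation.intro, goal_cases)
  case 1 show ?case by (rule complex)
next
  case 2 show ?case by (rule t_linear)
next
  case 3 show ?case by (rule \<delta>_linear)
next
  case 4 show ?case by (rule \<alpha>_linear)
next
  case 5 show ?case by (rule \<beta>_linear)
next
  case 6 show ?case by (rule \<gamma>_linear)
next
  case (7 n x)
  have "d n x \<in> carrier (T (n - 1))" "t n x \<in> carrier (T (n - 1))"
    using 7 d_linear t_linear by (auto simp: linear_map_iff)
  then have "t n x \<oplus>\<^bsub>T (n - 1)\<^esub> (d n x \<ominus>\<^bsub>T (n - 1)\<^esub> t n x) = d n x"
    by (simp add: a_minus_def C.T.M.a_lcomm C.T.M.r_neg)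
  then show ?case using 7 by (simp add: hd_delta_def dhat_eq)
next
  case (8 n x)
  show ?case
  proof
    fix p
    have x: "x p \<in> carrier (C p n)" using 8 by (rule C.proj_closed)
    then have k: "k_part p n (x p) \<in> carrier (B p (n - 1))" using part_closed(3) by (metis Kp_eq(1))
    show "t (n - 1) (t n x) p = \<zero>\<^bsub>T (n - 2)\<^esub> p"
      using rel_diff_in(2)[OF k] by (simp add: t_def rel_diff_eq[OF x] total_space_zero)
  qed
next
  case (9 n y)
  then show ?case by (simp add: \<alpha>_eq \<beta>_eq total_space_carrier)
next
  case (10 n x)
  show ?case
  proof
    fix p
    have x: "x p \<in> carrier (C p n)" using 10 by (rule C.proj_closed)
    let ?h = "h_in p n (h_part p n (x p))" and ?b = "b_in p n (b_part p n (x p))"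
      and ?k = "k_in p n (k_part p n (x p))"
    have c: "?h \<in> carrier (C p n)" "?b \<in> carrier (C p n)" "?k \<in> carrier (C p n)"
      using x by (simp_all add: in_closed part_closed)
    have b: "b_part p n (x p) \<in> carrier (Kp p (n + 1))" using part_closed(2)[OF x] by (simp add: Kp_eq)
    have k: "k_part p n (x p) \<in> carrier (B p (n - 1))" using part_closed(3)[OF x] by (simp add: Kp_eq)
    have "rel_diff C d p (n + 1) (\<gamma>p p n (x p)) = \<ominus>\<^bsub>C p n\<^esub> ?b"
      using linear_map_neg[OF rel_diff_linear in_closed(3)[OF b]] rel_diff_in(3)[OF b]
      by (simp add: \<gamma>p_def)
    moreover have "\<gamma>p p (n - 1) (rel_diff C d p n (x p)) = \<ominus>\<^bsub>C p n\<^esub> ?k"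
      using part_in(5)[OF k] by (simp add: \<gamma>p_def rel_diff_eq[OF x])
    moreover have "?h = (?h \<oplus>\<^bsub>C p n\<^esub> ?b \<oplus>\<^bsub>C p n\<^esub> ?k) \<oplus>\<^bsub>C p n\<^esub> \<ominus>\<^bsub>C p n\<^esub> ?b \<oplus>\<^bsub>C p n\<^esub> \<ominus>\<^bsub>C p n\<^esub> ?k"
    proof -
      have "?h = ?h \<oplus>\<^bsub>C p n\<^esub> (?b \<oplus>\<^bsub>C p n\<^esub> \<ominus>\<^bsub>C p n\<^esub> ?b) \<oplus>\<^bsub>C p n\<^esub> (?k \<oplus>\<^bsub>C p n\<^esub> \<ominus>\<^bsub>C p n\<^esub> ?k)"
        using c by (simp add: C.C.M.r_neg)
      also have "\<dots> = (?h \<oplus>\<^bsub>C p n\<^esub> ?b \<oplus>\<^bsub>C p n\<^esub> ?k) \<oplus>\<^bsub>C p n\<^esub> \<ominus>\<^bsub>C p n\<^esub> ?b \<oplus>\<^bsub>C p n\<^esub> \<ominus>\<^bsub>C p n\<^esub> ?k"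
        using c by (simp add: C.C.M.a_ac)
      finally show ?thesis .
    qed
    ultimately show "\<beta> n (\<alpha> n x) p = (x \<oplus>\<^bsub>T n\<^esub> t (n + 1) (\<gamma> n x) \<oplus>\<^bsub>T n\<^esub> \<gamma> (n - 1) (t n x)) p"
      using parts_sum[OF x] by (simp add: \<alpha>_eq \<beta>_eq \<gamma>_eq t_def total_space_add)
  qed
next
  case (11 n x)
  then show ?case
    by (auto simp: \<alpha>_eq \<gamma>_eq \<gamma>p_def total_space_zero total_space_carrier linear_map_neg[OF part_linear(1)]
        in_closed part_closed Kp_eq fun_eq_iff)
next
  case (12 n y)
  then show ?case
    using in_zero(3)[of _ "n + 1"]
    by (auto simp: \<beta>_eq \<gamma>_eq \<gamma>p_def total_space_zero total_space_carrier Kp_eq fun_eq_iff)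
next
  case (13 n x)
  show ?case
  proof
    fix p
    have "b_part p n (x p) \<in> carrier (Kp p (n + 1))"
      using part_closed(2)[OF C.proj_closed[OF 13]] by (simp add: Kp_eq)
    then have "b_part p (n + 1) (\<gamma>p p n (x p)) = \<zero>\<^bsub>B p (n + 1)\<^esub>"
      by (simp add: \<gamma>p_def linear_map_neg[OF part_linear(2)] in_closed)
    then show "\<gamma> (n + 1) (\<gamma> n x) p = \<zero>\<^bsub>T (n + 2)\<^esub> p"
      using in_zero(3)[of p "n + 2"] Kp_eq(2)[of p "n + 1"]
      by (simp add: \<gamma>_eq \<gamma>p_def[of p "n + 1"] total_space_zero add.commute[of 2 n])
  qed
next
  case (14 n x)
  show ?case
  proof
    fix p
    have x: "x p \<in> carrier (C p n)" using 14 by (rule C.proj_closed)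
    then have k: "k_part p n (x p) \<in> carrier (B p (n - 1))" using part_closed(3) by (metis Kp_eq(1))
    show "\<alpha> (n - 1) (t n x) p = \<zero>\<^bsub>total_space H (n - 1)\<^esub> p"
      using k by (simp add: \<alpha>_eq t_def rel_diff_eq[OF x] total_space_zero)
  qed
next
  case (15 n y)
  then show ?case by (simp add: t_def \<beta>_eq total_space_zero total_space_carrier)
next
  case (16 n)
  show ?case by (rule \<gamma>\<delta>_nilpotent)
qed

lemma S_eq: "S = hd_S C d \<zeta>"
  by (simp add: S_def hd_S_def)

text \<open>
  The geometric series for \<open>(1 - \<gamma> \<delta>)\<^sup>-\<^sup>1 x\<close> stays among the vectors supported below \<open>q\<close>,
  because \<open>\<gamma>\<close> and \<open>\<delta>\<close> preserve this subspace.
\<close>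
lemma S_filtered: "filtered C n C (n - 1) (S n)"
  unfolding filtered_iff_supported[OF C.graded_space_axioms C.graded_space_axioms lin_S]
proof (intro allI ballI)
  fix q x assume x: "x \<in> supported C n {..q}"
  have f\<delta>: "\<And>z. z \<in> supported C n {..q} \<Longrightarrow> \<delta> n z \<in> supported C (n - 1) {..q}"
    using \<delta>_filtered
    unfolding filtered_iff_supported[OF C.graded_space_axioms C.graded_space_axioms \<delta>_linear] by blast
  have f\<gamma>: "\<And>z. z \<in> supported C (n - 1) {..q} \<Longrightarrow> \<gamma> (n - 1) z \<in> supported C n {..q}"
    using \<gamma>_filtered[of "n - 1"]
    unfolding filtered_iff_supported[OF C.graded_space_axioms C.graded_space_axioms \<gamma>_linear] by simp
  obtain k where k: "((\<gamma> (n - 1) \<circ> \<delta> n) ^^ k) x = \<zero>\<^bsub>T n\<^esub>"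
    using \<gamma>\<delta>_nilpotent[of n] x by (auto simp: locally_nilpotent_def supported_def)
  have "\<exists>z\<in>supported C n {..q}. z \<ominus>\<^bsub>T n\<^esub> (\<gamma> (n - 1) \<circ> \<delta> n) z = x"
  proof (rule locally_nilpotent_solve[OF C.T.M.abelian_group_axioms _ _ _ _ _ _ x k])
    show "supported C n {..q} \<subseteq> carrier (T n)" by (auto simp: supported_def)
    show "(\<gamma> (n - 1) \<circ> \<delta> n) \<zero>\<^bsub>T n\<^esub> = \<zero>\<^bsub>T n\<^esub>" by (rule linear_map_zero[OF \<gamma>\<delta>_linear])
    show "(\<gamma> (n - 1) \<circ> \<delta> n) u \<in> supported C n {..q}" if "u \<in> supported C n {..q}" for u
      using f\<gamma>[OF f\<delta>[OF that]] by simp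
  qed (use C.supported_zero C.supported_add linear_map_add[OF \<gamma>\<delta>_linear] in auto)
  then obtain z where z: "z \<in> supported C n {..q}" "z \<ominus>\<^bsub>T n\<^esub> \<gamma> (n - 1) (\<delta> n z) = x" by auto
  have "S n x = \<delta> n z" using S_at[of z n] z by (auto simp: supported_def)
  with f\<delta>[OF z(1)] show "S n x \<in> supported C (n - 1) {..q}" by simp
qed

lemma bar_eq: "d' = bar_d C d \<zeta>" "f' = bar_alpha C d \<zeta>" "g' = bar_beta C d \<zeta>" "h' = bar_gamma C d \<zeta>"
  by (simp_all add: bar_d_def bar_alpha_def bar_beta_def bar_gamma_def S_eq)

lemma bar_filtered_contraction:
  "filtered_contraction K C d H (bar_d C d \<zeta>) (bar_alpha C d \<zeta>) (bar_beta C d \<zeta>) (bar_gamma C d \<zeta>)"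
proof -
  note gs = C.graded_space_axioms H.graded_space_axioms
  have S\<gamma>: "filtered C n C n (\<lambda>x. S (n + 1) (\<gamma> n x))" for n
    using filtered_comp[OF gs(1,1,1) \<gamma>_linear[of n] \<gamma>_filtered lin_S[of "n + 1"] S_filtered] by simp
  have \<gamma>S: "filtered C n C n (\<lambda>x. \<gamma> (n - 1) (S n x))" for n
    using filtered_comp[OF gs(1,1,1) lin_S[of n] S_filtered \<gamma>_linear[of "n - 1"] \<gamma>_filtered] by simp
  have "filtered H n H (n - 1) (d' n)" for n
    unfolding pert_d_def
    by (intro filtered_comp[OF gs(2,1,2) _ _ \<alpha>_linear \<alpha>_filtered]
        filtered_comp[OF gs(2,1,1) \<beta>_linear \<beta>_filtered lin_S S_filtered] linear_map_comp[OF \<beta>_linear lin_S])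
  moreover have "filtered C n H n (f' n)" for n
    unfolding pert_f_def
    by (intro filtered_sum[OF gs(1,2) \<alpha>_linear \<alpha>_filtered] linear_map_comp[OF lin_S\<gamma> \<alpha>_linear]
        filtered_comp[OF gs(1,1,2) lin_S\<gamma> S\<gamma> \<alpha>_linear \<alpha>_filtered])
  moreover have "filtered H n C n (g' n)" for n
    unfolding pert_g_def
    by (intro filtered_sum[OF gs(2,1) \<beta>_linear \<beta>_filtered] linear_map_comp[OF \<beta>_linear lin_\<gamma>S]
        filtered_comp[OF gs(2,1,1) \<beta>_linear \<beta>_filtered lin_\<gamma>S \<gamma>S])
  moreover have "filtered C n C (n + 1) (h' n)" for n
    unfolding pert_h_def
    by (intro filtered_sum[OF gs(1,1) \<gamma>_linear \<gamma>_filtered] linear_map_comp[OF lin_S\<gamma> \<gamma>_linear]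
        filtered_comp[OF gs(1,1,1) lin_S\<gamma> S\<gamma> \<gamma>_linear \<gamma>_filtered])
  ultimately show ?thesis
    using graded contraction' complex' unfolding filtered_contraction_def graded_complex_def bar_eq
    by (auto simp: HBK_spaces)
qed

end

section \<open>Transport of contractions\<close>

text \<open>
  A contraction may be replaced by one onto an isomorphic complex.  Only the values of the new maps
  on the carriers matter, whence the hypotheses that describe them there.
\<close>
lemma contraction_transport:
  assumes con: "contraction K C d H d' f g h" and iso: "\<And>n. lin_iso K (H n) (H' n) (\<rho> n)"
    and d'': "\<And>n y. y \<in> carrier (H n) \<Longrightarrow> d'' n (\<rho> n y) = \<rho> (n - 1) (d' n y)"
    and f'': "\<And>n x. x \<in> carrier (C n) \<Longrightarrow> f'' n x = \<rho> n (f n x)"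
    and g'': "\<And>n y. y \<in> carrier (H n) \<Longrightarrow> g'' n (\<rho> n y) = g n y"
    and h'': "\<And>n x. x \<in> carrier (C n) \<Longrightarrow> h'' n x = h n x"
  shows "contraction K C d H' d'' f'' g'' h''"
proof -
  have \<rho>: "linear_map K (H n) (H' n) (\<rho> n)" and bij: "bij_betw (\<rho> n) (carrier (H n)) (carrier (H' n))" for n
    using iso[of n] by (simp_all add: lin_iso_def)
  define \<sigma> where "\<sigma> n = inv_into (carrier (H n)) (\<rho> n)" for n
  have \<sigma>: "linear_map K (H' n) (H n) (\<sigma> n)" for n
    unfolding \<sigma>_def by (rule linear_map_inv_into[OF \<rho> bij])
  have surj: "\<exists>y\<in>carrier (H n). z = \<rho> n y \<and> \<sigma> n z = y" if "z \<in> carrier (H' n)" for n z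
  proof -
    have "z \<in> \<rho> n ` carrier (H n)" using that bij_betw_imp_surj_on[OF bij] by simp
    then show ?thesis
      unfolding \<sigma>_def by (intro bexI[of _ "inv_into (carrier (H n)) (\<rho> n) z"])
        (simp_all add: f_inv_into_f inv_into_into)
  qed
  have \<sigma>c: "\<sigma> n w \<in> carrier (H n)" and \<rho>\<sigma>: "\<rho> n (\<sigma> n w) = w" if "w \<in> carrier (H' n)" for n w
    using surj[OF that] by auto
  have C: "chain_complex K C d" and H: "chain_complex K H d'" and f: "chain_map K C d H d' f"
    and g: "chain_map K H d' C d g" and h: "\<And>n. linear_map K (C n) (C (n + 1)) (h n)"
    using con unfolding contraction_def by blast+
  have fg: "\<And>n y. y \<in> carrier (H n) \<Longrightarrow> f n (g n y) = y"
    and gf: "\<And>n x. x \<in> carrier (C n) \<Longrightarrow>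
      g n (f n x) = x \<oplus>\<^bsub>C n\<^esub> d (n + 1) (h n x) \<oplus>\<^bsub>C n\<^esub> h (n - 1) (d n x)"
    and fh: "\<And>n x. x \<in> carrier (C n) \<Longrightarrow> f (n + 1) (h n x) = \<zero>\<^bsub>H (n + 1)\<^esub>"
    and hg: "\<And>n y. y \<in> carrier (H n) \<Longrightarrow> h n (g n y) = \<zero>\<^bsub>C (n + 1)\<^esub>"
    and hh: "\<And>n x. x \<in> carrier (C n) \<Longrightarrow> h (n + 1) (h n x) = \<zero>\<^bsub>C (n + 2)\<^esub>"
    using con unfolding contraction_def by blast+
  have ld: "linear_map K (C n) (C (n - 1)) (d n)" and ld': "linear_map K (H n) (H (n - 1)) (d' n)"
    and lf: "linear_map K (C n) (H n) (f n)" and lg: "linear_map K (H n) (C n) (g n)" for n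
    using C H f g unfolding chain_complex_def chain_map_def by blast+
  note cl = ld[THEN linear_map_closed] ld'[THEN linear_map_closed] lf[THEN linear_map_closed]
    lg[THEN linear_map_closed] h[THEN linear_map_closed]
  have z: "\<rho> n \<zero>\<^bsub>H n\<^esub> = \<zero>\<^bsub>H' n\<^esub>" for n by (rule linear_map_zero[OF \<rho>])
  have ld'': "linear_map K (H' n) (H' (n - 1)) (d'' n)" for n
    using linear_map_comp[OF linear_map_comp[OF \<sigma> ld'] \<rho>]
    by (rule linear_map_cong) (use d''[OF \<sigma>c] \<rho>\<sigma> in simp)
  have H': "chain_complex K H' d''"
    unfolding chain_complex_def
  proof (intro conjI allI ballI ld'')
    fix n w assume "w \<in> carrier (H' n)"
    then obtain y where y: "y \<in> carrier (H n)" "w = \<rho> n y" using surj by blast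
    then show "d'' (n - 1) (d'' n w) = \<zero>\<^bsub>H' (n - 2)\<^esub>"
      using H z[of "n - 2"] by (simp add: d'' cl chain_complex_def)
  qed
  have f''m: "chain_map K C d H' d'' f''"
    unfolding chain_map_def
  proof (intro conjI allI ballI)
    show "linear_map K (C n) (H' n) (f'' n)" for n
      using linear_map_comp[OF lf \<rho>] by (rule linear_map_cong) (rule f'')
    show "f'' (n - 1) (d n x) = d'' n (f'' n x)" if "x \<in> carrier (C n)" for n x
      using that f by (simp add: d'' f'' cl chain_map_def)
  qed
  have g''m: "chain_map K H' d'' C d g''"
    unfolding chain_map_def
  proof (intro conjI allI ballI)
    show "linear_map K (H' n) (C n) (g'' n)" for n
      using linear_map_comp[OF \<sigma> lg] by (rule linear_map_cong) (use g''[OF \<sigma>c] \<rho>\<sigma> in simp)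
    fix n w assume "w \<in> carrier (H' n)"
    then obtain y where y: "y \<in> carrier (H n)" "w = \<rho> n y" using surj by blast
    then show "g'' (n - 1) (d'' n w) = d n (g'' n w)"
      using g by (simp add: d'' g'' cl chain_map_def)
  qed
  have h''m: "linear_map K (C n) (C (n + 1)) (h'' n)" for n
    using h by (rule linear_map_cong) (rule h'')
  have hx: "h'' (n - 1) (d n x) = h (n - 1) (d n x)" if "x \<in> carrier (C n)" for n x
    using that by (simp add: h'' cl)
  show ?thesis
    unfolding contraction_def
  proof (intro conjI allI ballI C H' f''m g''m h''m)
    fix n w assume "w \<in> carrier (H' n)"
    then obtain y where y: "y \<in> carrier (H n)" "w = \<rho> n y" using surj by blast
    show "f'' n (g'' n w) = w" "h'' n (g'' n w) = \<zero>\<^bsub>C (n + 1)\<^esub>"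
      using y by (simp_all add: f'' g'' h'' cl fg hg)
  next
    fix n x assume x: "x \<in> carrier (C n)"
    show "g'' n (f'' n x) = x \<oplus>\<^bsub>C n\<^esub> d (n + 1) (h'' n x) \<oplus>\<^bsub>C n\<^esub> h'' (n - 1) (d n x)"
      using x by (simp add: f'' g'' h'' cl gf)
    show "f'' (n + 1) (h'' n x) = \<zero>\<^bsub>H' (n + 1)\<^esub>" "h'' (n + 1) (h'' n x) = \<zero>\<^bsub>C (n + 2)\<^esub>"
      using x by (simp_all add: f'' h'' cl z fh hh)
  qed
qed

lemma relabel_simps:
  "carrier (relabel j V) = j ` carrier V"
  "\<zero>\<^bsub>relabel j V\<^esub> = j \<zero>\<^bsub>V\<^esub>"
  "inj j \<Longrightarrow> j x \<oplus>\<^bsub>relabel j V\<^esub> j y = j (x \<oplus>\<^bsub>V\<^esub> y)"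
  "inj j \<Longrightarrow> c \<odot>\<^bsub>relabel j V\<^esub> j x = j (c \<odot>\<^bsub>V\<^esub> x)"
  by (simp_all add: relabel_def)

lemma vectorspace_relabel:
  assumes V: "vectorspace K V" and j: "inj j"
  shows "vectorspace K (relabel j V)"
proof -
  interpret vectorspace K V by fact
  have F: "field K" ..
  show ?thesis
    by (rule vs_criteria)
       (auto simp: F relabel_simps j M.a_ac smult_assoc1 smult_l_distr smult_r_distr
         M.r_neg intro!: bexI[of _ "\<ominus>\<^bsub>V\<^esub> _"])
qed

lemma relabel_linear:
  assumes V: "vectorspace K V" and j: "inj j"
  shows "linear_map K V (relabel j V) j"
  using V vectorspace_relabel[OF assms] by (simp add: linear_map_iff relabel_simps j)

lemma unlabel_linear:
  assumes V: "vectorspace K V" and j: "inj j" and u: "\<And>x. u (j x) = x"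
  shows "linear_map K (relabel j V) V u"
  using V vectorspace_relabel[OF V j]
  by (auto simp: linear_map_iff relabel_simps j u)

lemma linear_map_into_dsum:
  assumes K: "field K" and V: "vectorspace K V"
    and f: "\<And>i. i \<in> I \<Longrightarrow> linear_map K V (W i) (f i)"
    and fin: "\<And>x. x \<in> carrier V \<Longrightarrow> finite {i \<in> I. f i x \<noteq> \<zero>\<^bsub>W i\<^esub>}"
  shows "linear_map K V (dsum I W) (\<lambda>x. \<lambda>i\<in>I. f i x)"
proof -
  have W: "vectorspace K (dsum I W)"
    using f by (intro vectorspace_dsum[OF K]) (simp add: linear_map_iff)
  have cl: "(\<lambda>i\<in>I. f i x) \<in> carrier (dsum I W)" if "x \<in> carrier V" for x
    using fin[OF that] linear_map_closed[OF f that] by (simp add: dsum_carrier cong: conj_cong)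
  show ?thesis using V W cl f
    by (auto simp: linear_map_iff dsum_add dsum_smult intro!: restrict_ext)
qed

section \<open>The based complex of a homology decomposition\<close>

lemma UNIV_part: "(UNIV :: part set) = {H_part, B_part, K_part}"
  using part.exhaust by auto

context decomposed_complex
begin

abbreviation "P \<equiv> part_space C d"
abbreviation "idx \<equiv> part_idx C d"
abbreviation "X \<equiv> hbk_based C d \<zeta>"
abbreviation "M \<equiv> kb_matching C d"

text \<open>
  Inclusion and projection of the summand \<open>V\<^sup>p\<^sub>n\<close> inside \<open>C\<^sup>p\<^sub>n\<close>, before \<open>C\<^sup>p\<^sub>n\<close> is included
  into the total space.  Treating the three parts uniformly avoids most case distinctions.
\<close>
fun c_in :: "'p \<Rightarrow> part \<Rightarrow> int \<Rightarrow> 'v set + 'v \<Rightarrow> 'v" where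
  "c_in p H_part n w = h_in p n (projl w)"
| "c_in p B_part n w = b_in p n (projr w)"
| "c_in p K_part n w = k_in p n (projr w)"

fun c_part :: "'p \<Rightarrow> part \<Rightarrow> int \<Rightarrow> 'v \<Rightarrow> 'v set + 'v" where
  "c_part p H_part n v = Inl (h_part p n v)"
| "c_part p B_part n v = Inr (b_part p n v)"
| "c_part p K_part n v = Inr (k_part p n v)"

lemma part_incl_eq: "part_incl C d \<zeta> (p, V, n) w = gincl C n p (c_in p V n w)"
  by (cases V) (simp_all add: h_in_def b_in_def k_in_def)

lemma part_proj_eq: "part_proj \<zeta> (p, V, n) x = c_part p V n (x p)"
  by (cases V) (simp_all add: h_part_def b_part_def k_part_def)

lemma part_vectorspace: "vectorspace K (P a)"
  by (cases "(C, d, a)" rule: part_space.cases) (simp_all add: vectorspace_relabel HBK_spaces)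

lemma c_part_linear: "linear_map K (C p n) (P (p, V, n)) (c_part p V n)"
proof (cases V)
  case H_part
  show ?thesis
    using linear_map_comp[OF part_linear(1) relabel_linear[OF HBK_spaces(1) inj_Inl]]
    unfolding H_part part_space.simps by (rule linear_map_cong) simp_all
next
  case B_part
  show ?thesis
    using linear_map_comp[OF part_linear(2) relabel_linear[OF HBK_spaces(2) inj_Inr]]
    unfolding B_part part_space.simps by (rule linear_map_cong) simp_all
next
  case K_part
  show ?thesis
    using linear_map_comp[OF part_linear(3) relabel_linear[OF HBK_spaces(3) inj_Inr]]
    unfolding K_part part_space.simps by (rule linear_map_cong) simp_all
qed

lemma c_in_linear: "linear_map K (P (p, V, n)) (C p n) (c_in p V n)"
proof (cases V)
  case H_part
  show ?thesis
    using linear_map_comp[OF unlabel_linear[OF HBK_spaces(1) inj_Inl, of projl, OF sum.sel(1)] in_linear(1)]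
    unfolding H_part part_space.simps by (rule linear_map_cong) simp_all
next
  case B_part
  show ?thesis
    using linear_map_comp[OF unlabel_linear[OF HBK_spaces(2) inj_Inr, of projr, OF sum.sel(2)] in_linear(2)]
    unfolding B_part part_space.simps by (rule linear_map_cong) simp_all
next
  case K_part
  show ?thesis
    using linear_map_comp[OF unlabel_linear[OF HBK_spaces(3) inj_Inr, of projr, OF sum.sel(2)] in_linear(3)]
    unfolding K_part part_space.simps by (rule linear_map_cong) simp_all
qed

lemmas c_part_closed = linear_map_closed[OF c_part_linear]
lemmas c_in_closed = linear_map_closed[OF c_in_linear]
lemmas c_part_zero = linear_map_zero[OF c_part_linear]

lemma P_zero_closed: "\<zero>\<^bsub>P a\<^esub> \<in> carrier (P a)"
  by (rule abelian_monoid.zero_closed[OF abelian_group.axioms(1)[OF vectorspace_abelian_group[OF part_vectorspace]]])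

lemma c_part_in:
  assumes w: "w \<in> carrier (P (p, V, n))"
  shows "c_part p W n (c_in p V n w) = (if W = V then w else \<zero>\<^bsub>P (p, W, n)\<^esub>)"
proof (cases V)
  case H_part
  with w obtain h where "w = Inl h" "h \<in> carrier (H p n)" by (auto simp: relabel_simps)
  then show ?thesis by (cases W) (simp_all add: H_part relabel_simps)
next
  case B_part
  with w obtain b where "w = Inr b" "b \<in> carrier (B p n)" by (auto simp: relabel_simps)
  then show ?thesis by (cases W) (simp_all add: B_part relabel_simps)
next
  case K_part
  with w obtain k where "w = Inr k" "k \<in> carrier (Kp p n)" by (auto simp: relabel_simps)
  then show ?thesis by (cases W) (simp_all add: K_part relabel_simps)
qed

lemma c_part_eqI:
  assumes "v \<in> carrier (C p n)" "w \<in> carrier (C p n)" "\<And>V. c_part p V n v = c_part p V n w"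
  shows "v = w"
  by (rule parts_eqI[OF assms(1,2)])
     (use assms(3)[of H_part] assms(3)[of B_part] assms(3)[of K_part] in simp_all)

lemma part_idx_iff:
  "(p, V, m) \<in> idx n \<longleftrightarrow> m = n \<and> (V = H_part \<or> carrier (P (p, V, n)) \<noteq> {\<zero>\<^bsub>P (p, V, n)\<^esub>})"
  by (auto simp: part_idx_def)

text \<open>
  The summands discarded from the index set are zero, so an equation between their components
  holds automatically.
\<close>
lemma trivial_part: "(p, V, n) \<notin> idx n \<Longrightarrow> w \<in> carrier (P (p, V, n)) \<Longrightarrow> w = \<zero>\<^bsub>P (p, V, n)\<^esub>"
  by (auto simp: part_idx_iff)

lemma hbk_simps [simp]:
  "bcx X = T" "bdiff X = d" "bidx X = idx" "bsum X = P" "bincl X = part_incl C d \<zeta>" "bproj X = part_proj \<zeta>"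
  by (simp_all add: hbk_based_def)

lemma part_proj_linear: "a \<in> idx n \<Longrightarrow> linear_map K (T n) (P a) (part_proj \<zeta> a)"
proof -
  assume "a \<in> idx n"
  then obtain p V where a: "a = (p, V, n)" by (auto simp: part_idx_def)
  show ?thesis unfolding a
    using linear_map_comp[OF C.linear_proj c_part_linear] by (rule linear_map_cong) (rule part_proj_eq)
qed

lemma part_incl_linear: "a \<in> idx n \<Longrightarrow> linear_map K (P a) (T n) (part_incl C d \<zeta> a)"
proof -
  assume "a \<in> idx n"
  then obtain p V where a: "a = (p, V, n)" by (auto simp: part_idx_def)
  show ?thesis unfolding a
    using linear_map_comp[OF c_in_linear C.gincl_linear] by (rule linear_map_cong) (rule part_incl_eq)
qed

lemma part_proj_support:
  assumes x: "x \<in> carrier (T n)"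
  shows "finite {a \<in> idx n. part_proj \<zeta> a x \<noteq> \<zero>\<^bsub>P a\<^esub>}"
proof (rule finite_subset)
  show "{a \<in> idx n. part_proj \<zeta> a x \<noteq> \<zero>\<^bsub>P a\<^esub>} \<subseteq>
      (\<lambda>(p, V). (p, V, n)) ` ({p. x p \<noteq> \<zero>\<^bsub>C p n\<^esub>} \<times> UNIV)"
  proof
    fix a assume a: "a \<in> {a \<in> idx n. part_proj \<zeta> a x \<noteq> \<zero>\<^bsub>P a\<^esub>}"
    then obtain p V where "a = (p, V, n)" by (auto simp: part_idx_def)
    with a show "a \<in> (\<lambda>(p, V). (p, V, n)) ` ({p. x p \<noteq> \<zero>\<^bsub>C p n\<^esub>} \<times> UNIV)"
      using c_part_zero by (auto simp: part_proj_eq image_iff)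
  qed
  show "finite ((\<lambda>(p, V). (p, V, n)) ` ({p. x p \<noteq> \<zero>\<^bsub>C p n\<^esub>} \<times> (UNIV :: part set)))"
    using x by (simp add: total_space_carrier UNIV_part)
qed

lemma part_proj_incl:
  assumes "v \<in> carrier (P a)" "a \<in> idx n" "b \<in> idx n"
  shows "part_proj \<zeta> b (part_incl C d \<zeta> a v) = (if b = a then v else \<zero>\<^bsub>P b\<^esub>)"
proof -
  obtain p V q W where "a = (p, V, n)" "b = (q, W, n)" using assms(2,3) by (auto simp: part_idx_def)
  with assms(1) show ?thesis by (simp add: part_proj_eq part_incl_eq gincl_apply c_part_in c_part_zero)
qed

lemma coordinates_iso:
  "lin_iso K (T n) (dsum (idx n) P) (\<lambda>x. \<lambda>a\<in>idx n. part_proj \<zeta> a x)"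
  unfolding lin_iso_def
proof
  let ?f = "\<lambda>x. \<lambda>a\<in>idx n. part_proj \<zeta> a x"
  show lin: "linear_map K (T n) (dsum (idx n) P) ?f"
    using part_proj_support
    by (intro linear_map_into_dsum field C.T.vectorspace_axioms part_proj_linear) auto
  show "bij_betw ?f (carrier (T n)) (carrier (dsum (idx n) P))"
    unfolding bij_betw_def
  proof
    show "inj_on ?f (carrier (T n))"
    proof (rule inj_onI, rule ext)
      fix x y p assume xy: "x \<in> carrier (T n)" "y \<in> carrier (T n)" "?f x = ?f y"
      show "x p = y p"
      proof (rule c_part_eqI)
        show c: "x p \<in> carrier (C p n)" "y p \<in> carrier (C p n)" using xy by (auto simp: C.proj_closed)
        fix V
        show "c_part p V n (x p) = c_part p V n (y p)"
        proof (cases "(p, V, n) \<in> idx n")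
          case True
          then show ?thesis using fun_cong[OF xy(3), of "(p, V, n)"] by (simp add: part_proj_eq)
        next
          case False
          then show ?thesis using trivial_part[OF False c_part_closed[OF c(1)]] trivial_part[OF False c_part_closed[OF c(2)]] by simp
        qed
      qed
    qed
    show "?f ` carrier (T n) = carrier (dsum (idx n) P)"
    proof
      show "?f ` carrier (T n) \<subseteq> carrier (dsum (idx n) P)" using linear_map_closed[OF lin] by auto
      show "carrier (dsum (idx n) P) \<subseteq> ?f ` carrier (T n)"
      proof
        fix y assume y: "y \<in> carrier (dsum (idx n) P)"
        define w where "w p V = (if (p, V, n) \<in> idx n then y (p, V, n) else \<zero>\<^bsub>P (p, V, n)\<^esub>)" for p V
        define x where "x p = c_in p H_part n (w p H_part) \<oplus>\<^bsub>C p n\<^esub> c_in p B_part n (w p B_part)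
          \<oplus>\<^bsub>C p n\<^esub> c_in p K_part n (w p K_part)" for p
        have w: "w p V \<in> carrier (P (p, V, n))" for p V
          using y P_zero_closed by (auto simp: w_def dsum_carrier dest: PiE_mem)
        have xc: "x p \<in> carrier (C p n)" for p
          unfolding x_def by (intro C.C.M.a_closed c_in_closed w)
        have part: "c_part p V n (x p) = w p V" for p V
        proof -
          interpret PV: vectorspace K "P (p, W, n)" for W by (rule part_vectorspace)
          show ?thesis
            unfolding x_def using w[of p]
            by (cases V) (simp_all only: linear_map_add[OF c_part_linear] c_in_closed C.C.M.a_closed c_part_in
                part.distinct if_True if_False PV.M.l_zero PV.M.r_zero PV.M.zero_closed refl)
        qed
        have "{p. x p \<noteq> \<zero>\<^bsub>C p n\<^esub>} \<subseteq> fst ` {a \<in> idx n. y a \<noteq> \<zero>\<^bsub>P a\<^esub>}"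
        proof
          fix p assume "p \<in> {p. x p \<noteq> \<zero>\<^bsub>C p n\<^esub>}"
          then obtain V where "c_part p V n (x p) \<noteq> c_part p V n \<zero>\<^bsub>C p n\<^esub>"
            using c_part_eqI[OF xc C.C.M.zero_closed] by blast
          then have "w p V \<noteq> \<zero>\<^bsub>P (p, V, n)\<^esub>" by (simp add: part c_part_zero)
          then have "(p, V, n) \<in> {a \<in> idx n. y a \<noteq> \<zero>\<^bsub>P a\<^esub>}" by (auto simp: w_def split: if_splits)
          then show "p \<in> fst ` {a \<in> idx n. y a \<noteq> \<zero>\<^bsub>P a\<^esub>}" by force
        qed
        then have "x \<in> carrier (T n)"
          using xc y by (auto simp: total_space_carrier dsum_carrier intro: finite_subset)
        moreover have "?f x = y"
        proof
          fix a show "?f x a = y a"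
          proof (cases "a \<in> idx n")
            case True
            then obtain p V where a: "a = (p, V, n)" by (auto simp: part_idx_def)
            with True show ?thesis by (simp add: part_proj_eq part w_def)
          next
            case False
            then have "y a = undefined" using y by (intro PiE_arb[of y "idx n" "\<lambda>a. carrier (P a)"]) (simp_all add: dsum_carrier)
            with False show ?thesis by simp
          qed
        qed
        ultimately show "y \<in> ?f ` carrier (T n)" by blast
      qed
    qed
  qed
qed

lemma coordinates_eqI:
  assumes "x \<in> carrier (T n)" "y \<in> carrier (T n)"
    and "\<And>a. a \<in> idx n \<Longrightarrow> part_proj \<zeta> a x = part_proj \<zeta> a y"
  shows "x = y"
proof -
  have "inj_on (\<lambda>x. \<lambda>a\<in>idx n. part_proj \<zeta> a x) (carrier (T n))"
    using coordinates_iso[of n] unfolding lin_iso_def bij_betw_def by blast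
  then show ?thesis
    by (rule inj_onD[OF _ _ assms(1,2)]) (use assms(3) in \<open>auto intro: restrict_ext\<close>)
qed

lemma based_complex_hbk: "based_complex K X"
  unfolding based_complex_def hbk_simps
proof (intro conjI allI ballI impI complex part_vectorspace coordinates_iso)
  show "idx m \<inter> idx n = {}" if "m \<noteq> n" for m n using that by (auto simp: part_idx_def)
  fix n a v assume a: "a \<in> idx n" "v \<in> carrier (P a)"
  show "part_incl C d \<zeta> a v \<in> carrier (T n)" by (rule linear_map_closed[OF part_incl_linear[OF a(1)] a(2)])
  show "(\<lambda>b\<in>idx n. part_proj \<zeta> b (part_incl C d \<zeta> a v)) = dincl (idx n) P a v"
    unfolding dincl_def using a by (intro restrict_ext) (simp add: part_proj_incl)
qed

text \<open>Every vector is the sum of its finitely many nonzero components.\<close>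
lemma part_expansion:
  assumes x: "x \<in> carrier (T n)"
  shows "finsum (T n) (\<lambda>b. part_incl C d \<zeta> b (part_proj \<zeta> b x)) {b \<in> idx n. part_proj \<zeta> b x \<noteq> \<zero>\<^bsub>P b\<^esub>} = x"
    (is "finsum _ ?g ?S = x")
proof -
  have fin: "finite ?S" by (rule part_proj_support[OF x])
  have pc: "part_proj \<zeta> b x \<in> carrier (P b)" if "b \<in> idx n" for b
    by (rule linear_map_closed[OF part_proj_linear[OF that] x])
  have g: "?g b \<in> carrier (T n)" if "b \<in> idx n" for b
    by (rule linear_map_closed[OF part_incl_linear[OF that] pc[OF that]])
  have pi: "part_proj \<zeta> a (?g b) = (if a = b then part_proj \<zeta> b x else \<zero>\<^bsub>P a\<^esub>)"
    if "a \<in> idx n" "b \<in> idx n" for a b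
    by (rule part_proj_incl[OF pc[OF that(2)] that(2,1)])
  have s: "finsum (T n) ?g ?S \<in> carrier (T n)" using g by (intro C.T.M.finsum_closed) auto
  show ?thesis
  proof (rule coordinates_eqI[OF s x])
    fix a assume a: "a \<in> idx n"
    interpret Pa: vectorspace K "P a" by (rule part_vectorspace)
    have "part_proj \<zeta> a (finsum (T n) ?g ?S) = finsum (P a) (\<lambda>b. part_proj \<zeta> a (?g b)) ?S"
      by (rule linear_map_finsum[OF part_proj_linear[OF a] fin]) (use g in simp)
    also have "\<dots> = part_proj \<zeta> a (?g a)"
    proof (rule Pa.M.finsum_single[OF fin, where g = "\<lambda>b. part_proj \<zeta> a (?g b)" and ?i0.0 = a])
      show "part_proj \<zeta> a (?g b) = \<zero>\<^bsub>P a\<^esub>" if "b \<in> ?S" "b \<noteq> a" for b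
        using that a by (simp add: pi)
      show "part_proj \<zeta> a (?g a) \<in> carrier (P a)" using a by (simp add: pi pc)
      show "part_proj \<zeta> a (?g a) = \<zero>\<^bsub>P a\<^esub>" if "a \<notin> ?S"
        unfolding pi[OF a a] using that a by simp
    qed
    also have "\<dots> = part_proj \<zeta> a x" using a by (simp add: pi pc)
    finally show "part_proj \<zeta> a (finsum (T n) ?g ?S) = part_proj \<zeta> a x" .
  qed
qed

section \<open>The Morse matching\<close>

lemma matching_iff:
  "(b, a) \<in> M \<longleftrightarrow> (\<exists>p n. b = (p, K_part, n) \<and> a = (p, B_part, n - 1) \<and>
     carrier (Kp p n) \<noteq> {\<zero>\<^bsub>Kp p n\<^esub>})"
  by (auto simp: kb_matching_def)

lemma matched_parts_eq: "P (p, K_part, n) = P (p, B_part, n - 1)"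
  by (simp add: Kp_eq)

lemma nontrivial_iff:
  "(p, K_part, n) \<in> idx n \<longleftrightarrow> carrier (Kp p n) \<noteq> {\<zero>\<^bsub>Kp p n\<^esub>}"
  "(p, B_part, n) \<in> idx n \<longleftrightarrow> carrier (B p n) \<noteq> {\<zero>\<^bsub>B p n\<^esub>}"
  "(p, H_part, n) \<in> idx n"
proof -
  have "Inr ` A \<noteq> {Inr z} \<longleftrightarrow> A \<noteq> {z}" for A :: "'v set" and z :: 'v
    by (auto simp: set_eq_iff image_iff)
  then show "(p, K_part, n) \<in> idx n \<longleftrightarrow> carrier (Kp p n) \<noteq> {\<zero>\<^bsub>Kp p n\<^esub>}"
    "(p, B_part, n) \<in> idx n \<longleftrightarrow> carrier (B p n) \<noteq> {\<zero>\<^bsub>B p n\<^esub>}"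
    "(p, H_part, n) \<in> idx n"
    by (simp_all add: part_idx_iff relabel_simps)
qed

lemma idx_degree: "(p, V, m) \<in> idx n \<Longrightarrow> m = n"
  by (simp add: part_idx_iff)

lemma entry_eq: "bentry X n (p, V, m) b w = c_part p V m (d n (part_incl C d \<zeta> b w) p)"
  by (simp add: bentry_def part_proj_eq)

text \<open>
  Over a single \<open>p\<close>, the differential has just one nonzero block, and it is the identity since
  \<open>K\<^sup>p\<^sub>n\<close> and \<open>B\<^sup>p\<^sub>n\<^sub>-\<^sub>1\<close> are the same space.
\<close>
lemma entry_diagonal:
  assumes w: "w \<in> carrier (P (p, W, n))"
  shows "bentry X n (p, V, n - 1) (p, W, n) w =
    (if V = B_part \<and> W = K_part then w else \<zero>\<^bsub>P (p, V, n - 1)\<^esub>)"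
proof -
  have "bentry X n (p, V, n - 1) (p, W, n) w = c_part p V (n - 1) (rel_diff C d p n (c_in p W n w))"
    by (simp add: entry_eq part_incl_eq rel_diff_def)
  also have "\<dots> = (if V = B_part \<and> W = K_part then w else \<zero>\<^bsub>P (p, V, n - 1)\<^esub>)"
  proof (cases W)
    case H_part
    with w show ?thesis using c_part_zero[of p _ "n - 1"] by (auto simp: relabel_simps)
  next
    case B_part
    with w show ?thesis using c_part_zero[of p _ "n - 1"] by (auto simp: relabel_simps)
  next
    case K_part
    with w obtain k where k: "w = Inr k" "k \<in> carrier (Kp p n)" by (auto simp: relabel_simps)
    have wB: "w \<in> carrier (P (p, B_part, n - 1))" using w K_part by (simp only: matched_parts_eq)
    have "rel_diff C d p n (c_in p W n w) = c_in p B_part (n - 1) w"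
      using k K_part by simp
    then show ?thesis using K_part c_part_in[OF wB, of V]
      by (simp del: c_in.simps c_part.simps part_space.simps)
  qed
  finally show ?thesis .
qed

lemma entry_filtered:
  assumes w: "w \<in> carrier (P (q, W, n))"
    and nz: "bentry X n (p, V, n - 1) (q, W, n) w \<noteq> \<zero>\<^bsub>P (p, V, n - 1)\<^esub>"
  shows "p \<le> q"
proof -
  have "d n (gincl C n q (c_in q W n w)) p \<noteq> \<zero>\<^bsub>C p (n - 1)\<^esub>"
    using nz c_part_zero[of p V "n - 1"] by (auto simp: entry_eq part_incl_eq)
  then show ?thesis using filtered_d[of n] c_in_closed[OF w] unfolding filtered_def by blast
qed

lemma edges_iff:
  "(b, a) \<in> edges X \<longleftrightarrow> (\<exists>n. b \<in> idx n \<and> a \<in> idx (n - 1) \<and>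
     (\<exists>w\<in>carrier (P b). bentry X n a b w \<noteq> \<zero>\<^bsub>P a\<^esub>))"
  by (simp add: edges_def)

lemma edges_in_degree:
  assumes "b \<in> idx n"
  shows "(b, a) \<in> edges X \<longleftrightarrow> a \<in> idx (n - 1) \<and> (\<exists>w\<in>carrier (P b). bentry X n a b w \<noteq> \<zero>\<^bsub>P a\<^esub>)"
proof -
  have "m = n" if "b \<in> idx m" for m using that assms by (auto simp: part_idx_def)
  then show ?thesis unfolding edges_iff using assms by blast
qed

text \<open>
  An edge weakly lowers \<open>p\<close> because \<open>d\<close> is filtered, and an edge over a single \<open>p\<close> is matched.
\<close>
lemma unmatched_edge_less:
  assumes e: "((q, W, n), (p, V, m)) \<in> edges X - M"
  shows "p < q"
proof -
  have qi: "(q, W, n) \<in> idx n" using e by (auto simp: edges_iff part_idx_def)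
  then have pi: "(p, V, m) \<in> idx (n - 1)" using e by (simp add: edges_in_degree)
  then have m: "m = n - 1" by (simp add: part_idx_iff)
  obtain w where w: "w \<in> carrier (P (q, W, n))"
      "bentry X n (p, V, n - 1) (q, W, n) w \<noteq> \<zero>\<^bsub>P (p, V, n - 1)\<^esub>"
    using e qi m by (auto simp: edges_in_degree)
  have "p \<noteq> q"
  proof
    assume "p = q"
    with w entry_diagonal have "V = B_part" "W = K_part" by (metis)+
    with e \<open>p = q\<close> m qi show False by (auto simp: matching_iff nontrivial_iff)
  qed
  with entry_filtered[OF w] show ?thesis by simp
qed

lemma matching_idx:
  assumes "(b, a) \<in> M" "b \<in> idx n"
  obtains p where "b = (p, K_part, n)" "a = (p, B_part, n - 1)"
  using assms by (auto simp: matching_iff part_idx_def)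

lemma matched_entry:
  assumes "w \<in> carrier (P (p, K_part, n))"
  shows "bentry X n (p, B_part, n - 1) (p, K_part, n) w = w"
  using entry_diagonal[OF assms] by simp

lemma matching_edges: "M \<subseteq> edges X"
proof
  fix e assume "e \<in> M"
  then obtain p n where e: "e = ((p, K_part, n), (p, B_part, n - 1))"
      and nt: "carrier (Kp p n) \<noteq> {\<zero>\<^bsub>Kp p n\<^esub>}"
    by (auto simp: kb_matching_def)
  have i: "(p, K_part, n) \<in> idx n" "(p, B_part, n - 1) \<in> idx (n - 1)"
    using nt by (simp_all add: nontrivial_iff Kp_eq)
  have "carrier (P (p, K_part, n)) \<noteq> {\<zero>\<^bsub>P (p, K_part, n)\<^esub>}" using i(1) by (simp add: part_idx_iff del: part_space.simps)
  then obtain w where w: "w \<in> carrier (P (p, K_part, n))" "w \<noteq> \<zero>\<^bsub>P (p, K_part, n)\<^esub>"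
    using P_zero_closed[of "(p, K_part, n)"] by blast
  then have "bentry X n (p, B_part, n - 1) (p, K_part, n) w \<noteq> \<zero>\<^bsub>P (p, B_part, n - 1)\<^esub>"
    using matched_entry[OF w(1)] matched_parts_eq[of p n] by simp
  with w(1) i show "e \<in> edges X" unfolding e edges_in_degree[OF i(1)] by blast
qed

text \<open>
  A reversed matching edge keeps \<open>p\<close> fixed.  So along a path of length two between indices of equal
  degree, one step of which is a reversed edge, \<open>p\<close> drops strictly, and the order on \<open>p\<close> provides
  the required order on indices.
\<close>
lemma morse_matching_kb: "morse_matching K X M"
  unfolding morse_matching_def
proof (intro conjI allI impI)
  show "partial_matching X M"
    unfolding partial_matching_def using matching_edges by (auto simp: kb_matching_def)
  show "lin_iso K (bsum X b) (bsum X a) (bentry X n a b)" if "(b, a) \<in> M \<and> b \<in> bidx X n" for n a b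
  proof -
    from that have "(b, a) \<in> M" "b \<in> idx n" by simp_all
    then obtain p where ab: "b = (p, K_part, n)" "a = (p, B_part, n - 1)" by (rule matching_idx)
    \<comment> \<open>The summands at \<open>a\<close> and \<open>b\<close> are the same space and the entry is its identity.\<close>
    have "linear_map K (P b) (P b) (bentry X n a b)"
      by (rule linear_map_cong[OF linear_map_ident[OF part_vectorspace]]) (simp only: ab matched_entry)
    moreover have "bij_betw (bentry X n a b) (carrier (P b)) (carrier (P b))"
      using bij_betw_id by (rule bij_betw_cong[THEN iffD1, rotated]) (simp only: ab matched_entry id_apply)
    moreover have "P a = P b" unfolding ab by (rule matched_parts_eq[symmetric])
    ultimately show ?thesis by (simp add: lin_iso_def)
  qed
  define r where "r n = {(b, a). b \<in> idx n \<and> a \<in> idx n \<and> (b = a \<or> fst b < fst a)}" for n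
  show "\<exists>r. \<forall>n. partial_order_on (bidx X n) (r n) \<and> wf (r n - Id) \<and>
        (\<forall>a\<in>bidx X n. \<forall>b\<in>bidx X n. \<forall>c. a \<noteq> b \<and>
           ((a, c) \<in> edges X - M \<and> (c, b) \<in> M\<inverse> \<or> (a, c) \<in> M\<inverse> \<and> (c, b) \<in> edges X - M)
           \<longrightarrow> (b, a) \<in> r n)"
  proof (intro exI[of _ r] allI conjI ballI impI)
    fix n
    show "partial_order_on (bidx X n) (r n)"
      unfolding partial_order_on_def preorder_on_def
      by (auto simp: r_def refl_on_def trans_def antisym_def)
    have "wf {(b, a). fst b < (fst a :: 'p)}"
      using wf_inv_image[OF wf[unfolded wfp_def], of fst] by (simp add: inv_image_def)
    then show "wf (r n - Id)" by (rule wf_subset) (auto simp: r_def)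
  next
    fix n a b c
    assume ab: "a \<in> bidx X n" "b \<in> bidx X n"
      and e: "a \<noteq> b \<and> ((a, c) \<in> edges X - M \<and> (c, b) \<in> M\<inverse> \<or> (a, c) \<in> M\<inverse> \<and> (c, b) \<in> edges X - M)"
    obtain p V l q W m where abc: "a = (p, V, l)" "b = (q, W, m)" by (cases a, cases b) auto
    from e have "q < p"
      unfolding abc by (auto simp: matching_iff dest!: unmatched_edge_less[OF DiffI])
    with ab show "(b, a) \<in> r n" by (simp add: r_def abc)
  qed
qed

lemma critical_eq: "critical X M n = {(p, H_part, n) | p. True}"
proof (intro Set.set_eqI iffI)
  fix a :: "'p \<times> part \<times> int" assume a: "a \<in> critical X M n"
  then obtain p V where pV: "a = (p, V, n)" by (auto simp: critical_def part_idx_def)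
  show "a \<in> {(p, H_part, n) | p. True}"
  proof (cases V)
    case H_part
    then show ?thesis using pV by simp
  next
    case B_part
    then have "((p, K_part, n + 1), a) \<in> M"
      using a pV by (simp add: critical_def nontrivial_iff matching_iff Kp_eq)
    then show ?thesis using a by (force simp: critical_def)
  next
    case K_part
    then have "(a, (p, B_part, n - 1)) \<in> M"
      using a pV by (simp add: critical_def nontrivial_iff matching_iff)
    then show ?thesis using a by (force simp: critical_def)
  qed
next
  fix a :: "'p \<times> part \<times> int" assume "a \<in> {(p, H_part, n) | p. True}"
  then show "a \<in> critical X M n"
    by (auto simp: critical_def nontrivial_iff kb_matching_def)
qed

section \<open>Comparison of the two constructions\<close>

lemma sk_space_eq: "sk_space X M n = dsum {(p, H_part, n) | p. True} P"
  by (simp add: sk_space_def critical_eq)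

lemma reindex_iso: "lin_iso K (total_space H n) (sk_space X M n) (reindex n)"
proof -
  let ?I = "{(p :: 'p, H_part, n) | p. True}"
  have fin: "finite {a \<in> ?I. Inl (y (fst a)) \<noteq> \<zero>\<^bsub>P a\<^esub>} \<longleftrightarrow> finite {p. y p \<noteq> \<zero>\<^bsub>H p n\<^esub>}" for y
  proof -
    have "{a \<in> ?I. Inl (y (fst a)) \<noteq> \<zero>\<^bsub>P a\<^esub>} = (\<lambda>p. (p, H_part, n)) ` {p. y p \<noteq> \<zero>\<^bsub>H p n\<^esub>}"
      by (auto simp: relabel_simps)
    moreover have "inj (\<lambda>p. (p, H_part, n))" by (simp add: inj_on_def)
    ultimately show ?thesis by (simp add: finite_image_iff inj_on_def)
  qed
  have eq: "reindex n = (\<lambda>y. \<lambda>a\<in>?I. Inl (y (fst a)))" by (simp add: reindex_def fun_eq_iff)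
  have lin: "linear_map K (total_space H n) (dsum ?I P) (reindex n)"
    unfolding eq
  proof (rule linear_map_into_dsum[OF field H.T.vectorspace_axioms])
    fix a assume "a \<in> ?I"
    then obtain p where a: "a = (p, H_part, n)" by auto
    show "linear_map K (total_space H n) (P a) (\<lambda>y. Inl (y (fst a)))"
      using linear_map_comp[OF H.linear_proj relabel_linear[OF HBK_spaces(1) inj_Inl], of n p] by (simp add: a)
  next
    fix y assume "y \<in> carrier (total_space H n)"
    then show "finite {a \<in> ?I. Inl (y (fst a)) \<noteq> \<zero>\<^bsub>P a\<^esub>}" unfolding fin by (simp add: total_space_carrier)
  qed
  moreover have "bij_betw (reindex n) (carrier (total_space H n)) (carrier (dsum ?I P))"
    unfolding bij_betw_def
  proof
    show "inj_on (reindex n) (carrier (total_space H n))"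
    proof (rule inj_onI, rule ext)
      fix x y :: "'p \<Rightarrow> 'v set" and p assume "reindex n x = reindex n y"
      from fun_cong[OF this, of "(p, H_part, n)"] show "x p = y p" by (simp add: reindex_def)
    qed
    show "reindex n ` carrier (total_space H n) = carrier (dsum ?I P)"
    proof
      show "reindex n ` carrier (total_space H n) \<subseteq> carrier (dsum ?I P)"
        using linear_map_closed[OF lin] by auto
      show "carrier (dsum ?I P) \<subseteq> reindex n ` carrier (total_space H n)"
      proof
        fix z assume z: "z \<in> carrier (dsum ?I P)"
        define y where "y p = projl (z (p, H_part, n))" for p
        have zp: "z (p, H_part, n) \<in> Inl ` carrier (H p n)" for p
          using z by (auto simp: dsum_carrier relabel_simps dest!: PiE_mem[where x = "(p, H_part, n)"])
        then have yI: "z (p, H_part, n) = Inl (y p)" "y p \<in> carrier (H p n)" for p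
          unfolding y_def by (metis imageE sum.sel(1))+
        have zy: "z = reindex n y"
        proof
          fix a show "z a = reindex n y a"
          proof (cases "a \<in> ?I")
            case True
            then show ?thesis by (auto simp: reindex_def yI)
          next
            case False
            then have "z a = undefined"
              using z by (intro PiE_arb[of z ?I "\<lambda>a. carrier (P a)"]) (simp_all add: dsum_carrier)
            with False show ?thesis by (auto simp: reindex_def)
          qed
        qed
        have "{a \<in> ?I. z a \<noteq> \<zero>\<^bsub>P a\<^esub>} = {a \<in> ?I. Inl (y (fst a)) \<noteq> \<zero>\<^bsub>P a\<^esub>}"
          using yI(1) by auto
        then have "finite {p. y p \<noteq> \<zero>\<^bsub>H p n\<^esub>}"
          using z fin[of y] by (simp only: dsum_carrier)
        then have "y \<in> carrier (total_space H n)" using yI by (simp add: total_space_carrier)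
        with zy show "z \<in> reindex n ` carrier (total_space H n)" by blast
      qed
    qed
  qed
  ultimately show ?thesis by (simp add: lin_iso_def sk_space_eq)
qed

lemma sk_f0_eq: "sk_f0 X M n x = reindex n (\<alpha> n x)"
  unfolding sk_f0_def reindex_def critical_eq
  by (rule restrict_ext) (auto simp: \<alpha>_eq h_part_def)

lemma sk_g0_eq:
  assumes y: "y \<in> carrier (total_space H n)"
  shows "sk_g0 X M n (reindex n y) = \<beta> n y"
  unfolding sk_g0_def critical_eq hbk_simps
proof (rule C.lfsum_gincl[where \<pi> = fst])
  show "\<beta> n y \<in> carrier (T n)" by (rule linear_map_closed[OF \<beta>_linear y])
  show "inj_on fst {(p, H_part, n) | p. True}" by (auto simp: inj_on_def)
  fix a assume "a \<in> {(p :: 'p, H_part, n) | p. True}"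
  then show "part_incl C d \<zeta> a (reindex n y a) = gincl C n (fst a) (\<beta> n y (fst a))"
    by (auto simp: reindex_def \<beta>_eq h_in_def)
next
  fix p :: 'p assume "p \<notin> fst ` {(p, H_part, n) | p. True}"
  then show "\<beta> n y p = \<zero>\<^bsub>C p n\<^esub>" by force
qed

text \<open>
  Each matched entry is the identity, so its inverse is too: the sum over the matching sends the
  \<open>B\<close>-component over \<open>p\<close> to the \<open>K\<close>-component over \<open>p\<close>, one degree higher.
\<close>
lemma sk_h0_eq:
  assumes x: "x \<in> carrier (T n)"
  shows "sk_h0 X M n x = \<gamma> n x"
proof -
  define y where "y p = k_in p (n + 1) (b_part p n (x p))" for p
  have "linear_map K (C p n) (C p (n + 1)) (\<lambda>v. k_in p (n + 1) (b_part p n v))" for p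
    using linear_map_comp[OF part_linear(2) in_linear(3)[of p "n + 1", unfolded Kp_eq(2)]] .
  from componentwise_closed[of K C n C "n + 1" "\<lambda>p v. k_in p (n + 1) (b_part p n v)", OF this x]
  have y: "y \<in> carrier (T (n + 1))" by (simp add: y_def[abs_def])
  let ?A = "{(b, a). (b, a) \<in> M \<and> b \<in> idx (n + 1) \<and> a \<in> idx n}"
  have A: "e \<in> ?A \<longleftrightarrow> (\<exists>p. e = ((p, K_part, n + 1), (p, B_part, n)) \<and> carrier (B p n) \<noteq> {\<zero>\<^bsub>B p n\<^esub>})" for e
    by (cases e) (auto simp: matching_iff nontrivial_iff Kp_eq dest: idx_degree)
  have "lfsum (T (n + 1))
      (\<lambda>(b, a). part_incl C d \<zeta> b (inv_into (carrier (P b)) (bentry X (n + 1) a b) (part_proj \<zeta> a x))) ?A = y"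
  proof (rule C.lfsum_gincl[OF y, where \<pi> = "\<lambda>e. fst (fst e)"])
    show "inj_on (\<lambda>e. fst (fst e)) ?A" unfolding inj_on_def Ball_def A by auto
    fix e assume "e \<in> ?A"
    then obtain p where e: "e = ((p, K_part, n + 1), (p, B_part, n))" unfolding A by auto
    let ?w = "part_proj \<zeta> (p, B_part, n) x"
    have Pe: "P (p, K_part, n + 1) = P (p, B_part, n)" by (simp add: Kp_eq)
    have w: "?w \<in> carrier (P (p, K_part, n + 1))"
      unfolding Pe part_proj_eq by (rule c_part_closed[OF C.proj_closed[OF x]])
    have id: "bentry X (n + 1) (p, B_part, n) (p, K_part, n + 1) v = v" if "v \<in> carrier (P (p, K_part, n + 1))" for v
      using matched_entry[OF that] by simp
    have "inv_into (carrier (P (p, K_part, n + 1))) (bentry X (n + 1) (p, B_part, n) (p, K_part, n + 1)) ?w = ?w"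
    proof (rule inv_into_f_eq)
      show "inj_on (bentry X (n + 1) (p, B_part, n) (p, K_part, n + 1)) (carrier (P (p, K_part, n + 1)))"
        by (rule inj_onI) (simp only: id)
    qed (rule w, rule id[OF w])
    then show "(case e of (b, a) \<Rightarrow> part_incl C d \<zeta> b (inv_into (carrier (P b)) (bentry X (n + 1) a b) (part_proj \<zeta> a x)))
        = gincl C (n + 1) (fst (fst e)) (y (fst (fst e)))"
      unfolding e by (simp only: prod.case part_incl_eq fst_conv y_def part_proj_eq c_part.simps c_in.simps sum.sel)
  next
    fix p assume "p \<notin> (\<lambda>e. fst (fst e)) ` ?A"
    then have "((p, K_part, n + 1), (p, B_part, n)) \<notin> ?A" by force
    then have "carrier (B p n) = {\<zero>\<^bsub>B p n\<^esub>}" unfolding A by simp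
    then have "b_part p n (x p) = \<zero>\<^bsub>B p n\<^esub>" using part_closed(2)[OF C.proj_closed[OF x]] by blast
    then show "y p = \<zero>\<^bsub>C p (n + 1)\<^esub>" using in_zero(3)[of p "n + 1"] by (simp add: y_def Kp_eq)
  qed
  then have "sk_h0 X M n x = \<ominus>\<^bsub>T (n + 1)\<^esub> y" by (simp only: sk_h0_def hbk_simps)
  also have "\<dots> = \<gamma> n x" using y by (simp add: fun_eq_iff C.total_space_neg \<gamma>_eq \<gamma>p_def y_def)
  finally show ?thesis .
qed

text \<open>
  Subtracting the block diagonal from \<open>d\<close> clears the entries over a single \<open>p\<close>.  These are either
  zero or matched, while no entry between different \<open>p\<close> is matched.
\<close>
lemma \<delta>_entry:
  assumes b: "b \<in> idx n" and a: "a \<in> idx (n - 1)" and w: "w \<in> carrier (P b)"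
  shows "part_proj \<zeta> a (\<delta> n (part_incl C d \<zeta> b w)) =
    (if (b, a) \<in> edges X - M then bentry X n a b w else \<zero>\<^bsub>P a\<^esub>)"
proof -
  obtain q W where bq: "b = (q, W, n)" using b by (auto simp: part_idx_def)
  obtain p V where ap: "a = (p, V, n - 1)" using a by (auto simp: part_idx_def)
  let ?z = "part_incl C d \<zeta> b w"
  have z: "?z \<in> carrier (T n)" by (rule linear_map_closed[OF part_incl_linear[OF b] w])
  have dz: "d n ?z \<in> carrier (T (n - 1))" "t n ?z \<in> carrier (T (n - 1))"
    by (rule linear_map_closed[OF d_linear z], rule linear_map_closed[OF t_linear z])
  interpret Pa: vectorspace K "P a" by (rule part_vectorspace)
  have ec: "bentry X n a b w \<in> carrier (P a)"
    using linear_map_closed[OF part_proj_linear[OF a] dz(1)] by (simp add: bentry_def)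
  have "part_proj \<zeta> a (\<delta> n ?z) = bentry X n a b w \<ominus>\<^bsub>P a\<^esub> part_proj \<zeta> a (t n ?z)"
    using linear_map_minus[OF part_proj_linear[OF a] dz] by (simp add: hd_delta_def dhat_eq[OF z] bentry_def)
  also have "part_proj \<zeta> a (t n ?z) = (if p = q then bentry X n a b w else \<zero>\<^bsub>P a\<^esub>)"
    by (simp add: ap bq part_proj_eq t_def entry_eq part_incl_eq gincl_apply rel_diff_def[symmetric]
        linear_map_zero[OF rel_diff_linear] c_part_zero)
  finally have eq: "part_proj \<zeta> a (\<delta> n ?z) = (if p = q then \<zero>\<^bsub>P a\<^esub> else bentry X n a b w)"
    using ec by (simp add: a_minus_def Pa.M.r_neg)
  show ?thesis
  proof (cases "p = q")
    case True
    then have "(b, a) \<notin> edges X - M" using unmatched_edge_less[of q W n p V "n - 1"] by (auto simp: ap bq)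
    with True eq show ?thesis by auto
  next
    case False
    then have "(b, a) \<notin> M" by (auto simp: ap bq matching_iff)
    moreover have "bentry X n a b w = \<zero>\<^bsub>P a\<^esub>" if "(b, a) \<notin> edges X"
      using that a w unfolding edges_in_degree[OF b] by blast
    ultimately show ?thesis using False eq by auto
  qed
qed

text \<open>
  The left hand side is a sum over edges, the right hand side is determined by its entries.  They
  are compared component by component: the component at \<open>a\<close> of the sum over edges only sees the
  edges that end in \<open>a\<close>, and these are indexed by their sources \<open>b\<close>.
\<close>
lemma sk_tau_eq:
  assumes x: "x \<in> carrier (T n)"
  shows "sk_tau X M n x = \<delta> n x"
proof -
  let ?F = "\<lambda>(b, a). part_incl C d \<zeta> a (bentry X n a b (part_proj \<zeta> b x))"
  let ?A = "{(b, a). (b, a) \<in> edges X - M \<and> b \<in> idx n \<and> a \<in> idx (n - 1)}"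
  let ?S = "{e \<in> ?A. ?F e \<noteq> \<zero>\<^bsub>T (n - 1)\<^esub>}"
  let ?B = "{b \<in> idx n. part_proj \<zeta> b x \<noteq> \<zero>\<^bsub>P b\<^esub>}"
  have pc: "part_proj \<zeta> b x \<in> carrier (P b)" if "b \<in> idx n" for b
    by (rule linear_map_closed[OF part_proj_linear[OF that] x])
  define z where "z b = part_incl C d \<zeta> b (part_proj \<zeta> b x)" for b
  have zc: "z b \<in> carrier (T n)" if "b \<in> idx n" for b
    unfolding z_def by (rule linear_map_closed[OF part_incl_linear[OF that] pc[OF that]])
  have dzc: "d n (z b) \<in> carrier (T (n - 1))" if "b \<in> idx n" for b
    by (rule linear_map_closed[OF d_linear zc[OF that]])
  have entry: "bentry X n a b (part_proj \<zeta> b x) = part_proj \<zeta> a (d n (z b))" for a b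
    by (simp add: bentry_def z_def)
  have ec: "part_proj \<zeta> a (d n (z b)) \<in> carrier (P a)" if "b \<in> idx n" "a \<in> idx (n - 1)" for a b
    by (rule linear_map_closed[OF part_proj_linear[OF that(2)] dzc[OF that(1)]])
  have Fc: "?F e \<in> carrier (T (n - 1))" if "e \<in> ?A" for e
    using that linear_map_closed[OF part_incl_linear ec] by (auto simp: entry)
  have zero: "part_proj \<zeta> a (d n (z b)) = \<zero>\<^bsub>P a\<^esub>" if "b \<in> idx n" "b \<notin> ?B" "a \<in> idx (n - 1)" for a b
    using that linear_map_zero[OF part_incl_linear[OF that(1)]] linear_map_zero[OF d_linear]
      linear_map_zero[OF part_proj_linear[OF that(3)]] by (simp add: z_def)
  have finB: "finite ?B" by (rule part_proj_support[OF x])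
  \<comment> \<open>Finitely many sources \<open>b\<close> have a nonzero component of \<open>x\<close>, and for each of them \<open>d\<close> applied
    to that component has finitely many nonzero components.\<close>
  have finS: "finite ?S"
  proof (rule finite_subset)
    show "?S \<subseteq> Sigma ?B (\<lambda>b. {a \<in> idx (n - 1). part_proj \<zeta> a (d n (z b)) \<noteq> \<zero>\<^bsub>P a\<^esub>})"
    proof
      fix e assume e: "e \<in> ?S"
      then obtain b a where ba: "e = (b, a)" "b \<in> idx n" "a \<in> idx (n - 1)"
          "part_incl C d \<zeta> a (part_proj \<zeta> a (d n (z b))) \<noteq> \<zero>\<^bsub>T (n - 1)\<^esub>"
        by (auto simp: entry)
      then have "part_proj \<zeta> a (d n (z b)) \<noteq> \<zero>\<^bsub>P a\<^esub>"
        using linear_map_zero[OF part_incl_linear[OF ba(3)]] by metis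
      moreover from this have "b \<in> ?B" using zero ba by blast
      ultimately show "e \<in> Sigma ?B (\<lambda>b. {a \<in> idx (n - 1). part_proj \<zeta> a (d n (z b)) \<noteq> \<zero>\<^bsub>P a\<^esub>})"
        using ba by blast
    qed
    show "finite (Sigma ?B (\<lambda>b. {a \<in> idx (n - 1). part_proj \<zeta> a (d n (z b)) \<noteq> \<zero>\<^bsub>P a\<^esub>}))"
      using finB part_proj_support[OF dzc] by (intro finite_SigmaI) auto
  qed
  have \<tau>: "sk_tau X M n x = finsum (T (n - 1)) ?F ?S"
    unfolding sk_tau_def lfsum_def hbk_simps ..
  show ?thesis
  proof (rule coordinates_eqI)
    show "sk_tau X M n x \<in> carrier (T (n - 1))"
      unfolding \<tau> using Fc by (intro C.T.M.finsum_closed) auto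
    show "\<delta> n x \<in> carrier (T (n - 1))" by (rule linear_map_closed[OF \<delta>_linear x])
    fix a assume a: "a \<in> idx (n - 1)"
    interpret Pa: vectorspace K "P a" by (rule part_vectorspace)
    let ?e = "\<lambda>b. part_proj \<zeta> a (d n (z b))"
    let ?B' = "{b \<in> ?B. (b, a) \<in> edges X - M}"
    have "part_proj \<zeta> a (sk_tau X M n x) = finsum (P a) (\<lambda>e. part_proj \<zeta> a (?F e)) ?S"
      unfolding \<tau> by (rule linear_map_finsum[OF part_proj_linear[OF a] finS]) (use Fc in blast)
    also have "\<dots> = finsum (P a) (\<lambda>e. if snd e = a then ?e (fst e) else \<zero>\<^bsub>P a\<^esub>) ?S"
    proof (rule Pa.M.add.finprod_cong'[OF refl])
      show "(\<lambda>e. if snd e = a then ?e (fst e) else \<zero>\<^bsub>P a\<^esub>) \<in> ?S \<rightarrow> carrier (P a)"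
        using ec[OF _ a] by auto
      fix e assume e: "e \<in> ?S"
      obtain b c where bc: "e = (b, c)" by (cases e)
      with e have "b \<in> idx n" "c \<in> idx (n - 1)" by auto
      then show "part_proj \<zeta> a (?F e) = (if snd e = a then ?e (fst e) else \<zero>\<^bsub>P a\<^esub>)"
        using part_proj_incl[OF ec[of b c] _ a] by (simp add: bc entry)
    qed
    also have "\<dots> = finsum (P a) (\<lambda>e. if snd e = a then ?e (fst e) else \<zero>\<^bsub>P a\<^esub>) ((\<lambda>b. (b, a)) ` ?B')"
    proof (rule Pa.M.add.finprod_mono_neutral_cong)
      show "finite ((\<lambda>b. (b, a)) ` ?B')" by (rule finite_imageI, rule finite_subset[OF _ finB]) auto
      show "finite ?S" by (rule finS)
      show "(if snd e = a then ?e (fst e) else \<zero>\<^bsub>P a\<^esub>) = \<zero>\<^bsub>P a\<^esub>" if e: "e \<in> (\<lambda>b. (b, a)) ` ?B' - ?S" for e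
      proof -
        obtain b where b: "e = (b, a)" "b \<in> ?B'" using e by blast
        with e a have "part_incl C d \<zeta> a (?e b) = \<zero>\<^bsub>T (n - 1)\<^esub>" by (auto simp: entry)
        then have "?e b = \<zero>\<^bsub>P a\<^esub>"
          using part_proj_incl[OF ec[of b a] a a] b a linear_map_zero[OF part_proj_linear[OF a]] by simp
        with b show ?thesis by simp
      qed
      show "(if snd e = a then ?e (fst e) else \<zero>\<^bsub>P a\<^esub>) = \<zero>\<^bsub>P a\<^esub>" if "e \<in> ?S - (\<lambda>b. (b, a)) ` ?B'" for e
      proof (cases "snd e = a")
        case True
        then obtain b where b: "e = (b, a)" by (cases e) auto
        with that have "b \<in> idx n" "b \<notin> ?B" by auto
        with zero a show ?thesis by (simp add: b)
      qed simp
      show "(\<lambda>e. if snd e = a then ?e (fst e) else \<zero>\<^bsub>P a\<^esub>) \<in> ?S \<rightarrow> carrier (P a)"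
        "(\<lambda>e. if snd e = a then ?e (fst e) else \<zero>\<^bsub>P a\<^esub>) \<in> (\<lambda>b. (b, a)) ` ?B' \<rightarrow> carrier (P a)"
        using ec[OF _ a] by auto
    qed simp
    also have "\<dots> = finsum (P a) ?e ?B'"
    proof (subst Pa.M.add.finprod_reindex)
      show "(\<lambda>e. if snd e = a then ?e (fst e) else \<zero>\<^bsub>P a\<^esub>) \<in> (\<lambda>b. (b, a)) ` ?B' \<rightarrow> carrier (P a)"
        using ec[OF _ a] by auto
      show "inj_on (\<lambda>b. (b, a)) ?B'" by (simp add: inj_on_def)
    qed simp
    also have "\<dots> = finsum (P a) (\<lambda>b. part_proj \<zeta> a (\<delta> n (z b))) ?B"
    proof -
      have \<delta>e: "part_proj \<zeta> a (\<delta> n (z b)) = (if (b, a) \<in> edges X - M then ?e b else \<zero>\<^bsub>P a\<^esub>)" if "b \<in> idx n" for b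
        using \<delta>_entry[OF that a pc[OF that]] by (simp add: entry z_def[symmetric])
      show ?thesis
        by (rule Pa.M.add.finprod_mono_neutral_cong_left[OF finB]) (use \<delta>e ec[OF _ a] in auto)
    qed
    also have "\<dots> = part_proj \<zeta> a (finsum (T (n - 1)) (\<lambda>b. \<delta> n (z b)) ?B)"
      by (rule linear_map_finsum[OF part_proj_linear[OF a] finB, symmetric])
         (use linear_map_closed[OF \<delta>_linear zc] in blast)
    also have "finsum (T (n - 1)) (\<lambda>b. \<delta> n (z b)) ?B = \<delta> n (finsum (T n) z ?B)"
      by (rule linear_map_finsum[OF \<delta>_linear finB, symmetric]) (use zc in blast)
    also have "finsum (T n) z ?B = x" using part_expansion[OF x] by (simp add: z_def[abs_def])
    finally show "part_proj \<zeta> a (sk_tau X M n x) = part_proj \<zeta> a (\<delta> n x)" .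
  qed
qed

text \<open>
  The inverse of \<open>1 - h \<tau>\<close> is taken on the carrier, so it depends only on the values of \<open>h\<close> and
  \<open>\<tau>\<close> there.
\<close>
lemma sk_S_eq:
  assumes x: "x \<in> carrier (T n)"
  shows "sk_S X M n x = S n x"
proof -
  have eq: "z \<ominus>\<^bsub>T n\<^esub> sk_h0 X M (n - 1) (sk_tau X M n z) = z \<ominus>\<^bsub>T n\<^esub> \<gamma> (n - 1) (\<delta> n z)"
    if "z \<in> carrier (T n)" for z
    using that by (simp add: sk_tau_eq sk_h0_eq)
  have "inv_into (carrier (T n)) (\<lambda>z. z \<ominus>\<^bsub>T n\<^esub> sk_h0 X M (n - 1) (sk_tau X M n z)) x =
      inv_into (carrier (T n)) (\<lambda>z. z \<ominus>\<^bsub>T n\<^esub> \<gamma> (n - 1) (\<delta> n z)) x"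
    unfolding inv_into_def using eq by (intro arg_cong[of _ _ Eps]) (auto simp: fun_eq_iff)
  moreover have "inv_into (carrier (T n)) (\<lambda>z. z \<ominus>\<^bsub>T n\<^esub> \<gamma> (n - 1) (\<delta> n z)) x \<in> carrier (T n)"
    by (rule inv_into_into) (simp add: bij_betw_imp_surj_on[OF one_minus_bij] x)
  ultimately show ?thesis by (simp add: sk_S_def S_def pert_S_def sk_tau_eq)
qed

lemma sk_nilpotent: "locally_nilpotent (T n) (sk_h0 X M (n - 1) \<circ> sk_tau X M n)"
proof -
  let ?f = "sk_h0 X M (n - 1) \<circ> sk_tau X M n" and ?g = "\<gamma> (n - 1) \<circ> \<delta> n"
  have "(?f ^^ k) x = (?g ^^ k) x \<and> (?g ^^ k) x \<in> carrier (T n)" if "x \<in> carrier (T n)" for k x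
  proof (induction k)
    case 0
    then show ?case using that by simp
  next
    case (Suc k)
    then show ?case by (simp add: sk_tau_eq sk_h0_eq)
  qed
  then show ?thesis using nil[of n] by (simp add: locally_nilpotent_def)
qed

lemma sk_f_eq:
  assumes x: "x \<in> carrier (T n)"
  shows "sk_f X M n x = reindex n (bar_alpha C d \<zeta> n x)"
proof -
  have r: "linear_map K (total_space H n) (sk_space X M n) (reindex n)"
    using reindex_iso by (simp add: lin_iso_def)
  show ?thesis
    using x linear_map_add[OF r, of "\<alpha> n x" "\<alpha> n (S (n + 1) (\<gamma> n x))"]
    unfolding bar_eq[symmetric] by (simp add: sk_f_def pert_f_def sk_f0_eq sk_h0_eq sk_S_eq)
qed

lemma sk_d_eq:
  assumes "y \<in> carrier (total_space H n)"
  shows "sk_d X M n (reindex n y) = reindex (n - 1) (bar_d C d \<zeta> n y)"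
  using assms unfolding bar_eq[symmetric] by (simp add: sk_d_def pert_d_def sk_f0_eq sk_g0_eq sk_S_eq)

lemma sk_g_eq:
  assumes "y \<in> carrier (total_space H n)"
  shows "sk_g X M n (reindex n y) = bar_beta C d \<zeta> n y"
  using assms unfolding bar_eq[symmetric] by (simp add: sk_g_def pert_g_def sk_g0_eq sk_S_eq sk_h0_eq)

lemma sk_h_eq:
  assumes "x \<in> carrier (T n)"
  shows "sk_h X M n x = bar_gamma C d \<zeta> n x"
  using assms unfolding bar_eq[symmetric] by (simp add: sk_h_def pert_h_def sk_S_eq sk_h0_eq)

lemma sk_contraction:
  "contraction K T d (sk_space X M) (sk_d X M) (sk_f X M) (sk_g X M) (sk_h X M)"
proof (rule contraction_transport[OF contraction'[unfolded bar_eq] reindex_iso])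
qed (simp_all only: sk_d_eq sk_f_eq sk_g_eq sk_h_eq)

end

theorem proposition3p8:
  fixes K :: "('k, 'e) ring_scheme"
    and C :: "'p::order \<Rightarrow> int \<Rightarrow> ('k, 'v) module"
    and d :: "int \<Rightarrow> ('p \<Rightarrow> 'v) \<Rightarrow> ('p \<Rightarrow> 'v)"
    and \<zeta> :: "'p \<Rightarrow> int \<Rightarrow> 'v \<Rightarrow> 'v set \<times> 'v \<times> 'v"
  assumes "field K"
    and "wfp ((<) :: 'p \<Rightarrow> 'p \<Rightarrow> bool)"
    and "graded_complex K C d"
    and "homology_decomposition K C d \<zeta>"
  shows "based_complex K (hbk_based C d \<zeta>) \<and>
    morse_matching K (hbk_based C d \<zeta>) (kb_matching C d) \<and>
    (\<forall>n. locally_nilpotent (total_space C n)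
      (sk_h0 (hbk_based C d \<zeta>) (kb_matching C d) (n - 1) \<circ>
       sk_tau (hbk_based C d \<zeta>) (kb_matching C d) n)) \<and>
    (\<forall>n. locally_nilpotent (total_space C n) (hd_gamma C d \<zeta> (n - 1) \<circ> hd_delta C d n)) \<and>
    contraction K (total_space C) d
      (sk_space (hbk_based C d \<zeta>) (kb_matching C d))
      (sk_d (hbk_based C d \<zeta>) (kb_matching C d))
      (sk_f (hbk_based C d \<zeta>) (kb_matching C d))
      (sk_g (hbk_based C d \<zeta>) (kb_matching C d))
      (sk_h (hbk_based C d \<zeta>) (kb_matching C d)) \<and>
    filtered_contraction K C d (Hsp C d)
      (bar_d C d \<zeta>) (bar_alpha C d \<zeta>) (bar_beta C d \<zeta>) (bar_gamma C d \<zeta>) \<and>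
    (\<forall>n. critical (hbk_based C d \<zeta>) (kb_matching C d) n = {(p, H_part, n) | p. True} \<and>
      lin_iso K (total_space (Hsp C d) n) (sk_space (hbk_based C d \<zeta>) (kb_matching C d) n) (reindex n)) \<and>
    (\<forall>n. \<forall>y\<in>carrier (total_space (Hsp C d) n).
      sk_d (hbk_based C d \<zeta>) (kb_matching C d) n (reindex n y) =
      reindex (n - 1) (bar_d C d \<zeta> n y)) \<and>
    (\<forall>n. \<forall>x\<in>carrier (total_space C n).
      sk_f (hbk_based C d \<zeta>) (kb_matching C d) n x = reindex n (bar_alpha C d \<zeta> n x)) \<and>
    (\<forall>n. \<forall>y\<in>carrier (total_space (Hsp C d) n).
      sk_g (hbk_based C d \<zeta>) (kb_matching C d) n (reindex n y) = bar_beta C d \<zeta> n y) \<and>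
    (\<forall>n. \<forall>x\<in>carrier (total_space C n).
      sk_h (hbk_based C d \<zeta>) (kb_matching C d) n x = bar_gamma C d \<zeta> n x)"
proof -
  interpret decomposed_complex K C d \<zeta>
    by (rule decomposed_complex.intro) (rule assms)+
  show ?thesis
    by (intro conjI allI ballI based_complex_hbk morse_matching_kb sk_nilpotent \<gamma>\<delta>_nilpotent sk_contraction
        bar_filtered_contraction critical_eq reindex_iso sk_d_eq sk_f_eq sk_g_eq sk_h_eq)
qed

end
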